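(* Let $X_0,X_1,\dots,X_n$ be smooth vector fields on a domain $\Omega\subset\mathbb{R}^p$, free up to weight $r$ and satisfying Hörmander's condition of step $r$ in $\Omega$, and let $\Theta$, the coordinates $u$ and the notion of weight at a point be as in the context. For every multiindex $I$ the vector field $X_{[I]}$ has weight $\ge-|I|$ at any point of $\Omega$. If $Y_0,Y_1,\dots,Y_n$ is another system of smooth vector fields (expressed in the same coordinates $u$, near $u=0$) satisfying $$\sum_{I\in B}u_I\frac{\partial}{\partial u_I}=\sum_{I\in B}u_IY_{[I]},$$ then $X_{[I]}-Y_{[I]}$ has weight $\ge1-|I|$ at any point of $\Omega$. Moreover, for any point $\eta\in\Omega$ there exists a system of vector fields $R_{\eta,[I]}$, of weight $\ge1-|I|$ at $\eta$ (when expressed in the coordinates $u$) and smoothly depending on the point $\eta$, such that, for every smooth function $f(u)$ and $\xi$ near $\eta$, $$X_{[I]}^{\xi}\bigl[f(\Theta(\eta,\xi))\bigr]=(Y_{[I]}f)(\Theta(\eta,\xi))+(R_{\eta,[I]}f)(\Theta(\eta,\xi)),$$ where $X^\xi_{[I]}$ denotes $X_{[I]}$ acting as a differential operator in the variable $\xi$.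
   Context: Weights and commutators: $X_0$ has weight $p_0=2$, $X_i$ has weight $p_i=1$ for $i\ge1$. For $I=(i_1,\dots,i_k)$, $i_j\in\{0,\dots,n\}$, $|I|=\sum_j p_{i_j}$ and $X_{[I]}=[X_{i_1},[X_{i_2},\dots[X_{i_{k-1}},X_{i_k}]\dots]]$, $X_{[(i)]}=X_i$; similarly $Y_{[I]}$. Hörmander's condition of step $r$ in $\Omega$: $\{(X_{[I]})_x\}_{|I|\le r}$ spans $\mathbb{R}^p$ for every $x\in\Omega$. In noncommuting indeterminates $\xi_0,\dots,\xi_n$ write $\xi_{[I]}=[\xi_{i_1},[\dots,\xi_{i_k}]\dots]=\sum_JA_{IJ}\xi_J$. The fields are free up to weight $r$ in $\Omega$ if at each $x\in\Omega$: $\sum_{|I|\le r}a_I(X_{[I]})_x=0$ (real constants $a_I$) implies $\sum_{|I|\le r} a_IA_{IJ}=0$ for all $J$. A set $B$ of $p$ multiindices of weight $\le r$ is fixed so that $\{(X_{[I]})_x\}_{I\in B}$ is a basis of $\mathbb{R}^p$ at every $x\in\Omega$. Canonical coordinates and $\Theta$: $\exp(Z)(\eta)$ is the time-1 value of the solution of $\phi'=Z_\phi$, $\phi(0)=\eta$. For $\eta\in\Omega$, the map $u=(u_I)_{I\in B}\mapsto\xi=\exp(\sum_{I\in B}u_IX_{[I]})(\eta)$ is a diffeomorphism from a neighborhood of $0\in\mathbb{R}^p$ onto a neighborhood of $\eta$; its inverse is $u=\Theta(\eta,\xi)$, which is smooth in $(\eta,\xi)$ near the diagonal. The $u$ are the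 canonical coordinates centered at $\eta$. Weight: assign weight $|I|$ to the coordinate $u_I$. A smooth function $f(u)$ has weight $\ge s$ if its Taylor expansion at $u=0$ contains no term $a\,u_{I_1}u_{I_2}\cdots u_{I_k}$ with $a\ne0$ and $|I_1|+\dots+|I_k|<s$. A vector field $\sum_{I\in B}f_I\,\partial/\partial u_I$ has weight $\ge s$ if each $f_I$ has weight $\ge s+|I|$. A vector field has weight $\ge s$ at $\eta$ if, expressed in the canonical coordinates $u=\Theta(\eta,\xi)$, it has weight $\ge s$. (For $X_{[I]}-Y_{[I]}$ at $\eta$, $X_{[I]}$ is expressed in the coordinates $u=\Theta(\eta,\cdot)$.) *)

theory Defs
  imports "HOL-Analysis.Analysis"
begin

section \<open>Smooth maps\<close>

text \<open>Both predicates are meant for open \<open>S\<close>.\<close>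

fun Ck_on :: "nat \<Rightarrow> ('a::real_normed_vector \<Rightarrow> 'b::real_normed_vector) \<Rightarrow> 'a set \<Rightarrow> bool" where
  "Ck_on 0 f S \<longleftrightarrow> continuous_on S f"
| "Ck_on (Suc k) f S \<longleftrightarrow>
     (\<forall>x\<in>S. f differentiable (at x)) \<and>
     (\<forall>v. Ck_on k (\<lambda>x. frechet_derivative f (at x) v) S)"

definition smooth_on :: "'a::real_normed_vector set \<Rightarrow> ('a \<Rightarrow> 'b::real_normed_vector) \<Rightarrow> bool" where
  "smooth_on S f \<longleftrightarrow> (\<forall>k. Ck_on k f S)"

definition diffeomorphism ::
  "'a::real_normed_vector set \<Rightarrow> 'b::real_normed_vector set \<Rightarrow> ('a \<Rightarrow> 'b) \<Rightarrow> ('b \<Rightarrow> 'a) \<Rightarrow> bool" where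
  "diffeomorphism U V f g \<longleftrightarrow>
     open U \<and> open V \<and> homeomorphism U V f g \<and> smooth_on U f \<and> smooth_on V g"


section \<open>Vector fields and iterated commutators\<close>

text \<open>A vector field is its coefficient function; it acts on functions by differentiation.\<close>

definition vf_apply ::
  "('a::real_normed_vector \<Rightarrow> 'a) \<Rightarrow> ('a \<Rightarrow> real) \<Rightarrow> 'a \<Rightarrow> real" where
  "vf_apply Z f x = frechet_derivative f (at x) (Z x)"

text \<open>The coefficients of \<open>ZW - WZ\<close> are those of \<open>W\<close> differentiated along \<open>Z\<close>, minus those of
  \<open>Z\<close> differentiated along \<open>W\<close>.\<close>

definition lie_bracket ::
  "('a::real_normed_vector \<Rightarrow> 'a) \<Rightarrow> ('a \<Rightarrow> 'a) \<Rightarrow> 'a \<Rightarrow> 'a" where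
  "lie_bracket Z W x = frechet_derivative W (at x) (Z x) - frechet_derivative Z (at x) (W x)"

text \<open>\<open>[g\<^sub>i, [g\<^sub>j, \<dots>]]\<close> for an arbitrary bracket operation. The empty multiindex is excluded by
  \<open>multiindices\<close> below.\<close>

fun iterated_bracket :: "('a \<Rightarrow> 'a \<Rightarrow> 'a) \<Rightarrow> (nat \<Rightarrow> 'a) \<Rightarrow> nat list \<Rightarrow> 'a" where
  "iterated_bracket br g [] = undefined"
| "iterated_bracket br g [i] = g i"
| "iterated_bracket br g (i # j # I) = br (g i) (iterated_bracket br g (j # I))"

abbreviation commutator ::
  "(nat \<Rightarrow> 'a::real_normed_vector \<Rightarrow> 'a) \<Rightarrow> nat list \<Rightarrow> 'a \<Rightarrow> 'a" where
  "commutator X I \<equiv> iterated_bracket lie_bracket X I"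

definition multiindices :: "nat \<Rightarrow> nat list set" where
  "multiindices n = {I. I \<noteq> [] \<and> set I \<subseteq> {0..n}}"

definition wt :: "nat list \<Rightarrow> nat" where
  "wt I = (\<Sum>i\<leftarrow>I. if i = 0 then 2 else 1)"


section \<open>Noncommuting indeterminates\<close>

text \<open>A polynomial in noncommuting indeterminates is the function giving the coefficient of each word.\<close>

type_synonym nc_poly = "nat list \<Rightarrow> real"

definition nc_var :: "nat \<Rightarrow> nc_poly" where
  "nc_var i = (\<lambda>J. if J = [i] then 1 else 0)"

definition nc_mult :: "nc_poly \<Rightarrow> nc_poly \<Rightarrow> nc_poly" where
  "nc_mult P Q = (\<lambda>J. \<Sum>k\<le>length J. P (take k J) * Q (drop k J))"

definition nc_bracket :: "nc_poly \<Rightarrow> nc_poly \<Rightarrow> nc_poly" where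
  "nc_bracket P Q = (\<lambda>J. nc_mult P Q J - nc_mult Q P J)"

definition nc_coeff :: "nat list \<Rightarrow> nat list \<Rightarrow> real" where
  "nc_coeff I J = iterated_bracket nc_bracket nc_var I J"


section \<open>Free systems and Hoermander's condition\<close>

definition hoermander ::
  "nat \<Rightarrow> nat \<Rightarrow> 'a::real_normed_vector set \<Rightarrow> (nat \<Rightarrow> 'a \<Rightarrow> 'a) \<Rightarrow> bool" where
  "hoermander n r \<Omega> X \<longleftrightarrow>
     (\<forall>x\<in>\<Omega>. span {commutator X I x | I. I \<in> multiindices n \<and> wt I \<le> r} = UNIV)"

definition free_up_to ::
  "nat \<Rightarrow> nat \<Rightarrow> 'a::real_normed_vector set \<Rightarrow> (nat \<Rightarrow> 'a \<Rightarrow> 'a) \<Rightarrow> bool" where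
  "free_up_to n r \<Omega> X \<longleftrightarrow>
     (\<forall>x\<in>\<Omega>. \<forall>a :: nat list \<Rightarrow> real.
        (\<Sum>I | I \<in> multiindices n \<and> wt I \<le> r. a I *\<^sub>R commutator X I x) = 0 \<longrightarrow>
        (\<forall>J. (\<Sum>I | I \<in> multiindices n \<and> wt I \<le> r. a I * nc_coeff I J) = 0))"

text \<open>The set of \<open>p\<close> multiindices is given by an injective enumeration \<open>B\<close> over the index type of
  \<open>\<real>\<^sup>p\<close>. The coordinate attached to the multiindex \<open>B j\<close> is then the component \<open>u $ j\<close>.\<close>

definition basis_multiindices ::
  "nat \<Rightarrow> nat \<Rightarrow> (real^'p) set \<Rightarrow> (nat \<Rightarrow> real^'p \<Rightarrow> real^'p) \<Rightarrow> ('p::finite \<Rightarrow> nat list) \<Rightarrow> bool" where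
  "basis_multiindices n r \<Omega> X B \<longleftrightarrow>
     inj B \<and> (\<forall>j. B j \<in> multiindices n \<and> wt (B j) \<le> r) \<and>
     (\<forall>x\<in>\<Omega>. inj (\<lambda>j. commutator X (B j) x) \<and>
            independent (range (\<lambda>j. commutator X (B j) x)) \<and>
            span (range (\<lambda>j. commutator X (B j) x)) = UNIV)"


section \<open>Canonical coordinates\<close>

text \<open>\<open>is_exp \<Omega> Z \<eta> \<xi>\<close> says that \<open>exp(Z)(\<eta>)\<close> is defined, with the integral curve in \<open>\<Omega>\<close>, and equals \<open>\<xi>\<close>.\<close>

definition is_exp ::
  "'a::real_normed_vector set \<Rightarrow> ('a \<Rightarrow> 'a) \<Rightarrow> 'a \<Rightarrow> 'a \<Rightarrow> bool" where
  "is_exp \<Omega> Z \<eta> \<xi> \<longleftrightarrow>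
     (\<exists>\<phi> :: real \<Rightarrow> 'a. \<phi> 0 = \<eta> \<and> \<phi> 1 = \<xi> \<and>
        (\<forall>t\<in>{0..1}. \<phi> t \<in> \<Omega> \<and> (\<phi> has_vector_derivative Z (\<phi> t)) (at t within {0..1})))"

text \<open>The first conjunct is joint smoothness near the diagonal. The second says that
  \<open>E = (u \<mapsto> exp(\<Sum>\<^sub>j u\<^sub>j X\<^bsub>[B j]\<^esub>)(\<eta>))\<close> is a local diffeomorphism at \<open>0\<close> with inverse \<open>\<Theta> \<eta>\<close>.\<close>

definition canonical_coordinates ::
  "(real^'p) set \<Rightarrow> (nat \<Rightarrow> real^'p \<Rightarrow> real^'p) \<Rightarrow> ('p::finite \<Rightarrow> nat list) \<Rightarrow>
   (real^'p \<Rightarrow> real^'p \<Rightarrow> real^'p) \<Rightarrow> bool" where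
  "canonical_coordinates \<Omega> X B \<Theta> \<longleftrightarrow>
     (\<exists>D. open D \<and> (\<forall>\<eta>\<in>\<Omega>. (\<eta>, \<eta>) \<in> D) \<and> smooth_on D (\<lambda>(\<eta>, \<xi>). \<Theta> \<eta> \<xi>)) \<and>
     (\<forall>\<eta>\<in>\<Omega>. \<exists>U V E. 0 \<in> U \<and> \<eta> \<in> V \<and>
        (\<forall>u\<in>U. is_exp \<Omega> (\<lambda>x. \<Sum>j\<in>UNIV. u $ j *\<^sub>R commutator X (B j) x) \<eta> (E u)) \<and>
        diffeomorphism U V E (\<Theta> \<eta>))"

text \<open>\<open>in_coordinates \<theta> \<eta> Z Z'\<close>: in the coordinates \<open>u = \<theta> \<xi>\<close> near \<open>\<eta>\<close>, the vector field \<open>Z\<close> is \<open>Z'\<close>.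
  When \<open>\<theta>\<close> is a local diffeomorphism at \<open>\<eta>\<close>, this determines the germ of \<open>Z'\<close> at \<open>\<theta> \<eta>\<close>.\<close>

definition in_coordinates ::
  "('a::real_normed_vector \<Rightarrow> 'a) \<Rightarrow> 'a \<Rightarrow> ('a \<Rightarrow> 'a) \<Rightarrow> ('a \<Rightarrow> 'a) \<Rightarrow> bool" where
  "in_coordinates \<theta> \<eta> Z Z' \<longleftrightarrow>
     (\<forall>\<^sub>F \<xi> in nhds \<eta>. Z' (\<theta> \<xi>) = frechet_derivative \<theta> (at \<xi>) (Z \<xi>))"


section \<open>Weight\<close>

fun iterated_partial :: "'p::finite list \<Rightarrow> (real^'p \<Rightarrow> real) \<Rightarrow> real^'p \<Rightarrow> real" where
  "iterated_partial [] f = f"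
| "iterated_partial (j # js) f =
     (\<lambda>u. frechet_derivative (iterated_partial js f) (at u) (axis j 1))"

text \<open>The coefficient of the monomial \<open>\<Prod>j\<leftarrow>js. u $ j\<close> in the Taylor expansion of \<open>f\<close> at \<open>0\<close>.\<close>

definition taylor_coeff :: "(real^'p::finite \<Rightarrow> real) \<Rightarrow> 'p list \<Rightarrow> real" where
  "taylor_coeff f js = iterated_partial js f 0 / (\<Prod>j\<in>UNIV. fact (count_list js j))"

definition fun_weight_ge :: "('p::finite \<Rightarrow> nat list) \<Rightarrow> int \<Rightarrow> (real^'p \<Rightarrow> real) \<Rightarrow> bool" where
  "fun_weight_ge B s f \<longleftrightarrow>
     (\<exists>U. open U \<and> 0 \<in> U \<and> smooth_on U f) \<and>
     \<not> (\<exists>js. taylor_coeff f js \<noteq> 0 \<and> (\<Sum>j\<leftarrow>js. int (wt (B j))) < s)"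

definition vf_weight_ge :: "('p::finite \<Rightarrow> nat list) \<Rightarrow> int \<Rightarrow> (real^'p \<Rightarrow> real^'p) \<Rightarrow> bool" where
  "vf_weight_ge B s Z \<longleftrightarrow> (\<forall>j. fun_weight_ge B (s + int (wt (B j))) (\<lambda>u. Z u $ j))"

definition vf_weight_ge_at ::
  "(real^'p \<Rightarrow> real^'p \<Rightarrow> real^'p) \<Rightarrow> ('p::finite \<Rightarrow> nat list) \<Rightarrow> real^'p \<Rightarrow> int \<Rightarrow>
   (real^'p \<Rightarrow> real^'p) \<Rightarrow> bool" where
  "vf_weight_ge_at \<Theta> B \<eta> s Z \<longleftrightarrow> (\<exists>Z'. in_coordinates (\<Theta> \<eta>) \<eta> Z Z' \<and> vf_weight_ge B s Z')"

end

theory Submission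
  imports Defs
begin

text \<open>
  In canonical coordinates the radial identity \<open>\<Sum>\<^sub>j u\<^sub>j Z\<^sub>j = \<Sum>\<^sub>j u\<^sub>j \<partial>\<^sub>j\<close> holds for the frame \<open>Z\<^sub>j = X\<^bsub>[B j]\<^esub>\<close>,
  because \<open>t \<mapsto> exp(\<Sum>\<^sub>j t u\<^sub>j X\<^bsub>[B j]\<^esub>)(\<eta>)\<close> is an integral curve. Differentiating it along \<open>Z\<^sub>k\<close> gives a recursion
  that determines the Taylor coefficients of \<open>h\<^sub>k = Z\<^sub>k - \<partial>\<^sub>k\<close> degree by degree from the brackets \<open>[Z\<^sub>j, Z\<^sub>k]\<close>.
  By freeness these brackets are constant combinations, with the same constants for \<open>X\<close> and \<open>Y\<close>, of the \<open>Z\<^sub>l\<close> with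
  \<open>|B l| = |B j| + |B k|\<close>, unless \<open>|B j| + |B k| > r\<close>; in that case \<open>u\<^sub>j [Z\<^sub>j, Z\<^sub>k]\<close> has weight at least
  \<open>|B j| - r \<ge> 1 - |B k|\<close> for trivial reasons. Induction on the degree therefore bounds the weight of \<open>h\<^sub>k\<close> from below
  by \<open>-|B k|\<close> and shows that its leading part is the same for \<open>X\<close> and \<open>Y\<close>.
\<close>

section \<open>Calculus of smooth maps\<close>

text \<open>Three points are left implicit. The structure constants must serve \<open>X\<close> and
  \<open>Y\<close> alike, while freeness is a property of \<open>X\<close> at points. It is used to
  obtain relations between Lie polynomials; these hold for every system of smooth fields, because
  X_[I] as a differential operator is the image of the Lie polynomial with index I under
  substitution of the fields for the indeterminates. Smooth dependence on \<eta> needs a separate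
  argument. The coordinate hypothesis gives an inverse of \<open>\<Theta> \<eta>\<close> for each
  \<eta> on its own, on a domain depending on \<eta>. Inverting (\<eta>, \<xi>) |-> (\<eta>,
  \<Theta>(\<eta>, \<xi>)) near the diagonal yields one smooth inverse \<open>G\<close>. Then X_[I]
  in coordinates is smooth jointly in (\<eta>, u), and R is this expression minus Y_[I]. The radial
  identity rests on uniqueness of integral curves: the hypothesis says that some curve reaches the
  point with coordinates u, and uniqueness identifies the point with coordinates t u as the position
  of that curve at time t.\<close>

lemma Ck_on_subset: "Ck_on k f S \<Longrightarrow> T \<subseteq> S \<Longrightarrow> Ck_on k f T"
  by (induction k arbitrary: f) (auto intro: continuous_on_subset)

lemma Ck_on_Suc_imp: "Ck_on (Suc k) f S \<Longrightarrow> Ck_on k f S"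
proof (induction k arbitrary: f)
  case 0
  then show ?case
    by (auto simp: continuous_at_imp_continuous_on differentiable_imp_continuous_within)
next
  case (Suc k)
  then show ?case
    by (metis Ck_on.simps(2))
qed

lemma Ck_on_cong:
  assumes "open S" "\<And>x. x \<in> S \<Longrightarrow> f x = g x" "Ck_on k f S"
  shows "Ck_on k g S"
  using assms(2,3)
proof (induction k arbitrary: f g)
  case 0
  then show ?case by (auto cong: continuous_on_cong)
next
  case (Suc k)
  have d: "(g has_derivative frechet_derivative f (at x)) (at x)" if "x \<in> S" for x
  proof (rule has_derivative_transform_within_open)
    show "(f has_derivative frechet_derivative f (at x)) (at x)"
      using Suc.prems(2) that by (simp flip: frechet_derivative_works)
  qed (use assms(1) that Suc.prems in auto)
  then have e: "frechet_derivative f (at x) = frechet_derivative g (at x)" if "x \<in> S" for x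
    using frechet_derivative_at that by blast
  have "Ck_on k (\<lambda>x. frechet_derivative g (at x) v) S" for v
    using Suc.IH[of "\<lambda>x. frechet_derivative f (at x) v" "\<lambda>x. frechet_derivative g (at x) v"]
      Suc.prems(2) e by simp
  then show ?case
    using d by (auto simp: differentiable_def)
qed

text \<open>\<open>frechet_derivative\<close> is a choice; this rule allows an explicit formula for
  the derivative in its place, which is what the inductive closure proofs below supply.\<close>

lemma Ck_on_SucI:
  assumes "open S" "\<And>x. x \<in> S \<Longrightarrow> (f has_derivative f' x) (at x)"
    and "\<And>v. Ck_on k (\<lambda>x. f' x v) S"
  shows "Ck_on (Suc k) f S"
proof -
  have "frechet_derivative f (at x) = f' x" if "x \<in> S" for x
    using assms(2) that frechet_derivative_at by metis
  then have "Ck_on k (\<lambda>x. frechet_derivative f (at x) v) S" for v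
    using assms(1,3) by (auto intro: Ck_on_cong[where f = "\<lambda>x. f' x v"])
  then show ?thesis
    using assms(2) by (auto simp: differentiable_def)
qed

lemma Ck_on_Suc_has_derivative:
  "Ck_on (Suc k) f S \<Longrightarrow> x \<in> S \<Longrightarrow> (f has_derivative frechet_derivative f (at x)) (at x)"
  by (simp flip: frechet_derivative_works)

lemma Ck_on_const: "Ck_on k (\<lambda>x. c) S"
  by (induction k arbitrary: c) auto

lemma Ck_on_bounded_linear:
  assumes "open S" "bounded_linear f" shows "Ck_on k f S"
proof (cases k)
  case 0
  then show ?thesis by (simp add: assms linear_continuous_on)
next
  case (Suc m)
  then show ?thesis
    using Ck_on_SucI[OF assms(1) bounded_linear_imp_has_derivative[OF assms(2)] Ck_on_const] by simp
qed

lemma Ck_on_bounded_linear_compose: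
  assumes "open S" "bounded_linear h" "Ck_on k f S" shows "Ck_on k (\<lambda>x. h (f x)) S"
  using assms(3)
proof (induction k arbitrary: f)
  case 0
  then show ?case using assms(2) by (auto intro: bounded_linear.continuous_on)
next
  case (Suc k)
  show ?case
  proof (rule Ck_on_SucI[OF assms(1)])
    show "((\<lambda>x. h (f x)) has_derivative (\<lambda>v. h (frechet_derivative f (at x) v))) (at x)"
      if "x \<in> S" for x
      using Ck_on_Suc_has_derivative[OF Suc.prems that] assms(2) bounded_linear.has_derivative by blast
    show "Ck_on k (\<lambda>x. h (frechet_derivative f (at x) v)) S" for v
      using Suc by simp
  qed
qed

lemma Ck_on_add:
  assumes "open S" "Ck_on k f S" "Ck_on k g S" shows "Ck_on k (\<lambda>x. f x + g x) S"
  using assms(2,3)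
proof (induction k arbitrary: f g)
  case 0
  then show ?case by (auto intro: continuous_on_add)
next
  case (Suc k)
  show ?case
    by (rule Ck_on_SucI[OF assms(1) has_derivative_add[OF Ck_on_Suc_has_derivative[OF Suc.prems(1)]
          Ck_on_Suc_has_derivative[OF Suc.prems(2)]]]) (use Suc in auto)
qed

lemma Ck_on_sum:
  assumes "open S" "\<And>i. i \<in> A \<Longrightarrow> Ck_on k (f i) S" shows "Ck_on k (\<lambda>x. \<Sum>i\<in>A. f i x) S"
  using assms(2)
  by (induction A rule: infinite_finite_induct) (auto intro: Ck_on_const Ck_on_add[OF assms(1)])

lemma Ck_on_bilinear:
  assumes "open S" "bounded_bilinear prd" "Ck_on k f S" "Ck_on k g S"
  shows "Ck_on k (\<lambda>x. prd (f x) (g x)) S"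
  using assms(3,4)
proof (induction k arbitrary: f g)
  case 0
  then show ?case
    using assms(2) by (auto intro: bounded_bilinear.continuous_on)
next
  case (Suc k)
  show ?case
  proof (rule Ck_on_SucI[OF assms(1)])
    show "((\<lambda>x. prd (f x) (g x)) has_derivative
        (\<lambda>v. prd (f x) (frechet_derivative g (at x) v) + prd (frechet_derivative f (at x) v) (g x))) (at x)"
      if "x \<in> S" for x
      by (rule bounded_bilinear.FDERIV[OF assms(2) Ck_on_Suc_has_derivative[OF Suc.prems(1) that]
            Ck_on_Suc_has_derivative[OF Suc.prems(2) that]])
    show "Ck_on k (\<lambda>x. prd (f x) (frechet_derivative g (at x) v) + prd (frechet_derivative f (at x) v) (g x)) S" for v
      by (intro Ck_on_add[OF assms(1)] Suc.IH) (use Suc.prems Ck_on_Suc_imp in auto)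
  qed
qed

lemma linear_eq_sum_Basis:
  fixes h :: "'a::euclidean_space \<Rightarrow> 'b::real_vector"
  assumes "linear h"
  shows "h v = (\<Sum>b\<in>Basis. (v \<bullet> b) *\<^sub>R h b)"
proof -
  have "h v = h (\<Sum>b\<in>Basis. (v \<bullet> b) *\<^sub>R b)"
    by (simp add: euclidean_representation)
  then show ?thesis
    by (simp only: linear_sum[OF assms] linear_scale[OF assms])
qed

text \<open>\<open>Ck_on\<close> speaks of derivatives in fixed directions, whereas the chain rule
  differentiates \<open>f\<close> in the moving direction Dg(x)v. Expanding that direction in
  \<open>Basis\<close> gives a finite sum of products to which the induction hypothesis applies;
  hence the Euclidean middle space.\<close>

lemma Ck_on_compose:
  fixes g :: "'a::real_normed_vector \<Rightarrow> 'b::euclidean_space" and f :: "'b \<Rightarrow> 'c::real_normed_vector"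
  assumes S: "open S" and T: "open T" and sub: "g ` S \<subseteq> T" and "Ck_on k f T" "Ck_on k g S"
  shows "Ck_on k (\<lambda>x. f (g x)) S"
  using assms(4,5)
proof (induction k arbitrary: f)
  case 0
  then show ?case
    using sub by (auto intro: continuous_on_compose2)
next
  case (Suc k)
  show ?case
  proof (rule Ck_on_SucI[OF S])
    let ?d = "\<lambda>x v. \<Sum>b\<in>Basis. (frechet_derivative g (at x) v \<bullet> b) *\<^sub>R frechet_derivative f (at (g x)) b"
    show "((\<lambda>x. f (g x)) has_derivative ?d x) (at x)" if "x \<in> S" for x
    proof -
      have f: "(f has_derivative frechet_derivative f (at (g x))) (at (g x))"
        using Ck_on_Suc_has_derivative[OF Suc.prems(1)] sub that by auto
      have "((\<lambda>x. f (g x)) has_derivative (\<lambda>v. frechet_derivative f (at (g x)) (frechet_derivative g (at x) v))) (at x)"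
        using has_derivative_compose[OF Ck_on_Suc_has_derivative[OF Suc.prems(2) that] f] .
      moreover have "frechet_derivative f (at (g x)) (frechet_derivative g (at x) v) = ?d x v" for v
        using linear_eq_sum_Basis has_derivative_linear[OF f] by blast
      ultimately show ?thesis by (simp only:)
    qed
    have "Ck_on k g S" using Ck_on_Suc_imp Suc.prems(2) by blast
    then show "Ck_on k (\<lambda>x. ?d x v) S" for v
      by (intro Ck_on_sum[OF S] Ck_on_bilinear[OF S bounded_bilinear_scaleR] Suc.IH
          Ck_on_bounded_linear_compose[OF S bounded_linear_inner_left]) (use Suc.prems in auto)
  qed
qed

lemma Ck_on_inverse:
  fixes f :: "'a::real_normed_vector \<Rightarrow> real"
  assumes S: "open S" and nz: "\<And>x. x \<in> S \<Longrightarrow> f x \<noteq> 0" and "Ck_on k f S"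
  shows "Ck_on k (\<lambda>x. inverse (f x)) S"
  using assms(3)
proof (induction k)
  case 0
  then show ?case using nz by (auto intro: continuous_on_inverse)
next
  case (Suc k)
  show ?case
  proof (rule Ck_on_SucI[OF S])
    show "((\<lambda>x. inverse (f x)) has_derivative
        (\<lambda>v. - (inverse (f x) * frechet_derivative f (at x) v * inverse (f x)))) (at x)" if "x \<in> S" for x
      using Deriv.has_derivative_inverse[OF nz[OF that] Ck_on_Suc_has_derivative[OF Suc.prems that]] .
    have "Ck_on k (\<lambda>x. inverse (f x)) S" using Suc Ck_on_Suc_imp by blast
    then show "Ck_on k (\<lambda>x. - (inverse (f x) * frechet_derivative f (at x) v * inverse (f x))) S" for v
      by (intro Ck_on_bounded_linear_compose[OF S bounded_linear_minus[OF bounded_linear_ident]]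
          Ck_on_bilinear[OF S bounded_bilinear_mult]) (use Suc.prems in auto)
  qed
qed

lemma Ck_on_prod:
  fixes f :: "'i \<Rightarrow> 'a::real_normed_vector \<Rightarrow> real"
  assumes "open S" "\<And>i. i \<in> A \<Longrightarrow> Ck_on k (f i) S" shows "Ck_on k (\<lambda>x. \<Prod>i\<in>A. f i x) S"
  using assms(2)
  by (induction A rule: infinite_finite_induct)
    (auto intro: Ck_on_const Ck_on_bilinear[OF assms(1) bounded_bilinear_mult])

lemma Ck_on_vec:
  fixes f :: "'a::real_normed_vector \<Rightarrow> real^'n"
  assumes "open S" "\<And>i. Ck_on k (\<lambda>x. f x $ i) S" shows "Ck_on k f S"
proof -
  have eq: "(\<Sum>i\<in>UNIV. f x $ i *\<^sub>R axis i 1) = f x" for x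
    by (simp add: vec_eq_iff axis_def if_distrib sum.delta cong: if_cong)
  have "Ck_on k (\<lambda>x. \<Sum>i\<in>UNIV. f x $ i *\<^sub>R axis i 1) S"
    by (intro Ck_on_sum Ck_on_bounded_linear_compose[OF assms(1) bounded_linear_scaleR_left] assms)
  then show ?thesis
    by (rule Ck_on_cong[OF assms(1) eq])
qed

lemma Ck_on_det:
  fixes M :: "'a::real_normed_vector \<Rightarrow> real^'n^'n"
  assumes S: "open S" and M: "\<And>i j. Ck_on k (\<lambda>w. M w $ i $ j) S"
  shows "Ck_on k (\<lambda>w. det (M w)) S"
  unfolding det_def
  by (intro Ck_on_sum Ck_on_bilinear[OF S bounded_bilinear_mult] Ck_on_const Ck_on_prod S M)

text \<open>Cramer's rule: each component of the solution is a quotient of determinants, which are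
  polynomials in the entries. This lets the derivative of an implicit function inherit the
  regularity of its coefficients.\<close>

lemma Ck_on_linear_solve:
  fixes A :: "'a::real_normed_vector \<Rightarrow> real^'n^'n"
  assumes S: "open S" and A: "\<And>i j. Ck_on k (\<lambda>w. A w $ i $ j) S" and b: "Ck_on k b S"
    and det: "\<And>w. w \<in> S \<Longrightarrow> det (A w) \<noteq> 0" and x: "\<And>w. w \<in> S \<Longrightarrow> A w *v x w = b w"
  shows "Ck_on k x S"
proof (rule Ck_on_vec[OF S])
  fix i
  let ?M = "\<lambda>w. (\<chi> i' j. if j = i then b w $ i' else A w $ i' $ j) :: real^'n^'n"
  have "Ck_on k (\<lambda>w. b w $ j) S" for j
    using Ck_on_bounded_linear_compose[OF S bounded_linear_vec_nth b] .
  then have M: "Ck_on k (\<lambda>w. ?M w $ i' $ j) S" for i' j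
    using A by (cases "j = i") auto
  have "Ck_on k (\<lambda>w. det (?M w) * inverse (det (A w))) S"
    by (intro Ck_on_bilinear[OF S bounded_bilinear_mult] Ck_on_inverse[OF S det] Ck_on_det S A M)
  moreover have "det (?M w) * inverse (det (A w)) = x w $ i" if "w \<in> S" for w
    using cramer[OF det[OF that], of "x w" "b w"] x[OF that] by (simp add: vec_eq_iff divide_inverse)
  ultimately show "Ck_on k (\<lambda>w. x w $ i) S"
    by (rule Ck_on_cong[OF S, rotated])
qed

lemma Ck_on_Pair:
  fixes f :: "'a::real_normed_vector \<Rightarrow> 'b::real_normed_vector" and g :: "'a \<Rightarrow> 'c::real_normed_vector"
  assumes S: "open S" and "Ck_on k f S" "Ck_on k g S"
  shows "Ck_on k (\<lambda>x. (f x, g x)) S"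
proof -
  have "Ck_on k (\<lambda>x. (f x, 0 :: 'c) + (0 :: 'b, g x)) S"
    by (intro Ck_on_add[OF S] Ck_on_bounded_linear_compose[OF S _ assms(2)] Ck_on_bounded_linear_compose[OF S _ assms(3)]
        bounded_linear_Pair bounded_linear_ident bounded_linear_zero)
  then show ?thesis by simp
qed

section \<open>Smooth maps: closure properties inherited from every finite order\<close>

lemma smooth_on_subset: "smooth_on S f \<Longrightarrow> T \<subseteq> S \<Longrightarrow> smooth_on T f"
  by (auto simp: smooth_on_def intro: Ck_on_subset)

lemma smooth_on_cong: "smooth_on S f \<Longrightarrow> open S \<Longrightarrow> (\<And>x. x \<in> S \<Longrightarrow> f x = g x) \<Longrightarrow> smooth_on S g"
  by (auto simp: smooth_on_def intro: Ck_on_cong)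

lemma smooth_on_has_derivative:
  "smooth_on S f \<Longrightarrow> x \<in> S \<Longrightarrow> (f has_derivative frechet_derivative f (at x)) (at x)"
  by (auto simp: smooth_on_def intro: Ck_on_Suc_has_derivative)

lemma smooth_on_differentiable: "smooth_on S f \<Longrightarrow> x \<in> S \<Longrightarrow> f differentiable (at x)"
  using smooth_on_has_derivative differentiable_def by blast

lemma smooth_on_linear_derivative: "smooth_on S f \<Longrightarrow> x \<in> S \<Longrightarrow> linear (frechet_derivative f (at x))"
  using smooth_on_has_derivative has_derivative_linear by blast

lemma smooth_on_continuous: "smooth_on S f \<Longrightarrow> continuous_on S f"
  by (metis smooth_on_def Ck_on.simps(1))

lemma smooth_on_const: "smooth_on S (\<lambda>x. c)"
  by (simp add: smooth_on_def Ck_on_const)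

lemma smooth_on_add:
  "open S \<Longrightarrow> smooth_on S f \<Longrightarrow> smooth_on S g \<Longrightarrow> smooth_on S (\<lambda>x. f x + g x)"
  by (simp add: smooth_on_def Ck_on_add)

lemma smooth_on_sum:
  "open S \<Longrightarrow> (\<And>i. i \<in> A \<Longrightarrow> smooth_on S (f i)) \<Longrightarrow> smooth_on S (\<lambda>x. \<Sum>i\<in>A. f i x)"
  by (simp add: smooth_on_def Ck_on_sum)

lemma smooth_on_bilinear:
  "open S \<Longrightarrow> bounded_bilinear prd \<Longrightarrow> smooth_on S f \<Longrightarrow> smooth_on S g \<Longrightarrow> smooth_on S (\<lambda>x. prd (f x) (g x))"
  by (simp add: smooth_on_def Ck_on_bilinear)

lemmas smooth_on_mult = smooth_on_bilinear[OF _ bounded_bilinear_mult]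
lemmas smooth_on_scaleR = smooth_on_bilinear[OF _ bounded_bilinear_scaleR]

lemma smooth_on_bounded_linear: "open S \<Longrightarrow> bounded_linear f \<Longrightarrow> smooth_on S f"
  by (simp add: smooth_on_def Ck_on_bounded_linear)

lemma smooth_on_bounded_linear_compose:
  "open S \<Longrightarrow> bounded_linear h \<Longrightarrow> smooth_on S f \<Longrightarrow> smooth_on S (\<lambda>x. h (f x))"
  by (simp add: smooth_on_def Ck_on_bounded_linear_compose)

lemma smooth_on_uminus:
  assumes "open S" "smooth_on S f" shows "smooth_on S (\<lambda>x. - f x)"
  using smooth_on_bounded_linear_compose[OF assms(1) bounded_linear_minus[OF bounded_linear_ident] assms(2)] .

lemma smooth_on_diff:
  assumes "open S" "smooth_on S f" "smooth_on S g" shows "smooth_on S (\<lambda>x. f x - g x)"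
  using smooth_on_add[OF assms(1,2) smooth_on_uminus[OF assms(1,3)]] by simp

lemmas smooth_on_inner_left = smooth_on_bounded_linear_compose[OF _ bounded_linear_inner_left]
lemmas smooth_on_nth = smooth_on_bounded_linear_compose[OF _ bounded_linear_vec_nth]

lemma smooth_on_ident: "open U \<Longrightarrow> smooth_on U (\<lambda>u. u)"
  by (rule smooth_on_bounded_linear[OF _ bounded_linear_ident])

lemma smooth_on_Pair:
  assumes "open S" "smooth_on S f" "smooth_on S g"
  shows "smooth_on S (\<lambda>x. (f x, g x))"
  using assms Ck_on_Pair unfolding smooth_on_def by blast

lemma smooth_on_det:
  fixes M :: "'a::real_normed_vector \<Rightarrow> real^'n^'n"
  shows "open S \<Longrightarrow> (\<And>i j. smooth_on S (\<lambda>w. M w $ i $ j)) \<Longrightarrow> smooth_on S (\<lambda>w. det (M w))"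
  by (simp add: smooth_on_def Ck_on_det)

lemma smooth_on_compose:
  fixes g :: "'a::real_normed_vector \<Rightarrow> 'b::euclidean_space"
  shows "smooth_on T f \<Longrightarrow> open S \<Longrightarrow> open T \<Longrightarrow> smooth_on S g \<Longrightarrow> g ` S \<subseteq> T \<Longrightarrow> smooth_on S (\<lambda>x. f (g x))"
  by (simp add: smooth_on_def Ck_on_compose)

lemma smooth_on_derivative: "smooth_on S f \<Longrightarrow> smooth_on S (\<lambda>x. frechet_derivative f (at x) v)"
  unfolding smooth_on_def by (metis Ck_on.simps(2))

lemma derivative_eq_sum_Basis:
  fixes f :: "'a::euclidean_space \<Rightarrow> 'b::real_normed_vector"
  assumes "f differentiable (at x)"
  shows "frechet_derivative f (at x) v = (\<Sum>b\<in>Basis. (v \<bullet> b) *\<^sub>R frechet_derivative f (at x) b)"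
  using linear_eq_sum_Basis assms linear_frechet_derivative by blast

text \<open>The moving direction \<open>Z x\<close> is again expanded in \<open>Basis\<close>, since
  \<open>smooth_on_derivative\<close> covers fixed directions.\<close>

lemma smooth_on_derivative_apply:
  fixes f :: "'a::euclidean_space \<Rightarrow> 'b::real_normed_vector" and g :: "'c::real_normed_vector \<Rightarrow> 'a"
  assumes f: "smooth_on T f" and S: "open S" and T: "open T" and g: "smooth_on S g" "g ` S \<subseteq> T"
    and Z: "smooth_on S Z"
  shows "smooth_on S (\<lambda>x. frechet_derivative f (at (g x)) (Z x))"
proof (rule smooth_on_cong[OF _ S])
  show "smooth_on S (\<lambda>x. \<Sum>b\<in>Basis. (Z x \<bullet> b) *\<^sub>R frechet_derivative f (at (g x)) b)"
    by (intro smooth_on_sum smooth_on_scaleR smooth_on_inner_left S Z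
        smooth_on_compose[OF smooth_on_derivative[OF f] S T g])
  show "(\<Sum>b\<in>Basis. (Z x \<bullet> b) *\<^sub>R frechet_derivative f (at (g x)) b) = frechet_derivative f (at (g x)) (Z x)"
    if "x \<in> S" for x
    using derivative_eq_sum_Basis[of f "g x" "Z x"] smooth_on_differentiable[OF f] that g(2) by auto
qed

lemma frechet_derivative_eqI: "(f has_derivative f') (at x) \<Longrightarrow> frechet_derivative f (at x) v = f' v"
  by (simp flip: frechet_derivative_at)

text \<open>Functions with the same germ have the same derivatives, so the choice inside
  \<open>frechet_derivative\<close> falls on the same map, differentiable or not.\<close>

lemma frechet_derivative_cong:
  assumes "\<forall>\<^sub>F y in nhds x. f y = g y"
  shows "frechet_derivative f (at x) = frechet_derivative g (at x)"
proof -
  have "f x = g x" "\<forall>\<^sub>F y in at x. f y = g y"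
    using assms eventually_nhds_x_imp_x by (auto simp: eventually_at_filter elim: eventually_mono)
  moreover have "\<forall>\<^sub>F y in at x. g y = f y"
    using calculation(2) by eventually_elim simp
  ultimately have "(f has_derivative F) (at x) \<longleftrightarrow> (g has_derivative F) (at x)" for F
    using has_derivative_transform_eventually[of f F x UNIV g] has_derivative_transform_eventually[of g F x UNIV f]
    by auto
  then show ?thesis
    unfolding frechet_derivative_def by presburger
qed

subsection \<open>Symmetry of second derivatives\<close>

text \<open>Two applications of the mean value theorem: first in direction \<open>v\<close> to the
  increment of \<open>f\<close> along \<open>w\<close>, then in direction \<open>w\<close> to the
  resulting first derivative.\<close>

lemma second_difference_mvt:
  fixes f :: "'a::real_normed_vector \<Rightarrow> real"
  assumes f: "smooth_on S f" and box: "\<And>s t. s \<in> {0..h} \<Longrightarrow> t \<in> {0..h} \<Longrightarrow> x + s *\<^sub>R v + t *\<^sub>R w \<in> S"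
    and h: "0 < h"
  obtains s t where "s \<in> {0..h}" "t \<in> {0..h}"
    "f (x + h *\<^sub>R v + h *\<^sub>R w) - f (x + h *\<^sub>R v) - f (x + h *\<^sub>R w) + f x =
      h * h * frechet_derivative (\<lambda>y. frechet_derivative f (at y) v) (at (x + s *\<^sub>R v + t *\<^sub>R w)) w"
proof -
  let ?D = "\<lambda>y. frechet_derivative f (at y) v"
  \<comment> \<open>The vacuous summand \<open>0 *\<^sub>R w\<close> makes both terms instances of
    \<open>df\<close>, with t = h and t = 0.\<close>
  define g where "g s = f (x + s *\<^sub>R v + h *\<^sub>R w) - f (x + s *\<^sub>R v + 0 *\<^sub>R w)" for s
  have df: "((\<lambda>s. f (x + s *\<^sub>R v + t *\<^sub>R w)) has_derivative (\<lambda>d. d * ?D (x + s *\<^sub>R v + t *\<^sub>R w))) (at s)"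
    if "s \<in> {0..h}" "t \<in> {0..h}" for s t
  proof -
    have F: "(f has_derivative frechet_derivative f (at (x + s *\<^sub>R v + t *\<^sub>R w))) (at (x + s *\<^sub>R v + t *\<^sub>R w))"
      using smooth_on_has_derivative[OF f box] that by blast
    have "((\<lambda>s. x + s *\<^sub>R v + t *\<^sub>R w) has_derivative (\<lambda>d. d *\<^sub>R v)) (at s)"
      by (auto intro!: derivative_eq_intros)
    from has_derivative_compose[OF this F] linear_scale[OF has_derivative_linear[OF F]]
    show ?thesis by simp
  qed
  have "((\<lambda>s. g s) has_derivative (\<lambda>d. d * ?D (x + s *\<^sub>R v + h *\<^sub>R w) - d * ?D (x + s *\<^sub>R v + 0 *\<^sub>R w))) (at s)"
    if "s \<in> {0..h}" for s
    unfolding g_def by (intro has_derivative_diff df) (use that h in auto)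
  then have "\<exists>s\<in>{0<..<h}. g h - g 0 = h * ?D (x + s *\<^sub>R v + h *\<^sub>R w) - h * ?D (x + s *\<^sub>R v + 0 *\<^sub>R w)"
    using mvt_simple[of 0 h g "\<lambda>s d. d * ?D (x + s *\<^sub>R v + h *\<^sub>R w) - d * ?D (x + s *\<^sub>R v + 0 *\<^sub>R w)"] h
    by (auto intro: has_derivative_at_withinI)
  then obtain s where s: "s \<in> {0<..<h}"
    and gs: "g h - g 0 = h * (?D (x + s *\<^sub>R v + h *\<^sub>R w) - ?D (x + s *\<^sub>R v + 0 *\<^sub>R w))"
    by (auto simp: algebra_simps)
  have "((\<lambda>t. ?D (x + s *\<^sub>R v + t *\<^sub>R w)) has_derivative
      (\<lambda>d. d * frechet_derivative ?D (at (x + s *\<^sub>R v + t *\<^sub>R w)) w)) (at t)" if "t \<in> {0..h}" for t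
  proof -
    have F: "(?D has_derivative frechet_derivative ?D (at (x + s *\<^sub>R v + t *\<^sub>R w))) (at (x + s *\<^sub>R v + t *\<^sub>R w))"
      using smooth_on_has_derivative[OF smooth_on_derivative[OF f] box] that s by auto
    have "((\<lambda>t. x + s *\<^sub>R v + t *\<^sub>R w) has_derivative (\<lambda>d. d *\<^sub>R w)) (at t)"
      by (auto intro!: derivative_eq_intros)
    from has_derivative_compose[OF this F] linear_scale[OF has_derivative_linear[OF F]]
    show ?thesis by simp
  qed
  then have "\<exists>t\<in>{0<..<h}. ?D (x + s *\<^sub>R v + h *\<^sub>R w) - ?D (x + s *\<^sub>R v + 0 *\<^sub>R w) =
      (h - 0) * frechet_derivative ?D (at (x + s *\<^sub>R v + t *\<^sub>R w)) w"
    using mvt_simple[of 0 h "\<lambda>t. ?D (x + s *\<^sub>R v + t *\<^sub>R w)"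
        "\<lambda>t d. d * frechet_derivative ?D (at (x + s *\<^sub>R v + t *\<^sub>R w)) w"] h
    by (auto intro: has_derivative_at_withinI)
  then obtain t where "t \<in> {0<..<h}"
    "?D (x + s *\<^sub>R v + h *\<^sub>R w) - ?D (x + s *\<^sub>R v + 0 *\<^sub>R w) =
      h * frechet_derivative ?D (at (x + s *\<^sub>R v + t *\<^sub>R w)) w"
    by auto
  then show ?thesis
    using that[of s t] s gs by (simp add: g_def)
qed

text \<open>The second difference does not change when \<open>v\<close> and \<open>w\<close> are
  exchanged. So the two mixed derivatives agree at points arbitrarily close to \<open>x\<close>, and
  continuity carries the equality to \<open>x\<close>.\<close>

lemma second_derivative_symmetric:
  fixes f :: "'a::real_normed_vector \<Rightarrow> real"
  assumes "open S" and f: "smooth_on S f" and x: "x \<in> S"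
  shows "frechet_derivative (\<lambda>y. frechet_derivative f (at y) v) (at x) w =
    frechet_derivative (\<lambda>y. frechet_derivative f (at y) w) (at x) v"
proof -
  let ?A = "\<lambda>v w y. frechet_derivative (\<lambda>y. frechet_derivative f (at y) v) (at y) w"
  have "\<bar>?A v w x - ?A w v x\<bar> \<le> 2 * e" if e: "e > 0" for e
  proof -
    have cont: "continuous_on S (?A v w)" for v w
      by (intro smooth_on_continuous smooth_on_derivative f)
    have "\<forall>\<^sub>F y in nhds x. y \<in> S \<and> dist (?A v w y) (?A v w x) < e \<and> dist (?A w v y) (?A w v x) < e"
      using cont[THEN continuous_on_interior[where x = x], of v w]
        cont[THEN continuous_on_interior[where x = x], of w v] x assms(1) e
      by (intro eventually_conj)
        (auto simp: interior_open continuous_at_eps_delta eventually_nhds_metric tendsto_iff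
           open_dist)
    then obtain d where d: "d > 0"
      and D: "\<And>y. dist y x < d \<Longrightarrow> y \<in> S \<and> dist (?A v w y) (?A v w x) < e \<and> dist (?A w v y) (?A w v x) < e"
      by (auto simp: eventually_nhds_metric)
    \<comment> \<open>Small enough for the whole parallelogram spanned by h v and h w to stay within
      distance d of x; the summand 1 keeps the denominator positive when both vectors
      vanish.\<close>
    define h where "h = d / (2 * (norm v + norm w + 1))"
    have h: "h > 0" using d by (simp add: h_def add_nonneg_pos)
    have box: "dist (x + s *\<^sub>R v + t *\<^sub>R w) x < d" if "s \<in> {0..h}" "t \<in> {0..h}" for s t
    proof -
      have "dist (x + s *\<^sub>R v + t *\<^sub>R w) x = norm (s *\<^sub>R v + t *\<^sub>R w)"
        by (simp add: dist_norm add.assoc)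
      also have "\<dots> \<le> s * norm v + t * norm w"
        using that by (intro order.trans[OF norm_triangle_ineq]) auto
      also have "\<dots> \<le> h * norm v + h * norm w"
        using that by (intro add_mono mult_right_mono) auto
      also have "\<dots> < h * (2 * (norm v + norm w + 1))"
        using h by (simp add: algebra_simps) (smt (verit) mult_nonneg_nonneg norm_ge_zero)
      also have "\<dots> = d" by (simp add: h_def add_nonneg_eq_0_iff)
      finally show ?thesis .
    qed
    have boxS: "x + s *\<^sub>R v + t *\<^sub>R w \<in> S" "x + s *\<^sub>R w + t *\<^sub>R v \<in> S"
      if "s \<in> {0..h}" "t \<in> {0..h}" for s t
      using D[OF box[OF that]] D[OF box[OF that(2,1)]] by (simp_all add: add.commute add.left_commute)
    obtain s t where st: "s \<in> {0..h}" "t \<in> {0..h}"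
      "f (x + h *\<^sub>R v + h *\<^sub>R w) - f (x + h *\<^sub>R v) - f (x + h *\<^sub>R w) + f x = h * h * ?A v w (x + s *\<^sub>R v + t *\<^sub>R w)"
      using second_difference_mvt[OF f boxS(1) h] by blast
    obtain s' t' where st': "s' \<in> {0..h}" "t' \<in> {0..h}"
      "f (x + h *\<^sub>R w + h *\<^sub>R v) - f (x + h *\<^sub>R w) - f (x + h *\<^sub>R v) + f x = h * h * ?A w v (x + s' *\<^sub>R w + t' *\<^sub>R v)"
      using second_difference_mvt[OF f boxS(2) h] by blast
    have "h * h * ?A v w (x + s *\<^sub>R v + t *\<^sub>R w) = h * h * ?A w v (x + s' *\<^sub>R w + t' *\<^sub>R v)"
      using st(3) st'(3) by (simp add: algebra_simps)
    then have "?A v w (x + s *\<^sub>R v + t *\<^sub>R w) = ?A w v (x + t' *\<^sub>R v + s' *\<^sub>R w)"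
      using h by (simp add: ac_simps)
    then show ?thesis
      using D[OF box[OF st(1,2)]] D[OF box[OF st'(2,1)]] unfolding dist_real_def by linarith
  qed
  then have "\<bar>?A v w x - ?A w v x\<bar> \<le> e" if "e > 0" for e
    using that half_gt_zero[OF that] by (metis field_sum_of_halves mult_2)
  then show ?thesis
    using field_le_epsilon[of "\<bar>?A v w x - ?A w v x\<bar>" 0] by force
qed

section \<open>Vector fields as derivations\<close>

lemma smooth_on_vf_apply:
  fixes Z :: "'a::euclidean_space \<Rightarrow> 'a"
  assumes "open S" "smooth_on S Z" "smooth_on S f" shows "smooth_on S (vf_apply Z f)"
  unfolding vf_apply_def[abs_def]
  using smooth_on_derivative_apply[OF assms(3,1,1) smooth_on_bounded_linear[OF assms(1) bounded_linear_ident] _ assms(2)]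
  by simp

lemma smooth_on_lie_bracket:
  fixes Z :: "'a::euclidean_space \<Rightarrow> 'a"
  assumes "open S" "smooth_on S Z" "smooth_on S W" shows "smooth_on S (lie_bracket Z W)"
  unfolding lie_bracket_def[abs_def]
  by (intro smooth_on_diff[OF assms(1)] assms
      smooth_on_derivative_apply[where T = S and g = "\<lambda>x. x", OF _ assms(1,1)
        smooth_on_bounded_linear[OF assms(1) bounded_linear_ident]]) auto

lemma smooth_on_commutator:
  fixes X :: "nat \<Rightarrow> 'a::euclidean_space \<Rightarrow> 'a"
  assumes "open S" "\<And>i. i \<in> set I \<Longrightarrow> smooth_on S (X i)" "I \<noteq> []"
  shows "smooth_on S (commutator X I)"
  using assms(2,3)
  by (induction "lie_bracket :: ('a \<Rightarrow> 'a) \<Rightarrow> _" X I rule: iterated_bracket.induct)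
    (auto intro: smooth_on_lie_bracket[OF assms(1)])

lemma eventually_nhds_openI: "open S \<Longrightarrow> x \<in> S \<Longrightarrow> (\<And>y. y \<in> S \<Longrightarrow> P y) \<Longrightarrow> \<forall>\<^sub>F y in nhds x. P y"
  by (auto simp: eventually_nhds)

lemma vf_apply_inner: "vf_apply Z (\<lambda>x. x \<bullet> b) x = Z x \<bullet> b"
  by (simp add: vf_apply_def frechet_derivative_eqI[OF bounded_linear_imp_has_derivative[OF bounded_linear_inner_left]])

lemma smooth_on_inner: "open S \<Longrightarrow> smooth_on S (\<lambda>x. x \<bullet> b)"
  by (intro smooth_on_bounded_linear bounded_linear_inner_left)

lemma vf_apply_cong:
  assumes "open S" "x \<in> S" "\<And>y. y \<in> S \<Longrightarrow> f y = g y"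
  shows "vf_apply Z f x = vf_apply Z g x"
proof -
  have "\<forall>\<^sub>F y in nhds x. f y = g y"
    by (rule eventually_nhds_openI) (use assms in auto)
  from frechet_derivative_cong[OF this] show ?thesis
    by (simp add: vf_apply_def)
qed

lemma vf_apply_diff:
  assumes "f differentiable (at x)" "g differentiable (at x)"
  shows "vf_apply Z (\<lambda>x. f x - g x) x = vf_apply Z f x - vf_apply Z g x"
  unfolding vf_apply_def
  by (rule frechet_derivative_eqI[OF has_derivative_diff[OF
          assms(1)[unfolded frechet_derivative_works] assms(2)[unfolded frechet_derivative_works]]])

lemma vf_apply_sum:
  assumes "\<And>i. i \<in> A \<Longrightarrow> f i differentiable (at x)"
  shows "vf_apply Z (\<lambda>x. \<Sum>i\<in>A. c i * f i x) x = (\<Sum>i\<in>A. c i * vf_apply Z (f i) x)"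
  unfolding vf_apply_def
  by (rule frechet_derivative_eqI[OF has_derivative_sum[OF has_derivative_mult_right[OF
          assms[unfolded frechet_derivative_works]]]])

text \<open>The product rule splits the derivative of Wf into a first order part, which enters the
  bracket coefficients, and a Hessian part, which cancels in ZW - WZ.\<close>

lemma frechet_derivative_along_field:
  fixes f :: "'a::euclidean_space \<Rightarrow> real"
  assumes "open S" "smooth_on S f" "smooth_on S W" "x \<in> S"
  shows "frechet_derivative (vf_apply W f) (at x) v =
    frechet_derivative f (at x) (frechet_derivative W (at x) v) +
    (\<Sum>b\<in>Basis. (W x \<bullet> b) * frechet_derivative (\<lambda>y. frechet_derivative f (at y) b) (at x) v)"
proof -
  have "vf_apply W f y = (\<Sum>b\<in>Basis. (W y \<bullet> b) * frechet_derivative f (at y) b)" if "y \<in> S" for y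
    using derivative_eq_sum_Basis[OF smooth_on_differentiable[OF assms(2) that], of "W y"]
    by (simp add: vf_apply_def)
  then have "\<forall>\<^sub>F y in nhds x. vf_apply W f y = (\<Sum>b\<in>Basis. (W y \<bullet> b) * frechet_derivative f (at y) b)"
    by (rule eventually_nhds_openI[OF assms(1,4)])
  from frechet_derivative_cong[OF this] have "frechet_derivative (vf_apply W f) (at x) v =
      frechet_derivative (\<lambda>y. \<Sum>b\<in>Basis. (W y \<bullet> b) * frechet_derivative f (at y) b) (at x) v"
    by (rule fun_cong)
  also have "\<dots> = (\<Sum>b\<in>Basis. (W x \<bullet> b) * frechet_derivative (\<lambda>y. frechet_derivative f (at y) b) (at x) v +
      (frechet_derivative W (at x) v \<bullet> b) * frechet_derivative f (at x) b)"
    by (rule frechet_derivative_eqI[OF has_derivative_sum[OF has_derivative_mult[OF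
            has_derivative_inner_left[OF smooth_on_has_derivative[OF assms(3,4)]]
            smooth_on_has_derivative[OF smooth_on_derivative[OF assms(2)] assms(4)]]]])
  also have "\<dots> = frechet_derivative f (at x) (frechet_derivative W (at x) v) +
      (\<Sum>b\<in>Basis. (W x \<bullet> b) * frechet_derivative (\<lambda>y. frechet_derivative f (at y) b) (at x) v)"
    using derivative_eq_sum_Basis[OF smooth_on_differentiable[OF assms(2,4)], of "frechet_derivative W (at x) v"]
    by (simp add: sum.distrib)
  finally show ?thesis .
qed

text \<open>Symmetry of the Hessian makes the second order parts of ZW and WZ equal, so the
  coefficient formula for the bracket really is the operator commutator.\<close>

lemma vf_apply_lie_bracket:
  fixes f :: "'a::euclidean_space \<Rightarrow> real"
  assumes S: "open S" and f: "smooth_on S f" and Z: "smooth_on S Z" and W: "smooth_on S W" and x: "x \<in> S"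
  shows "vf_apply (lie_bracket Z W) f x = vf_apply Z (vf_apply W f) x - vf_apply W (vf_apply Z f) x"
proof -
  let ?H = "\<lambda>b. frechet_derivative (\<lambda>y. frechet_derivative f (at y) b) (at x)"
  have H: "?H b v = (\<Sum>c\<in>Basis. (v \<bullet> c) * ?H b c)" for b v
    using derivative_eq_sum_Basis[OF smooth_on_differentiable[OF smooth_on_derivative[OF f] x], of b v]
    unfolding real_scaleR_def .
  have "(\<Sum>b\<in>Basis. (W x \<bullet> b) * ?H b (Z x)) = (\<Sum>b\<in>Basis. \<Sum>c\<in>Basis. (W x \<bullet> b) * ((Z x \<bullet> c) * ?H b c))"
    by (subst H) (simp add: sum_distrib_left)
  also have "\<dots> = (\<Sum>c\<in>Basis. \<Sum>b\<in>Basis. (Z x \<bullet> c) * ((W x \<bullet> b) * ?H c b))"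
    using second_derivative_symmetric[OF S f x] by (subst sum.swap) (simp add: mult.left_commute)
  also have "\<dots> = (\<Sum>c\<in>Basis. (Z x \<bullet> c) * ?H c (W x))"
    by (subst (2) H) (simp add: sum_distrib_left)
  finally have sym: "(\<Sum>b\<in>Basis. (W x \<bullet> b) * ?H b (Z x)) = (\<Sum>c\<in>Basis. (Z x \<bullet> c) * ?H c (W x))" .
  have "vf_apply Z (vf_apply W f) x - vf_apply W (vf_apply Z f) x =
      frechet_derivative f (at x) (frechet_derivative W (at x) (Z x)) -
      frechet_derivative f (at x) (frechet_derivative Z (at x) (W x))"
    unfolding vf_apply_def[of Z "vf_apply W f"] vf_apply_def[of W "vf_apply Z f"]
      frechet_derivative_along_field[OF S f Z x] frechet_derivative_along_field[OF S f W x] sym by simp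
  then show ?thesis
    using linear_diff[OF smooth_on_linear_derivative[OF f x]] by (simp add: vf_apply_def lie_bracket_def)
qed

text \<open>The coordinate functions already recover the coefficients. Identities between brackets
  can thus be checked for operators, where composition is associative.\<close>

lemma vector_field_eqI:
  fixes v w :: "'a::euclidean_space"
  assumes "x \<in> S" "open S"
    and "\<And>f. smooth_on S f \<Longrightarrow> vf_apply (\<lambda>_. v) f x = vf_apply (\<lambda>_. w) f x"
  shows "v = w"
  using assms(3)[OF smooth_on_inner[OF assms(2)]] by (simp add: vf_apply_inner euclidean_eq_iff[of v])

text \<open>Written out as compositions of three operators, both sides have the same terms; this is
  the usual cancellation in an associative algebra.\<close>

lemma lie_bracket_jacobi:
  fixes Z W V :: "'a::euclidean_space \<Rightarrow> 'a"
  assumes S: "open S" and Z: "smooth_on S Z" and W: "smooth_on S W" and V: "smooth_on S V" and x: "x \<in> S"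
  shows "lie_bracket (lie_bracket Z W) V x = lie_bracket Z (lie_bracket W V) x - lie_bracket W (lie_bracket Z V) x"
proof (rule vector_field_eqI[OF x S])
  fix f :: "'a \<Rightarrow> real" assume f: "smooth_on S f"
  note sm = smooth_on_vf_apply[OF S] smooth_on_lie_bracket[OF S]
  have br: "vf_apply P (vf_apply (lie_bracket M N) f) x =
      vf_apply P (vf_apply M (vf_apply N f)) x - vf_apply P (vf_apply N (vf_apply M f)) x"
    if "smooth_on S M" "smooth_on S N" for P M N
  proof -
    have "vf_apply P (vf_apply (lie_bracket M N) f) x =
        vf_apply P (\<lambda>y. vf_apply M (vf_apply N f) y - vf_apply N (vf_apply M f) y) x"
      by (rule vf_apply_cong[OF S x]) (use vf_apply_lie_bracket S f that in blast)
    also have "\<dots> = vf_apply P (vf_apply M (vf_apply N f)) x - vf_apply P (vf_apply N (vf_apply M f)) x"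
      by (intro vf_apply_diff smooth_on_differentiable[OF _ x] sm f that)
    finally show ?thesis .
  qed
  have "vf_apply (lie_bracket (lie_bracket Z W) V) f x =
      vf_apply (lie_bracket Z (lie_bracket W V)) f x - vf_apply (lie_bracket W (lie_bracket Z V)) f x"
    using br f Z W V x by (simp add: vf_apply_lie_bracket[OF S] sm)
  also have "\<dots> = vf_apply (\<lambda>_. lie_bracket Z (lie_bracket W V) x - lie_bracket W (lie_bracket Z V) x) f x"
    using linear_diff[OF smooth_on_linear_derivative[OF f x]] by (simp add: vf_apply_def)
  finally show "vf_apply (\<lambda>_. lie_bracket (lie_bracket Z W) V x) f x =
      vf_apply (\<lambda>_. lie_bracket Z (lie_bracket W V) x - lie_bracket W (lie_bracket Z V) x) f x"
    by (simp add: vf_apply_def)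
qed

lemma lie_bracket_cong:
  assumes "open S" "x \<in> S" "\<And>y. y \<in> S \<Longrightarrow> W y = W' y"
  shows "lie_bracket Z W x = lie_bracket Z W' x"
proof -
  have "\<forall>\<^sub>F y in nhds x. W y = W' y"
    by (rule eventually_nhds_openI) (use assms in auto)
  from frechet_derivative_cong[OF this] show ?thesis
    using assms by (simp add: lie_bracket_def)
qed

lemma lie_bracket_add:
  assumes "Z differentiable (at x)" "V differentiable (at x)" "W differentiable (at x)"
  shows "lie_bracket Z (\<lambda>y. V y + W y) x = lie_bracket Z V x + lie_bracket Z W x"
proof -
  have "frechet_derivative (\<lambda>y. V y + W y) (at x) (Z x) =
      frechet_derivative V (at x) (Z x) + frechet_derivative W (at x) (Z x)"
    by (rule frechet_derivative_eqI[OF has_derivative_add[OF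
            assms(2)[unfolded frechet_derivative_works] assms(3)[unfolded frechet_derivative_works]]])
  then show ?thesis
    using linear_add[OF linear_frechet_derivative[OF assms(1)]] by (simp add: lie_bracket_def)
qed

lemma lie_bracket_scaleR:
  assumes "Z differentiable (at x)" "V differentiable (at x)"
  shows "lie_bracket Z (\<lambda>y. c *\<^sub>R V y) x = c *\<^sub>R lie_bracket Z V x"
proof -
  have "frechet_derivative (\<lambda>y. c *\<^sub>R V y) (at x) (Z x) = c *\<^sub>R frechet_derivative V (at x) (Z x)"
    by (rule frechet_derivative_eqI[OF has_derivative_scaleR_right[OF
            assms(2)[unfolded frechet_derivative_works]]])
  then show ?thesis
    using linear_scale[OF linear_frechet_derivative[OF assms(1)]] by (simp add: lie_bracket_def scaleR_diff_right)
qed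

lemma lie_bracket_sum_list:
  fixes V :: "'b \<Rightarrow> 'a::euclidean_space \<Rightarrow> 'a"
  assumes S: "open S" and x: "x \<in> S" and Z: "smooth_on S Z"
    and V: "\<And>c K. (c, K) \<in> set L \<Longrightarrow> smooth_on S (V K)"
  shows "smooth_on S (\<lambda>y. \<Sum>(c, K)\<leftarrow>L. c *\<^sub>R V K y) \<and>
    lie_bracket Z (\<lambda>y. \<Sum>(c, K)\<leftarrow>L. c *\<^sub>R V K y) x = (\<Sum>(c, K)\<leftarrow>L. c *\<^sub>R lie_bracket Z (V K) x)"
  using V
proof (induction L)
  case Nil
  then show ?case
    using linear_0[OF smooth_on_linear_derivative[OF Z x]] by (simp add: smooth_on_const lie_bracket_def)
next
  case (Cons a L)
  obtain c K where a: "a = (c, K)" by (cases a)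
  have 1: "smooth_on S (V K)" "smooth_on S (\<lambda>y. c *\<^sub>R V K y)"
    using Cons.prems a by (auto intro!: smooth_on_scaleR[OF S smooth_on_const])
  have 2: "smooth_on S (\<lambda>y. \<Sum>(c, K)\<leftarrow>L. c *\<^sub>R V K y)"
    "lie_bracket Z (\<lambda>y. \<Sum>(c, K)\<leftarrow>L. c *\<^sub>R V K y) x = (\<Sum>(c, K)\<leftarrow>L. c *\<^sub>R lie_bracket Z (V K) x)"
    using Cons by auto
  show ?case
    using lie_bracket_add[OF smooth_on_differentiable[OF Z x] smooth_on_differentiable[OF 1(2) x] smooth_on_differentiable[OF 2(1) x]]
      lie_bracket_scaleR[OF smooth_on_differentiable[OF Z x] smooth_on_differentiable[OF 1(1) x]]
      smooth_on_add[OF S 1(2) 2(1)] 2(2)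
    by (simp add: a)
qed

section \<open>Commutators of commutators\<close>

text \<open>The Jacobi identity \<open>[[\<xi>\<^sub>i, \<xi>\<^bsub>[I]\<^esub>], \<xi>\<^bsub>[J]\<^esub>] = [\<xi>\<^sub>i, [\<xi>\<^bsub>[I]\<^esub>, \<xi>\<^bsub>[J]\<^esub>]] - [\<xi>\<^bsub>[I]\<^esub>, [\<xi>\<^sub>i, \<xi>\<^bsub>[J]\<^esub>]]\<close> rewrites
  \<open>[\<xi>\<^bsub>[I]\<^esub>, \<xi>\<^bsub>[J]\<^esub>]\<close> as a signed sum of right-nested commutators.\<close>

fun bracket_expansion :: "nat list \<Rightarrow> nat list \<Rightarrow> (real \<times> nat list) list" where
  "bracket_expansion [] J = []"
| "bracket_expansion [i] J = [(1, i # J)]"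
| "bracket_expansion (i # j # I) J =
     map (\<lambda>(c, K). (c, i # K)) (bracket_expansion (j # I) J) @
     map (\<lambda>(c, K). (- c, K)) (bracket_expansion (j # I) (i # J))"

lemma bracket_expansion_weight:
  "(c, K) \<in> set (bracket_expansion I J) \<Longrightarrow> I \<in> multiindices n \<Longrightarrow> J \<in> multiindices n \<Longrightarrow>
    K \<in> multiindices n \<and> wt K = wt I + wt J"
  by (induction I J arbitrary: c K rule: bracket_expansion.induct)
    (fastforce simp: multiindices_def wt_def split: if_splits)+

lemma lie_bracket_commutators:
  fixes X :: "nat \<Rightarrow> 'a::euclidean_space \<Rightarrow> 'a"
  assumes S: "open S" and X: "\<And>i. i \<le> n \<Longrightarrow> smooth_on S (X i)"
    and "I \<in> multiindices n" "J \<in> multiindices n" "x \<in> S"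
  shows "lie_bracket (commutator X I) (commutator X J) x = (\<Sum>(c, K)\<leftarrow>bracket_expansion I J. c *\<^sub>R commutator X K x)"
  using assms(3-)
proof (induction I J arbitrary: x rule: bracket_expansion.induct)
  case (1 J)
  then show ?case by (simp add: multiindices_def)
next
  case (2 i J)
  then show ?case by (cases J) (auto simp: multiindices_def)
next
  case (3 i j I J)
  have sm: "smooth_on S (commutator X K)" if "K \<in> multiindices n" for K
    using that X by (intro smooth_on_commutator[OF S]) (auto simp: multiindices_def)
  have I: "j # I \<in> multiindices n" "[i] \<in> multiindices n" "i # J \<in> multiindices n"
    using 3 by (auto simp: multiindices_def)
  have Xi: "smooth_on S (X i)" using sm[OF I(2)] by simp
  have cons: "commutator X (i # K) = lie_bracket (X i) (commutator X K)" if "K \<in> multiindices n" for K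
    using that by (cases K) (auto simp: multiindices_def)
  have nonempty: "K \<in> multiindices n" if "(c, K) \<in> set (bracket_expansion (j # I) J)" for c K
    using bracket_expansion_weight[OF that I(1) "3.prems"(2)] by blast
  have "lie_bracket (commutator X (i # j # I)) (commutator X J) x =
     lie_bracket (X i) (lie_bracket (commutator X (j # I)) (commutator X J)) x -
     lie_bracket (commutator X (j # I)) (lie_bracket (X i) (commutator X J)) x"
    using lie_bracket_jacobi[OF S Xi sm[OF I(1)] sm[OF "3.prems"(2)] "3.prems"(3)] by simp
  \<comment> \<open>The induction hypothesis holds at every point of \<open>S\<close>, so it may be
    inserted under the outer bracket, which depends only on germs.\<close>
  also have "lie_bracket (X i) (lie_bracket (commutator X (j # I)) (commutator X J)) x =
      lie_bracket (X i) (\<lambda>y. \<Sum>(c, K)\<leftarrow>bracket_expansion (j # I) J. c *\<^sub>R commutator X K y) x"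
    by (rule lie_bracket_cong[OF S "3.prems"(3)]) (use 3 I in auto)
  also have "\<dots> = (\<Sum>(c, K)\<leftarrow>bracket_expansion (j # I) J. c *\<^sub>R lie_bracket (X i) (commutator X K) x)"
    using lie_bracket_sum_list[OF S "3.prems"(3) Xi, of "bracket_expansion (j # I) J" "commutator X"] sm nonempty
    by blast
  also have "\<dots> = (\<Sum>(c, K)\<leftarrow>bracket_expansion (j # I) J. c *\<^sub>R commutator X (i # K) x)"
    by (rule arg_cong[where f = sum_list], rule map_cong) (use nonempty cons in auto)
  also have "lie_bracket (commutator X (j # I)) (lie_bracket (X i) (commutator X J)) x =
      (\<Sum>(c, K)\<leftarrow>bracket_expansion (j # I) (i # J). c *\<^sub>R commutator X K x)"
    using "3.IH"(2)[OF I(1,3) "3.prems"(3)] cons[OF "3.prems"(2)] by simp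
  finally show ?case
    by (simp add: o_def case_prod_beta uminus_sum_list_map)
qed

section \<open>Commutators in terms of words\<close>

lemma nc_mult_var_left:
  "nc_mult (nc_var i) P J = (if J \<noteq> [] \<and> hd J = i then P (tl J) else 0)"
proof (cases J)
  case (Cons j K)
  have "nc_mult (nc_var i) P J = (\<Sum>k\<le>length J. if k = 1 then (if j = i then P K else 0) else 0)"
    unfolding nc_mult_def
  proof (rule sum.cong[OF refl])
    fix k assume "k \<in> {..length J}"
    then show "nc_var i (take k J) * P (drop k J) = (if k = 1 then if j = i then P K else 0 else 0)"
      using Cons by (cases k; cases "k - 1"; cases K) (auto simp: nc_var_def)
  qed
  then show ?thesis using Cons by (auto simp: Suc_le_eq)
qed (simp add: nc_mult_def nc_var_def)

lemma nc_mult_var_right: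
  "nc_mult P (nc_var i) J = (if J \<noteq> [] \<and> last J = i then P (butlast J) else 0)"
proof (cases J rule: rev_cases)
  case (snoc K j)
  have "nc_mult P (nc_var i) J = (\<Sum>k\<le>length J. if k = length K then (if j = i then P K else 0) else 0)"
    unfolding nc_mult_def
  proof (rule sum.cong[OF refl])
    fix k assume k: "k \<in> {..length J}"
    have "length (drop k J) \<noteq> 1" if "k \<noteq> length K"
      using that k snoc by simp
    then have "drop k J \<noteq> [i]" if "k \<noteq> length K"
      using that by (metis One_nat_def length_Cons list.size(3))
    then show "P (take k J) * nc_var i (drop k J) = (if k = length K then if j = i then P K else 0 else 0)"
      using snoc by (auto simp: nc_var_def)
  qed
  then show ?thesis using snoc by auto
qed (simp add: nc_mult_def nc_var_def)

lemma nc_coeff_Cons: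
  assumes "I \<noteq> []"
  shows "nc_coeff (i # I) J = (if J \<noteq> [] \<and> hd J = i then nc_coeff I (tl J) else 0) -
    (if J \<noteq> [] \<and> last J = i then nc_coeff I (butlast J) else 0)"
  using assms nc_mult_var_left[of i "iterated_bracket nc_bracket nc_var I" J]
    nc_mult_var_right[of "iterated_bracket nc_bracket nc_var I" i J]
  by (cases I) (simp_all add: nc_coeff_def nc_bracket_def)

text \<open>Bracketing with a variable puts its letter at the front or at the back of each word, so
  every word that occurs is a rearrangement of \<open>I\<close>.\<close>

lemma nc_coeff_homogeneous:
  "I \<noteq> [] \<Longrightarrow> nc_coeff I J \<noteq> 0 \<Longrightarrow> length J = length I \<and> wt J = wt I"
proof (induction I arbitrary: J)
  case (Cons i I)
  show ?case
  proof (cases "I = []")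
    case True
    then show ?thesis
      using Cons.prems by (auto simp: nc_coeff_def nc_var_def split: if_splits)
  next
    case False
    have "J \<noteq> [] \<and> hd J = i \<and> nc_coeff I (tl J) \<noteq> 0 \<or> J \<noteq> [] \<and> last J = i \<and> nc_coeff I (butlast J) \<noteq> 0"
      using Cons.prems(2) unfolding nc_coeff_Cons[OF False] by (auto split: if_splits)
    then consider K where "J = i # K" "nc_coeff I K \<noteq> 0" | K where "J = K @ [i]" "nc_coeff I K \<noteq> 0"
      by (metis append_butlast_last_id list.collapse)
    then show ?thesis
      using Cons.IH[OF False] by cases (auto simp: wt_def)
  qed
qed simp

text \<open>The substitution of X_i for the i-th indeterminate, extended multiplicatively: a word
  becomes a composition of derivations.\<close>

primrec apply_word ::
  "(nat \<Rightarrow> 'a::real_normed_vector \<Rightarrow> 'a) \<Rightarrow> nat list \<Rightarrow> ('a \<Rightarrow> real) \<Rightarrow> 'a \<Rightarrow> real" where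
  "apply_word X [] f = f"
| "apply_word X (i # J) f = vf_apply (X i) (apply_word X J f)"

lemma apply_word_snoc: "apply_word X (J @ [i]) f = apply_word X J (vf_apply (X i) f)"
  by (induction J) auto

lemma smooth_on_apply_word:
  fixes X :: "nat \<Rightarrow> 'a::euclidean_space \<Rightarrow> 'a"
  assumes "open S" "\<And>i. i \<in> set J \<Longrightarrow> smooth_on S (X i)" "smooth_on S f"
  shows "smooth_on S (apply_word X J f)"
  using assms(2) by (induction J) (auto intro: assms smooth_on_vf_apply)

definition words :: "nat \<Rightarrow> nat \<Rightarrow> nat list set" where
  "words n m = {J. set J \<subseteq> {0..n} \<and> length J = m}"

lemma finite_words: "finite (words n m)"
  unfolding words_def by (rule finite_lists_length_eq) simp

lemma sum_words_hd:
  assumes "i \<le> n"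
  shows "(\<Sum>J\<in>words n (Suc m). (if J \<noteq> [] \<and> hd J = i then g (tl J) else 0) * h J) =
    (\<Sum>J\<in>words n m. g J * h (i # J) :: real)"
proof -
  have "(\<Sum>J\<in>words n (Suc m). (if J \<noteq> [] \<and> hd J = i then g (tl J) else 0) * h J) =
      (\<Sum>J\<in>(#) i ` words n m. (if J \<noteq> [] \<and> hd J = i then g (tl J) else 0) * h J)"
    by (rule sum.mono_neutral_right[OF finite_words])
      (use assms in \<open>force simp: words_def length_Suc_conv image_iff\<close>)+
  also have "\<dots> = (\<Sum>J\<in>words n m. g J * h (i # J))"
    by (subst sum.reindex) auto
  finally show ?thesis .
qed

lemma sum_words_last:
  assumes "i \<le> n"
  shows "(\<Sum>J\<in>words n (Suc m). (if J \<noteq> [] \<and> last J = i then g (butlast J) else 0) * h J) =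
    (\<Sum>J\<in>words n m. g J * h (J @ [i]) :: real)"
proof -
  have "(\<Sum>J\<in>words n (Suc m). (if J \<noteq> [] \<and> last J = i then g (butlast J) else 0) * h J) =
      (\<Sum>J\<in>(\<lambda>J. J @ [i]) ` words n m. (if J \<noteq> [] \<and> last J = i then g (butlast J) else 0) * h J)"
    by (rule sum.mono_neutral_right[OF finite_words])
      (use assms in \<open>force simp: words_def length_Suc_conv_rev image_iff\<close>)+
  also have "\<dots> = (\<Sum>J\<in>words n m. g J * h (J @ [i]))"
    by (subst sum.reindex) (auto simp: inj_on_def)
  finally show ?thesis .
qed

text \<open>X_[I] is the image of its Lie polynomial under substitution. In the induction the two
  terms of the operator commutator put the new letter in front of and behind each word, matching the
  two terms of \<open>nc_coeff_Cons\<close>.\<close>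

lemma vf_apply_commutator:
  fixes X :: "nat \<Rightarrow> 'a::euclidean_space \<Rightarrow> 'a"
  assumes S: "open S" and X: "\<And>i. i \<le> n \<Longrightarrow> smooth_on S (X i)"
    and "I \<in> multiindices n" "smooth_on S f" "x \<in> S"
  shows "vf_apply (commutator X I) f x = (\<Sum>J\<in>words n (length I). nc_coeff I J * apply_word X J f x)"
  using assms(3-)
proof (induction I arbitrary: f x)
  case (Cons i I)
  have i: "i \<le> n" using Cons.prems by (auto simp: multiindices_def)
  show ?case
  proof (cases "I = []")
    case True
    have "(\<Sum>J\<in>words n 1. nc_coeff [i] J * apply_word X J f x) = (\<Sum>J\<in>{[i]}. nc_coeff [i] J * apply_word X J f x)"
      by (rule sum.mono_neutral_right[OF finite_words]) (use i in \<open>auto simp: words_def nc_coeff_def nc_var_def\<close>)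
    then show ?thesis
      using True by (simp add: nc_coeff_def nc_var_def)
  next
    case False
    then have I: "I \<in> multiindices n" using Cons.prems by (auto simp: multiindices_def)
    have XI: "smooth_on S (commutator X I)"
      using I X by (intro smooth_on_commutator[OF S]) (auto simp: multiindices_def)
    have w: "smooth_on S (apply_word X J f)" if "J \<in> words n m" for J m
      using that X Cons.prems by (intro smooth_on_apply_word[OF S]) (auto simp: words_def)
    have "vf_apply (commutator X (i # I)) f x =
        vf_apply (X i) (vf_apply (commutator X I) f) x - vf_apply (commutator X I) (vf_apply (X i) f) x"
      using False vf_apply_lie_bracket[OF S Cons.prems(2) X[OF i] XI Cons.prems(3)] by (cases I) auto
    also have "vf_apply (X i) (vf_apply (commutator X I) f) x =
        vf_apply (X i) (\<lambda>y. \<Sum>J\<in>words n (length I). nc_coeff I J * apply_word X J f y) x"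
      by (rule vf_apply_cong[OF S Cons.prems(3)]) (use Cons.IH[OF I Cons.prems(2)] in auto)
    also have "\<dots> = (\<Sum>J\<in>words n (length I). nc_coeff I J * apply_word X (i # J) f x)"
      using vf_apply_sum[of "words n (length I)" "\<lambda>J. apply_word X J f"] smooth_on_differentiable[OF w Cons.prems(3)]
      by simp
    also have "\<dots> = (\<Sum>J\<in>words n (Suc (length I)). (if J \<noteq> [] \<and> hd J = i then nc_coeff I (tl J) else 0) * apply_word X J f x)"
      by (rule sum_words_hd[OF i, where g = "nc_coeff I" and h = "\<lambda>J. apply_word X J f x", symmetric])
    also have "vf_apply (commutator X I) (vf_apply (X i) f) x =
        (\<Sum>J\<in>words n (length I). nc_coeff I J * apply_word X (J @ [i]) f x)"
      using Cons.IH[OF I smooth_on_vf_apply[OF S X[OF i] Cons.prems(2)] Cons.prems(3)] by (simp add: apply_word_snoc)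
    also have "\<dots> = (\<Sum>J\<in>words n (Suc (length I)). (if J \<noteq> [] \<and> last J = i then nc_coeff I (butlast J) else 0) * apply_word X J f x)"
      by (rule sum_words_last[OF i, where g = "nc_coeff I" and h = "\<lambda>J. apply_word X J f x", symmetric])
    finally show ?thesis
      by (simp add: nc_coeff_Cons[OF False] left_diff_distrib sum_subtractf)
  qed
qed (simp add: multiindices_def)

text \<open>A relation between Lie polynomials is a relation between coefficients of words, so it
  passes to every system of smooth fields. This is how constants found for \<open>X\<close> come to
  hold for \<open>Y\<close>.\<close>

lemma commutator_linear_relation:
  fixes X :: "nat \<Rightarrow> 'a::euclidean_space \<Rightarrow> 'a" and B :: "'j \<Rightarrow> nat list"
  assumes S: "open S" and X: "\<And>i. i \<le> n \<Longrightarrow> smooth_on S (X i)"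
    and I: "I \<in> multiindices n" and B: "\<And>j. j \<in> A \<Longrightarrow> B j \<in> multiindices n" and A: "finite A"
    and rel: "\<And>J. nc_coeff I J = (\<Sum>j\<in>A. c j * nc_coeff (B j) J)" and x: "x \<in> S"
  shows "commutator X I x = (\<Sum>j\<in>A. c j *\<^sub>R commutator X (B j) x)"
proof (rule vector_field_eqI[OF x S])
  fix f :: "'a \<Rightarrow> real" assume f: "smooth_on S f"
  \<comment> \<open>A common length bound: the expansions of all the commutators involved become
    sums over the single finite set \<open>T\<close>, so that sums can be exchanged.\<close>
  define M where "M = Max (length ` insert I (B ` A))"
  define T where "T = (\<Union>m\<le>M. words n m)"
  have T: "finite T" by (simp add: T_def finite_words)
  have ext: "vf_apply (commutator X K) f x = (\<Sum>J\<in>T. nc_coeff K J * apply_word X J f x)"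
    if K: "K \<in> multiindices n" "length K \<le> M" for K
  proof -
    have "(\<Sum>J\<in>words n (length K). nc_coeff K J * apply_word X J f x) = (\<Sum>J\<in>T. nc_coeff K J * apply_word X J f x)"
    proof (rule sum.mono_neutral_left[OF T])
      show "words n (length K) \<subseteq> T" using K by (auto simp: T_def)
      show "\<forall>J\<in>T - words n (length K). nc_coeff K J * apply_word X J f x = 0"
        using nc_coeff_homogeneous[of K] K by (auto simp: T_def words_def multiindices_def)
    qed
    then show ?thesis using vf_apply_commutator[OF S X K(1) f x] by simp
  qed
  have le: "length I \<le> M" "\<And>j. j \<in> A \<Longrightarrow> length (B j) \<le> M"
    using A by (auto simp: M_def)
  have lin: "linear (frechet_derivative f (at x))" using smooth_on_linear_derivative[OF f x] .
  have "vf_apply (commutator X I) f x = (\<Sum>J\<in>T. \<Sum>j\<in>A. c j * (nc_coeff (B j) J * apply_word X J f x))"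
    by (simp add: ext[OF I le(1)] rel sum_distrib_right mult.assoc)
  also have "\<dots> = (\<Sum>j\<in>A. c j * vf_apply (commutator X (B j)) f x)"
    by (subst sum.swap) (auto intro!: sum.cong simp: ext B le sum_distrib_left)
  also have "\<dots> = vf_apply (\<lambda>_. \<Sum>j\<in>A. c j *\<^sub>R commutator X (B j) x) f x"
    by (simp add: vf_apply_def linear_sum[OF lin] linear_scale[OF lin])
  finally show "vf_apply (\<lambda>_. commutator X I x) f x = vf_apply (\<lambda>_. \<Sum>j\<in>A. c j *\<^sub>R commutator X (B j) x) f x"
    by (simp add: vf_apply_def)
qed

section \<open>Structure constants of a free system\<close>

lemma length_le_wt: "length I \<le> wt I"
  by (induction I) (auto simp: wt_def)

lemma finite_multiindices: "finite {I. I \<in> multiindices n \<and> wt I \<le> r}"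
proof (rule finite_subset)
  show "{I. I \<in> multiindices n \<and> wt I \<le> r} \<subseteq> {I. set I \<subseteq> {0..n} \<and> length I \<le> r}"
    using length_le_wt order.trans by (fastforce simp: multiindices_def)
  show "finite {I. set I \<subseteq> {0..n} \<and> length I \<le> r}"
    by (rule finite_lists_length_le) simp
qed

text \<open>At a single point \<open>X\<^bsub>[I]\<^esub>\<close> is a combination of the basis fields; freeness turns this into an identity
  between Lie polynomials, whose part of weight \<open>|I|\<close> is again an identity.\<close>

lemma free_system_relations:
  fixes X :: "nat \<Rightarrow> real^'p \<Rightarrow> real^'p" and B :: "'p \<Rightarrow> nat list"
  assumes free: "free_up_to n r \<Omega> X" and basis: "basis_multiindices n r \<Omega> X B" and "x \<in> \<Omega>"
    and I: "I \<in> multiindices n" "wt I \<le> r"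
  obtains c where "\<And>j. c j \<noteq> 0 \<Longrightarrow> wt (B j) = wt I"
    and "\<And>J. nc_coeff I J = (\<Sum>j\<in>UNIV. c j * nc_coeff (B j) J)"
proof -
  let ?M = "{I. I \<in> multiindices n \<and> wt I \<le> r}"
  have B: "B j \<in> ?M" for j using basis by (auto simp: basis_multiindices_def)
  have inj: "inj (\<lambda>j. commutator X (B j) x)" and sp: "span (range (\<lambda>j. commutator X (B j) x)) = UNIV"
    using basis \<open>x \<in> \<Omega>\<close> by (auto simp: basis_multiindices_def)
  have "commutator X I x \<in> span (range (\<lambda>j. commutator X (B j) x))"
    using sp by simp
  then obtain d where "commutator X I x = (\<Sum>v\<in>range (\<lambda>j. commutator X (B j) x). d v *\<^sub>R v)"
    unfolding span_finite[OF finite_imageI[OF finite]] by auto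
  then have d: "commutator X I x = (\<Sum>j\<in>UNIV. d (commutator X (B j) x) *\<^sub>R commutator X (B j) x)"
    by (simp add: sum.reindex[OF inj])
  define e where "e j = d (commutator X (B j) x)" for j
  \<comment> \<open>The pointwise relation X_[I] = sum of e_j X_[B j] at \<open>x\<close>, rewritten
    as a vanishing combination over all multiindices of weight at most r, the form in which freeness
    applies.\<close>
  define a where "a K = (if K = I then 1 else 0) - (\<Sum>j\<in>UNIV. e j * (if K = B j then 1 else 0))" for K
  have a_sum: "(\<Sum>K\<in>?M. a K *\<^sub>R g K) = g I - (\<Sum>j\<in>UNIV. e j *\<^sub>R g (B j))"
    for g :: "nat list \<Rightarrow> 'b::real_vector"
  proof -
    have "(\<Sum>K\<in>?M. a K *\<^sub>R g K) = (\<Sum>K\<in>?M. (if K = I then g K else 0)) -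
        (\<Sum>K\<in>?M. \<Sum>j\<in>UNIV. (if K = B j then e j *\<^sub>R g K else 0))"
      unfolding a_def scaleR_left_diff_distrib sum_subtractf scaleR_sum_left
      by (intro arg_cong2[where f = minus] sum.cong refl) auto
    also have "(\<Sum>K\<in>?M. (if K = I then g K else 0)) = g I"
      using finite_multiindices I by (simp add: sum.delta)
    also have "(\<Sum>K\<in>?M. \<Sum>j\<in>UNIV. (if K = B j then e j *\<^sub>R g K else 0)) = (\<Sum>j\<in>UNIV. e j *\<^sub>R g (B j))"
      using finite_multiindices B by (subst sum.swap) (simp add: sum.delta)
    finally show ?thesis .
  qed
  have "(\<Sum>K\<in>?M. a K *\<^sub>R commutator X K x) = 0"
    unfolding a_sum using d by (simp add: e_def)
  then have "\<forall>J. (\<Sum>K\<in>?M. a K * nc_coeff K J) = 0"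
    using free \<open>x \<in> \<Omega>\<close> unfolding free_up_to_def by blast
  then have e: "nc_coeff I J = (\<Sum>j\<in>UNIV. e j * nc_coeff (B j) J)" for J
    using a_sum[of "\<lambda>K. nc_coeff K J"] by simp
  define c where "c j = (if wt (B j) = wt I then e j else 0)" for j
  have ne: "I \<noteq> []" "\<And>j. B j \<noteq> []" using I B by (auto simp: multiindices_def)
  have rel: "nc_coeff I J = (\<Sum>j\<in>UNIV. c j * nc_coeff (B j) J)" for J
  proof (cases "wt J = wt I")
    case True
    have eq: "e j * nc_coeff (B j) J = c j * nc_coeff (B j) J" for j
      using nc_coeff_homogeneous[OF ne(2), of j J] True by (cases "nc_coeff (B j) J = 0") (auto simp: c_def)
    show ?thesis
      unfolding e[of J] by (rule sum.cong[OF refl eq])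
  next
    case False
    have z: "c j * nc_coeff (B j) J = 0" for j
      using nc_coeff_homogeneous[OF ne(2), of j J] False by (cases "nc_coeff (B j) J = 0") (auto simp: c_def)
    have "nc_coeff I J = 0" using nc_coeff_homogeneous[OF ne(1), of J] False by auto
    then show ?thesis by (simp only: z sum.neutral_const)
  qed
  have "wt (B j) = wt I" if "c j \<noteq> 0" for j
    using that by (auto simp: c_def split: if_splits)
  then show ?thesis
    by (rule that[OF _ rel])
qed

text \<open>The constants are read off from \<open>X\<close> at one point, yet the conclusions
  quantify over all systems \<open>Y\<close> on all open sets, because what is extracted is a set of
  Lie polynomial identities. The numbers \<open>b\<close> arise by writing the bracket of two basis
  commutators as right-nested commutators and expanding each of these with \<open>c\<close>.\<close>

lemma free_system_structure:
  fixes X :: "nat \<Rightarrow> real^'p \<Rightarrow> real^'p" and B :: "'p \<Rightarrow> nat list"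
  assumes free: "free_up_to n r \<Omega> X" and basis: "basis_multiindices n r \<Omega> X B" and "x \<in> \<Omega>"
  obtains c :: "nat list \<Rightarrow> 'p \<Rightarrow> real" and b :: "'p \<Rightarrow> 'p \<Rightarrow> 'p \<Rightarrow> real"
  where "\<And>I j. c I j \<noteq> 0 \<Longrightarrow> wt (B j) = wt I"
    and "\<And>S (Y :: nat \<Rightarrow> real^'p \<Rightarrow> real^'p) I u. open S \<Longrightarrow> (\<And>i. i \<le> n \<Longrightarrow> smooth_on S (Y i)) \<Longrightarrow> u \<in> S \<Longrightarrow>
      I \<in> multiindices n \<Longrightarrow> wt I \<le> r \<Longrightarrow> commutator Y I u = (\<Sum>j\<in>UNIV. c I j *\<^sub>R commutator Y (B j) u)"
    and "\<And>j k l. b j k l \<noteq> 0 \<Longrightarrow> wt (B l) = wt (B j) + wt (B k)"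
    and "\<And>S (Y :: nat \<Rightarrow> real^'p \<Rightarrow> real^'p) j k u. open S \<Longrightarrow> (\<And>i. i \<le> n \<Longrightarrow> smooth_on S (Y i)) \<Longrightarrow> u \<in> S \<Longrightarrow>
      wt (B j) + wt (B k) \<le> r \<Longrightarrow>
      lie_bracket (commutator Y (B j)) (commutator Y (B k)) u = (\<Sum>l\<in>UNIV. b j k l *\<^sub>R commutator Y (B l) u)"
proof -
  have B: "B j \<in> multiindices n" for j using basis by (auto simp: basis_multiindices_def)
  have "\<exists>c. (\<forall>j. c j \<noteq> 0 \<longrightarrow> wt (B j) = wt I) \<and>
      (I \<in> multiindices n \<and> wt I \<le> r \<longrightarrow> (\<forall>J. nc_coeff I J = (\<Sum>j\<in>UNIV. c j * nc_coeff (B j) J)))" for I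
  proof (cases "I \<in> multiindices n \<and> wt I \<le> r")
    case True
    then obtain c where "\<And>j. c j \<noteq> 0 \<Longrightarrow> wt (B j) = wt I" "\<And>J. nc_coeff I J = (\<Sum>j\<in>UNIV. c j * nc_coeff (B j) J)"
      using free_system_relations[OF assms, of I] by blast
    then show ?thesis by blast
  next
    case False
    then show ?thesis by (intro exI[of _ "\<lambda>_. 0"]) auto
  qed
  then have "\<exists>c. \<forall>I. (\<forall>j. c I j \<noteq> 0 \<longrightarrow> wt (B j) = wt I) \<and>
      (I \<in> multiindices n \<and> wt I \<le> r \<longrightarrow> (\<forall>J. nc_coeff I J = (\<Sum>j\<in>UNIV. c I j * nc_coeff (B j) J)))"
    by (intro choice allI)
  then obtain c where c: "\<And>I j. c I j \<noteq> 0 \<Longrightarrow> wt (B j) = wt I"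
    and rel: "\<And>I J. I \<in> multiindices n \<Longrightarrow> wt I \<le> r \<Longrightarrow> nc_coeff I J = (\<Sum>j\<in>UNIV. c I j * nc_coeff (B j) J)"
    by blast
  have comm: "commutator Y I u = (\<Sum>j\<in>UNIV. c I j *\<^sub>R commutator Y (B j) u)"
    if "open S" "\<And>i. i \<le> n \<Longrightarrow> smooth_on S (Y i)" "u \<in> S" "I \<in> multiindices n" "wt I \<le> r"
    for S and Y :: "nat \<Rightarrow> real^'p \<Rightarrow> real^'p" and I u
    using commutator_linear_relation[OF that(1,2,4) B finite rel[OF that(4,5)] that(3)] by simp
  define b where "b j k l = (\<Sum>(s, K)\<leftarrow>bracket_expansion (B j) (B k). s * c K l)" for j k l
  have b_weight: "wt (B l) = wt (B j) + wt (B k)" if "b j k l \<noteq> 0" for j k l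
  proof (rule ccontr)
    assume ne: "wt (B l) \<noteq> wt (B j) + wt (B k)"
    have "s * c K l = 0" if "(s, K) \<in> set (bracket_expansion (B j) (B k))" for s K
      using bracket_expansion_weight[OF that B B] ne c[of K l] by auto
    then have "map (\<lambda>(s, K). s * c K l) (bracket_expansion (B j) (B k)) = map (\<lambda>_. 0) (bracket_expansion (B j) (B k))"
      by auto
    then have "b j k l = 0" by (simp only: b_def) (simp add: sum_list_0)
    then show False using that by simp
  qed
  have bracket: "lie_bracket (commutator Y (B j)) (commutator Y (B k)) u = (\<Sum>l\<in>UNIV. b j k l *\<^sub>R commutator Y (B l) u)"
    if Y: "open S" "\<And>i. i \<le> n \<Longrightarrow> smooth_on S (Y i)" "u \<in> S" and jk: "wt (B j) + wt (B k) \<le> r"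
    for S and Y :: "nat \<Rightarrow> real^'p \<Rightarrow> real^'p" and j k u
  proof -
    have "(\<Sum>(s, K)\<leftarrow>L. s *\<^sub>R commutator Y K u) = (\<Sum>l\<in>UNIV. (\<Sum>(s, K)\<leftarrow>L. s * c K l) *\<^sub>R commutator Y (B l) u)"
      if "\<And>s K. (s, K) \<in> set L \<Longrightarrow> K \<in> multiindices n \<and> wt K \<le> r" for L
      using that
    proof (induction L)
      case (Cons a L)
      obtain s K where a: "a = (s, K)" by (cases a)
      have "commutator Y K u = (\<Sum>j\<in>UNIV. c K j *\<^sub>R commutator Y (B j) u)"
        by (rule comm[OF Y]) (use Cons.prems a in auto)
      moreover have "(\<Sum>(s, K)\<leftarrow>L. s *\<^sub>R commutator Y K u) = (\<Sum>l\<in>UNIV. (\<Sum>(s, K)\<leftarrow>L. s * c K l) *\<^sub>R commutator Y (B l) u)"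
        by (rule Cons.IH) (use Cons.prems in auto)
      ultimately show ?case
        by (simp add: a scaleR_left_distrib sum.distrib scaleR_sum_right)
    qed simp
    then show ?thesis
      using lie_bracket_commutators[OF Y(1,2) B B Y(3)] bracket_expansion_weight[OF _ B B] jk by (simp add: b_def)
  qed
  show ?thesis
    by (rule that[of c b]) (fact c, fact comm, fact b_weight, fact bracket)
qed

section \<open>Taylor coefficients and weights\<close>

abbreviation partial :: "'p::finite \<Rightarrow> (real^'p \<Rightarrow> real) \<Rightarrow> real^'p \<Rightarrow> real" where
  "partial j f \<equiv> \<lambda>u. frechet_derivative f (at u) (axis j 1)"

lemma iterated_partial_snoc: "iterated_partial (js @ [j]) f = iterated_partial js (partial j f)"
  by (induction js) auto

lemma smooth_on_iterated_partial: "smooth_on U f \<Longrightarrow> smooth_on U (iterated_partial js f)"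
  by (induction js) (auto intro: smooth_on_derivative)

lemma iterated_partial_cong:
  assumes "open U" "\<And>u. u \<in> U \<Longrightarrow> f u = g u"
  shows "u \<in> U \<Longrightarrow> iterated_partial js f u = iterated_partial js g u"
proof (induction js arbitrary: u)
  case (Cons j js)
  have "\<forall>\<^sub>F y in nhds u. iterated_partial js f y = iterated_partial js g y"
    using eventually_nhds_openI[OF assms(1) Cons.prems Cons.IH] .
  from frechet_derivative_cong[OF this] show ?case by simp
qed (use assms in auto)

lemma iterated_partial_sum:
  assumes U: "open U" and f: "\<And>i. i \<in> A \<Longrightarrow> smooth_on U (f i)"
  shows "u \<in> U \<Longrightarrow> iterated_partial js (\<lambda>u. \<Sum>i\<in>A. c i * f i u) u = (\<Sum>i\<in>A. c i * iterated_partial js (f i) u)"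
proof (induction js arbitrary: u)
  case (Cons j js)
  have ev: "\<forall>\<^sub>F y in nhds u. iterated_partial js (\<lambda>u. \<Sum>i\<in>A. c i * f i u) y = (\<Sum>i\<in>A. c i * iterated_partial js (f i) y)"
    using eventually_nhds_openI[OF U Cons.prems Cons.IH] .
  have "frechet_derivative (\<lambda>y. \<Sum>i\<in>A. c i * iterated_partial js (f i) y) (at u) v =
      (\<Sum>i\<in>A. c i * frechet_derivative (iterated_partial js (f i)) (at u) v)" for v
    by (rule frechet_derivative_eqI[OF has_derivative_sum[OF has_derivative_mult_right[OF
            smooth_on_has_derivative[OF smooth_on_iterated_partial[OF f] Cons.prems]]]])
  then show ?case
    by (simp only: iterated_partial.simps frechet_derivative_cong[OF ev])
qed simp

lemma iterated_partial_add:
  assumes "open U" "smooth_on U f" "smooth_on U g" "u \<in> U"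
  shows "iterated_partial js (\<lambda>u. f u + g u) u = iterated_partial js f u + iterated_partial js g u"
  using iterated_partial_sum[OF assms(1), of "{True, False}" "\<lambda>b. if b then f else g" u js "\<lambda>_. 1"] assms by simp

lemma iterated_partial_const: "js \<noteq> [] \<Longrightarrow> iterated_partial js (\<lambda>u. c) u = 0"
proof (induction js arbitrary: c rule: rev_induct)
  case (snoc j js)
  then show ?case
    by (cases js) (auto simp: iterated_partial_snoc)
qed simp

text \<open>The support of the Taylor expansion at \<open>0\<close>, recorded by the degree and the weight of the monomials.\<close>

definition taylor_support :: "('p::finite \<Rightarrow> nat) \<Rightarrow> (nat \<Rightarrow> nat \<Rightarrow> bool) \<Rightarrow> (real^'p \<Rightarrow> real) \<Rightarrow> bool" where
  "taylor_support w S f \<longleftrightarrow> (\<exists>U. open U \<and> 0 \<in> U \<and> smooth_on U f) \<and>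
     (\<forall>js. iterated_partial js f 0 \<noteq> 0 \<longrightarrow> S (length js) (\<Sum>j\<leftarrow>js. w j))"

lemma taylor_support_mono:
  "taylor_support w S f \<Longrightarrow> (\<And>l v. S l v \<Longrightarrow> T l v) \<Longrightarrow> taylor_support w T f"
  by (auto simp: taylor_support_def)

lemma taylor_support_cong:
  assumes "taylor_support w S f" "open U" "0 \<in> U" "\<And>u. u \<in> U \<Longrightarrow> f u = g u"
  shows "taylor_support w S g"
proof -
  obtain V where "open V" "0 \<in> V" "smooth_on V f" using assms(1) by (auto simp: taylor_support_def)
  then have "smooth_on (V \<inter> U) g"
    using assms smooth_on_cong[OF smooth_on_subset, of V f "V \<inter> U" g] by auto
  then have "\<exists>U. open U \<and> 0 \<in> U \<and> smooth_on U g"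
    using assms \<open>open V\<close> \<open>0 \<in> V\<close> by (intro exI[of _ "V \<inter> U"]) auto
  then show ?thesis
    using assms(1) iterated_partial_cong[OF assms(2,4,3)] by (auto simp: taylor_support_def)
qed

lemma taylor_support_smooth: "open U \<Longrightarrow> 0 \<in> U \<Longrightarrow> smooth_on U f \<Longrightarrow> taylor_support w (\<lambda>l v. True) f"
  by (auto simp: taylor_support_def)

lemma taylor_support_common_domain:
  assumes "finite A" "\<And>i. i \<in> A \<Longrightarrow> taylor_support w (S i) (f i)"
  shows "\<exists>U. open U \<and> 0 \<in> U \<and> (\<forall>i\<in>A. smooth_on U (f i))"
proof -
  have "\<forall>i\<in>A. \<exists>U. open U \<and> 0 \<in> U \<and> smooth_on U (f i)"
    using assms by (auto simp: taylor_support_def)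
  then obtain V where "\<forall>i\<in>A. open (V i) \<and> 0 \<in> V i \<and> smooth_on (V i) (f i)"
    by metis
  then show ?thesis
    using assms(1) by (intro exI[of _ "\<Inter>i\<in>A. V i"]) (auto intro: smooth_on_subset)
qed

lemma taylor_support_sum:
  assumes "finite A" "\<And>i. i \<in> A \<Longrightarrow> taylor_support w S (f i)"
  shows "taylor_support w S (\<lambda>u. \<Sum>i\<in>A. c i * f i u)"
proof -
  obtain U where U: "open U" "0 \<in> U" "\<And>i. i \<in> A \<Longrightarrow> smooth_on U (f i)"
    using taylor_support_common_domain[of A w "\<lambda>_. S" f] assms by auto
  have "smooth_on U (\<lambda>u. \<Sum>i\<in>A. c i * f i u)"
    by (intro smooth_on_sum smooth_on_mult smooth_on_const U)
  moreover have "S (length js) (\<Sum>j\<leftarrow>js. w j)"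
    if "iterated_partial js (\<lambda>u. \<Sum>i\<in>A. c i * f i u) 0 \<noteq> 0" for js
  proof -
    have "(\<Sum>i\<in>A. c i * iterated_partial js (f i) 0) \<noteq> 0"
      using that iterated_partial_sum[of U A f 0 js c] U by simp
    then obtain i where "i \<in> A" "c i * iterated_partial js (f i) 0 \<noteq> 0"
      by (meson sum.neutral)
    then show ?thesis using assms(2) by (auto simp: taylor_support_def)
  qed
  ultimately show ?thesis
    using U by (auto simp: taylor_support_def)
qed

lemma taylor_support_add:
  assumes "taylor_support w S f" "taylor_support w S g"
  shows "taylor_support w S (\<lambda>u. f u + g u)"
  using taylor_support_sum[of "{True, False}" w S "\<lambda>b. if b then f else g" "\<lambda>_. 1"] assms by simp

lemma taylor_support_diff:
  assumes "taylor_support w S f" "taylor_support w S g"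
  shows "taylor_support w S (\<lambda>u. f u - g u)"
  using taylor_support_sum[of "{True, False}" w S "\<lambda>b. if b then f else g" "\<lambda>b. if b then 1 else - 1"] assms by simp

lemma taylor_support_partial:
  assumes "taylor_support w S f"
  shows "taylor_support w (\<lambda>l v. S (Suc l) (v + w j)) (partial j f)"
proof -
  have "S (Suc (length js)) ((\<Sum>j\<leftarrow>js. w j) + w j)" if "iterated_partial js (partial j f) 0 \<noteq> 0" for js
    using assms that iterated_partial_snoc[of js j f]
    by (auto simp: taylor_support_def dest!: spec[of _ "js @ [j]"])
  then show ?thesis
    using assms by (auto simp: taylor_support_def intro: smooth_on_derivative)
qed

text \<open>Leibniz rule. The last index of the list is differentiated first; it falls on one of the
  two factors and shifts that factor's support, so the induction must vary both functions and both
  supports.\<close>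

lemma iterated_partial_mult:
  assumes U: "open U" "0 \<in> U"
  shows "smooth_on U f \<Longrightarrow> smooth_on U g \<Longrightarrow> taylor_support w S f \<Longrightarrow> taylor_support w T g \<Longrightarrow>
    iterated_partial js (\<lambda>u. f u * g u) 0 \<noteq> 0 \<Longrightarrow>
    \<exists>l v l' v'. S l v \<and> T l' v' \<and> length js = l + l' \<and> (\<Sum>j\<leftarrow>js. w j) = v + v'"
proof (induction js arbitrary: f g S T rule: rev_induct)
  case Nil
  have "S 0 0"
    using Nil by (auto simp: taylor_support_def dest: spec[of _ "[]"])
  moreover have "T 0 0"
    using Nil by (auto simp: taylor_support_def dest: spec[of _ "[]"])
  ultimately show ?case by auto
next
  case (snoc j js)
  have "partial j (\<lambda>u. f u * g u) u = f u * partial j g u + partial j f u * g u" if "u \<in> U" for u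
    by (rule frechet_derivative_eqI[OF has_derivative_mult[OF
            smooth_on_has_derivative[OF snoc.prems(1) that] smooth_on_has_derivative[OF snoc.prems(2) that]]])
  from iterated_partial_cong[OF U(1) this U(2)]
  have "iterated_partial js (partial j (\<lambda>u. f u * g u)) 0 =
      iterated_partial js (\<lambda>u. f u * partial j g u + partial j f u * g u) 0" .
  also have "\<dots> = iterated_partial js (\<lambda>u. f u * partial j g u) 0 + iterated_partial js (\<lambda>u. partial j f u * g u) 0"
    by (intro iterated_partial_add[OF U(1) _ _ U(2)] smooth_on_mult U smooth_on_derivative snoc.prems)
  finally have "iterated_partial js (\<lambda>u. f u * partial j g u) 0 \<noteq> 0 \<or> iterated_partial js (\<lambda>u. partial j f u * g u) 0 \<noteq> 0"
    using snoc.prems(5) by (auto simp: iterated_partial_snoc)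
  then show ?case
  proof
    assume "iterated_partial js (\<lambda>u. f u * partial j g u) 0 \<noteq> 0"
    from snoc.IH[OF snoc.prems(1) smooth_on_derivative[OF snoc.prems(2)] snoc.prems(3)
        taylor_support_partial[OF snoc.prems(4)] this]
    obtain l v l' v' where "S l v" "T (Suc l') (v' + w j)" "length js = l + l'" "(\<Sum>j\<leftarrow>js. w j) = v + v'"
      by blast
    then show ?case
      by (intro exI[of _ l] exI[of _ v] exI[of _ "Suc l'"] exI[of _ "v' + w j"]) auto
  next
    assume "iterated_partial js (\<lambda>u. partial j f u * g u) 0 \<noteq> 0"
    from snoc.IH[OF smooth_on_derivative[OF snoc.prems(1)] snoc.prems(2)
        taylor_support_partial[OF snoc.prems(3)] snoc.prems(4) this]
    obtain l v l' v' where "S (Suc l) (v + w j)" "T l' v'" "length js = l + l'" "(\<Sum>j\<leftarrow>js. w j) = v + v'"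
      by blast
    then show ?case
      by (intro exI[of _ "Suc l"] exI[of _ "v + w j"] exI[of _ l'] exI[of _ v']) auto
  qed
qed

lemma taylor_support_mult:
  assumes f: "taylor_support w S f" and g: "taylor_support w T g"
    and R: "\<And>l v l' v'. S l v \<Longrightarrow> T l' v' \<Longrightarrow> R (l + l') (v + v')"
  shows "taylor_support w R (\<lambda>u. f u * g u)"
proof -
  obtain U V where "open U" "0 \<in> U" "smooth_on U f" "open V" "0 \<in> V" "smooth_on V g"
    using f g by (auto simp: taylor_support_def)
  then have UV: "open (U \<inter> V)" "0 \<in> U \<inter> V" "smooth_on (U \<inter> V) f" "smooth_on (U \<inter> V) g"
    by (auto intro: smooth_on_subset)
  have "R (length js) (\<Sum>j\<leftarrow>js. w j)" if "iterated_partial js (\<lambda>u. f u * g u) 0 \<noteq> 0" for js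
    using iterated_partial_mult[OF UV f g that] R by metis
  moreover have "smooth_on (U \<inter> V) (\<lambda>u. f u * g u)"
    by (intro smooth_on_mult UV)
  ultimately show ?thesis
    using UV unfolding taylor_support_def by blast
qed

lemma taylor_support_const: "(c \<noteq> 0 \<Longrightarrow> S 0 0) \<Longrightarrow> taylor_support w S (\<lambda>u. c)"
proof -
  assume c: "c \<noteq> 0 \<Longrightarrow> S 0 0"
  have "S (length js) (\<Sum>j\<leftarrow>js. w j)" if "iterated_partial js (\<lambda>u. c) 0 \<noteq> 0" for js :: "'a list"
    using c that iterated_partial_const[of js c 0] by (cases "js = []") auto
  then show ?thesis
    by (auto simp: taylor_support_def intro: exI[of _ UNIV] smooth_on_const)
qed

lemma taylor_support_coordinate: "taylor_support w (\<lambda>l v. l = 1 \<and> v = w j) (\<lambda>u. u $ j)"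
proof -
  have "length js = 1 \<and> (\<Sum>j\<leftarrow>js. w j) = w j" if "iterated_partial js (\<lambda>u. u $ j) 0 \<noteq> 0" for js
  proof (cases js rule: rev_cases)
    case (snoc ks k)
    have "partial k (\<lambda>u. u $ j) = (\<lambda>u. axis k 1 $ j)"
      using frechet_derivative_eqI[OF bounded_linear_imp_has_derivative[OF bounded_linear_vec_nth]] by blast
    then have "iterated_partial ks (\<lambda>u. axis k 1 $ j :: real) 0 \<noteq> 0"
      using that snoc by (simp add: iterated_partial_snoc)
    then show ?thesis
      using snoc iterated_partial_const[of ks "axis k 1 $ j :: real" 0]
      by (cases "ks = []") (auto simp: axis_def split: if_splits)
  qed (use that in simp)
  moreover have "smooth_on UNIV (\<lambda>u. u $ j :: real)"
    by (intro smooth_on_bounded_linear bounded_linear_vec_nth) simp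
  ultimately show ?thesis
    unfolding taylor_support_def by blast
qed

text \<open>The factorials are nonzero, so Taylor coefficients may be replaced by derivatives. The
  comparison remains in \<open>int\<close> because the bound may be negative.\<close>

lemma vf_weight_ge_iff:
  "vf_weight_ge B s Z \<longleftrightarrow> (\<forall>i. taylor_support (\<lambda>j. wt (B j)) (\<lambda>l v. s + int (wt (B i)) \<le> int v) (\<lambda>u. Z u $ i))"
proof -
  have coeff: "taylor_coeff f js \<noteq> 0 \<longleftrightarrow> iterated_partial js f 0 \<noteq> 0" for f :: "real^'a \<Rightarrow> real" and js
    by (simp add: taylor_coeff_def)
  have weight: "(\<Sum>j\<leftarrow>js. int (wt (B j))) = int (\<Sum>j\<leftarrow>js. wt (B j))" for js
    by (induction js) auto
  show ?thesis
    unfolding vf_weight_ge_def fun_weight_ge_def taylor_support_def coeff weight by (auto simp: not_less)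
qed

section \<open>The Euler field\<close>

abbreviation euler :: "(real^'p \<Rightarrow> real) \<Rightarrow> real^'p \<Rightarrow> real" where
  "euler \<equiv> vf_apply (\<lambda>u. u)"

text \<open>The commutator of a partial derivative with the Euler field is that partial derivative
  itself; the Hessian terms match by symmetry.\<close>

lemma partial_euler:
  assumes U: "open U" and f: "smooth_on U f" and u: "u \<in> U"
  shows "partial j (euler f) u = euler (partial j f) u + partial j f u"
proof -
  have "partial j (euler f) u = partial j f u +
      (\<Sum>b\<in>Basis. (u \<bullet> b) * frechet_derivative (\<lambda>y. frechet_derivative f (at y) b) (at u) (axis j 1))"
    using frechet_derivative_along_field[OF U f smooth_on_ident[OF U] u] by simp
  also have "(\<Sum>b\<in>Basis. (u \<bullet> b) * frechet_derivative (\<lambda>y. frechet_derivative f (at y) b) (at u) (axis j 1)) =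
      (\<Sum>b\<in>Basis. (u \<bullet> b) *\<^sub>R frechet_derivative (partial j f) (at u) b)"
    using second_derivative_symmetric[OF U f u] by simp
  also have "\<dots> = euler (partial j f) u"
    unfolding vf_apply_def
    by (rule derivative_eq_sum_Basis[symmetric, OF smooth_on_differentiable[OF smooth_on_derivative[OF f] u]])
  finally show ?thesis by simp
qed

text \<open>Euler's identity for the homogeneous parts: moving each partial derivative past the
  Euler field costs one copy, and at 0 the Euler field vanishes.\<close>

lemma iterated_partial_euler:
  assumes U: "open U" "0 \<in> U"
  shows "smooth_on U f \<Longrightarrow> iterated_partial js (euler f) 0 = length js * iterated_partial js f 0"
proof (induction js arbitrary: f rule: rev_induct)
  case Nil
  then show ?case
    using linear_0[OF smooth_on_linear_derivative[OF Nil U(2)]] by (simp add: vf_apply_def)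
next
  case (snoc j js)
  have "iterated_partial js (partial j (euler f)) 0 = iterated_partial js (\<lambda>u. euler (partial j f) u + partial j f u) 0"
    using iterated_partial_cong[OF U(1) partial_euler[OF U(1) snoc.prems] U(2)] .
  also have "\<dots> = iterated_partial js (euler (partial j f)) 0 + iterated_partial js (partial j f) 0"
    by (intro iterated_partial_add[OF U(1) _ _ U(2)] smooth_on_vf_apply smooth_on_ident smooth_on_derivative snoc.prems U)
  finally show ?case
    using snoc.IH[OF smooth_on_derivative[OF snoc.prems]] by (simp add: iterated_partial_snoc algebra_simps)
qed

lemma sum_axis: "(\<Sum>j\<in>UNIV. v $ j *\<^sub>R axis j 1) = (v :: real^'p)"
  using basis_expansion[of v] by (simp add: scalar_mult_eq_scaleR)

text \<open>A frame with \<open>\<Sum>\<^sub>j u\<^sub>j Z\<^sub>j = \<Sum>\<^sub>j u\<^sub>j \<partial>\<^sub>j\<close> satisfies, for \<open>h\<^sub>k = Z\<^sub>k - \<partial>\<^sub>k\<close>, the identity of \<open>euler_recursion\<close>.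
  In degree \<open>m\<close> its left-hand side is \<open>(m + 1) h\<^sub>k\<close>, while the right-hand side involves the \<open>h\<^sub>j\<close> only in
  degrees less than \<open>m\<close>: this determines the Taylor expansion recursively.\<close>

locale euler_frame =
  fixes U :: "(real^'p) set" and Z :: "'p \<Rightarrow> real^'p \<Rightarrow> real^'p"
  assumes U: "open U" "0 \<in> U" and Z: "\<And>j. smooth_on U (Z j)"
    and radial: "\<And>u. u \<in> U \<Longrightarrow> (\<Sum>j\<in>UNIV. u $ j *\<^sub>R Z j u) = u"
begin

definition h :: "'p \<Rightarrow> real^'p \<Rightarrow> real^'p" where
  "h k u = Z k u - axis k 1"

lemma smooth_on_h: "smooth_on U (h k)"
  unfolding h_def[abs_def] by (intro smooth_on_diff U Z smooth_on_const)

lemma smooth_on_h_nth: "smooth_on U (\<lambda>u. h k u $ i)"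
  by (intro smooth_on_nth U smooth_on_h)

lemma radial_derivative:
  assumes u: "u \<in> U"
  shows "(\<Sum>j\<in>UNIV. v $ j *\<^sub>R Z j u) + (\<Sum>j\<in>UNIV. u $ j *\<^sub>R frechet_derivative (Z j) (at u) v) = v"
proof -
  have "\<forall>\<^sub>F y in nhds u. (\<Sum>j\<in>UNIV. y $ j *\<^sub>R Z j y) = y"
    using eventually_nhds_openI[OF U(1) u radial] .
  from frechet_derivative_cong[OF this]
  have "v = frechet_derivative (\<lambda>y. \<Sum>j\<in>UNIV. y $ j *\<^sub>R Z j y) (at u) v"
    by simp
  also have "\<dots> = (\<Sum>j\<in>UNIV. u $ j *\<^sub>R frechet_derivative (Z j) (at u) v + v $ j *\<^sub>R Z j u)"
    by (rule frechet_derivative_eqI[OF has_derivative_sum[OF has_derivative_scaleR[OF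
            bounded_linear_imp_has_derivative[OF bounded_linear_vec_nth] smooth_on_has_derivative[OF Z u]]]])
  finally show ?thesis by (simp add: sum.distrib add.commute)
qed

text \<open>At u = 0 only the first sum of the differentiated radial identity survives, which forces
  Z_k(0) to be the k-th coordinate direction. This starts the induction on the degree.\<close>

lemma h_zero: "h k 0 = 0"
proof -
  have "(\<Sum>j\<in>UNIV. axis k 1 $ j *\<^sub>R Z j 0) = axis k 1"
    using radial_derivative[OF U(2), of "axis k 1"] by simp
  moreover have "(\<Sum>j\<in>UNIV. axis k 1 $ j *\<^sub>R Z j 0) = (\<Sum>j\<in>UNIV. if j = k then Z j 0 else 0)"
    by (rule sum.cong) (auto simp: axis_def)
  ultimately show ?thesis by (simp add: h_def)
qed

lemma euler_recursion_vec:
  assumes u: "u \<in> U"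
  shows "frechet_derivative (Z k) (at u) u + h k u =
    (\<Sum>j\<in>UNIV. u $ j *\<^sub>R lie_bracket (Z j) (Z k) u) - (\<Sum>j\<in>UNIV. h k u $ j *\<^sub>R h j u)"
proof -
  have lin: "linear (frechet_derivative (Z k) (at u))"
    using smooth_on_linear_derivative[OF Z u] .
  have "(\<Sum>j\<in>UNIV. u $ j *\<^sub>R lie_bracket (Z j) (Z k) u) =
      frechet_derivative (Z k) (at u) (\<Sum>j\<in>UNIV. u $ j *\<^sub>R Z j u) -
      (\<Sum>j\<in>UNIV. u $ j *\<^sub>R frechet_derivative (Z j) (at u) (Z k u))"
    by (simp add: lie_bracket_def linear_sum[OF lin] linear_scale[OF lin] scaleR_diff_right sum_subtractf)
  \<comment> \<open>The radial identity enters twice: itself, to turn the combination of the Z_j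
    into the Euler direction u, and differentiated along v = Z_k(u), to remove the derivatives of
    the Z_j.\<close>
  also have "\<dots> = frechet_derivative (Z k) (at u) u - (Z k u - (\<Sum>j\<in>UNIV. Z k u $ j *\<^sub>R Z j u))"
    using radial_derivative[OF u, of "Z k u"] radial[OF u] by (simp add: algebra_simps)
  \<comment> \<open>Substituting coordinate direction plus h for the coefficients of Z_k, and then
    for Z_j where the coefficient is an h, leaves Z_k + h_k and a term quadratic in h; this Z_k
    cancels.\<close>
  also have "(\<Sum>j\<in>UNIV. Z k u $ j *\<^sub>R Z j u) =
      (\<Sum>j\<in>UNIV. axis k 1 $ j *\<^sub>R Z j u + (h k u $ j *\<^sub>R axis j 1 + h k u $ j *\<^sub>R h j u))"
    by (rule sum.cong) (auto simp: h_def algebra_simps)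
  also have "\<dots> = (\<Sum>j\<in>UNIV. axis k 1 $ j *\<^sub>R Z j u) + (h k u + (\<Sum>j\<in>UNIV. h k u $ j *\<^sub>R h j u))"
    by (simp add: sum.distrib sum_axis)
  also have "(\<Sum>j\<in>UNIV. axis k 1 $ j *\<^sub>R Z j u) = (\<Sum>j\<in>UNIV. if j = k then Z j u else 0)"
    by (rule sum.cong) (auto simp: axis_def)
  finally show ?thesis by (simp add: algebra_simps)
qed

lemma euler_recursion:
  assumes u: "u \<in> U"
  shows "euler (\<lambda>u. h k u $ i) u + h k u $ i =
    (\<Sum>j\<in>UNIV. u $ j * lie_bracket (Z j) (Z k) u $ i) - (\<Sum>j\<in>UNIV. h k u $ j * h j u $ i)"
proof -
  have "euler (\<lambda>u. h k u $ i) u = frechet_derivative (Z k) (at u) u $ i"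
    unfolding vf_apply_def h_def
    using frechet_derivative_eqI[OF bounded_linear.has_derivative[OF bounded_linear_vec_nth
          has_derivative_diff[OF smooth_on_has_derivative[OF Z u] has_derivative_const]]] by simp
  then show ?thesis
    using arg_cong[OF euler_recursion_vec[OF u], of "\<lambda>v. v $ i"] by simp
qed

end

text \<open>On degree d the operator \<open>euler f + f\<close> multiplies Taylor coefficients by d
  + 1, which is never 0, so a bound for \<open>g\<close> up to degree m + 1 is inherited by
  \<open>f\<close>.\<close>

lemma taylor_support_euler_step:
  fixes f :: "real^'p \<Rightarrow> real"
  assumes f: "taylor_support w (\<lambda>l v. 1 \<le> l \<and> (l \<le> m \<longrightarrow> P v)) f"
    and U: "open U" "0 \<in> U" "smooth_on U f"
    and eq: "\<And>u. u \<in> U \<Longrightarrow> euler f u + f u = g u"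
    and g: "taylor_support w (\<lambda>l v. l \<le> Suc m \<longrightarrow> P v) g"
  shows "taylor_support w (\<lambda>l v. 1 \<le> l \<and> (l \<le> Suc m \<longrightarrow> P v)) f"
proof -
  have "1 \<le> length js \<and> (length js \<le> Suc m \<longrightarrow> P (\<Sum>j\<leftarrow>js. w j))" if nz: "iterated_partial js f 0 \<noteq> 0" for js
  proof -
    have "iterated_partial js g 0 = iterated_partial js (\<lambda>u. euler f u + f u) 0"
      by (rule iterated_partial_cong[OF U(1) eq U(2), symmetric])
    also have "\<dots> = iterated_partial js (euler f) 0 + iterated_partial js f 0"
      by (intro iterated_partial_add[OF U(1) _ _ U(2)] smooth_on_vf_apply smooth_on_ident U)
    also have "\<dots> = (length js + 1) * iterated_partial js f 0"
      using iterated_partial_euler[OF U] by (simp add: algebra_simps)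
    finally have "iterated_partial js g 0 \<noteq> 0" using nz by simp
    then show ?thesis
      using f g nz by (auto simp: taylor_support_def)
  qed
  then show ?thesis
    using U by (auto simp: taylor_support_def)
qed

lemma taylor_support_all_degrees:
  assumes "\<And>m. taylor_support w (\<lambda>l v. 1 \<le> l \<and> (l \<le> m \<longrightarrow> P v)) f"
  shows "taylor_support w (\<lambda>l v. 1 \<le> l \<and> P v) f"
  using assms unfolding taylor_support_def by blast

text \<open>Base of the degree inductions: vanishing at 0 excludes degree 0, after which the bound
  on degrees at most 0 is vacuous.\<close>

lemma taylor_support_vanishing:
  assumes "open U" "0 \<in> U" "smooth_on U f" "f 0 = 0"
  shows "taylor_support w (\<lambda>l v. 1 \<le> l \<and> (l \<le> 0 \<longrightarrow> P v)) f"
proof -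
  have "1 \<le> length js \<and> (length js \<le> 0 \<longrightarrow> P (\<Sum>j\<leftarrow>js. w j))" if "iterated_partial js f 0 \<noteq> 0" for js
    using that assms(4) by (cases js) auto
  then show ?thesis
    using assms(1-3) by (auto simp: taylor_support_def)
qed

section \<open>Weight bounds for a radial frame with graded brackets up to weight r\<close>

locale graded_frame = euler_frame U Z for U :: "(real^'p) set" and Z +
  fixes w :: "'p \<Rightarrow> nat" and r :: nat and b :: "'p \<Rightarrow> 'p \<Rightarrow> 'p \<Rightarrow> real"
  assumes w_le: "\<And>j. w j \<le> r"
    and b_weight: "\<And>j k l. b j k l \<noteq> 0 \<Longrightarrow> w l = w j + w k"
    and bracket: "\<And>j k u. w j + w k \<le> r \<Longrightarrow> u \<in> U \<Longrightarrow> lie_bracket (Z j) (Z k) u = (\<Sum>l\<in>UNIV. b j k l *\<^sub>R Z l u)"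
begin

lemma smooth_on_bracket_nth: "smooth_on U (\<lambda>u. lie_bracket (Z j) (Z k) u $ i)"
  by (intro smooth_on_nth smooth_on_lie_bracket U Z)

text \<open>If w j + w k <= r, only frame fields Z_l with w l = w j + w k occur, and the bounds for
  h_l carry over; the constant part contributes only for l = i, where the bound is an equality.
  Otherwise w i <= r < w j + w k, so every monomial qualifies.\<close>

lemma bracket_support:
  assumes h: "\<And>l. taylor_support w (\<lambda>d v. 1 \<le> d \<and> (d \<le> m \<longrightarrow> w i \<le> v + w l)) (\<lambda>u. h l u $ i)"
  shows "taylor_support w (\<lambda>d v. d \<le> m \<longrightarrow> w i \<le> v + (w j + w k)) (\<lambda>u. lie_bracket (Z j) (Z k) u $ i)"
proof (cases "w j + w k \<le> r")
  case True
  \<comment> \<open>The sum runs over nonzero constants because the weight of l is known only for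
    these.\<close>
  have "taylor_support w (\<lambda>d v. d \<le> m \<longrightarrow> w i \<le> v + (w j + w k)) (\<lambda>u. \<Sum>l\<in>{l. b j k l \<noteq> 0}. b j k l * (h l u $ i + axis l 1 $ i))"
  proof (intro taylor_support_sum taylor_support_add)
    fix l assume l: "l \<in> {l. b j k l \<noteq> 0}"
    then show "taylor_support w (\<lambda>d v. d \<le> m \<longrightarrow> w i \<le> v + (w j + w k)) (\<lambda>u. h l u $ i)"
      using b_weight by (intro taylor_support_mono[OF h[of l]]) auto
    show "taylor_support w (\<lambda>d v. d \<le> m \<longrightarrow> w i \<le> v + (w j + w k)) (\<lambda>u. axis l 1 $ i)"
      using b_weight l by (intro taylor_support_const) (auto simp: axis_def split: if_splits)
  qed simp
  moreover have "(\<Sum>l\<in>{l. b j k l \<noteq> 0}. b j k l * (h l u $ i + axis l 1 $ i)) = lie_bracket (Z j) (Z k) u $ i"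
    if "u \<in> U" for u
    using bracket[OF True that] by (simp add: h_def) (rule sum.mono_neutral_left, auto)
  ultimately show ?thesis
    by (rule taylor_support_cong[OF _ U])
next
  case False
  then show ?thesis
    using w_le[of i] by (intro taylor_support_mono[OF taylor_support_smooth[OF U smooth_on_bracket_nth]]) auto
qed

text \<open>\<open>w i \<le> v + w k\<close> expresses weight at least w i - w k of the i-th
  component without subtraction in \<open>nat\<close>; in other words, the field h_k has weight at
  least -w k.\<close>

lemma h_support: "taylor_support w (\<lambda>d v. 1 \<le> d \<and> w i \<le> v + w k) (\<lambda>u. h k u $ i)"
proof (rule taylor_support_all_degrees)
  show "taylor_support w (\<lambda>d v. 1 \<le> d \<and> (d \<le> m \<longrightarrow> w i \<le> v + w k)) (\<lambda>u. h k u $ i)" for m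
  proof (induction m arbitrary: i k)
    case 0
    then show ?case
      by (rule taylor_support_vanishing[OF U smooth_on_h_nth]) (simp add: h_zero)
  next
    case (Suc m)
    show ?case
    proof (rule taylor_support_euler_step[OF Suc U smooth_on_h_nth euler_recursion])
      have "taylor_support w (\<lambda>d v. d \<le> Suc m \<longrightarrow> w i \<le> v + w k) (\<lambda>u. \<Sum>j\<in>UNIV. 1 * (u $ j * lie_bracket (Z j) (Z k) u $ i))"
        by (intro taylor_support_sum taylor_support_mult[OF taylor_support_coordinate bracket_support[OF Suc]]) auto
      \<comment> \<open>Both factors have degree at least 1, so in total degree m + 1 each has
        degree at most m and the induction hypothesis covers both; the intermediate weight w j
        cancels when the two bounds are added. In the first sum the factor u_j likewise lowers the
        degree left for the bracket to m.\<close>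
      moreover have "taylor_support w (\<lambda>d v. d \<le> Suc m \<longrightarrow> w i \<le> v + w k) (\<lambda>u. \<Sum>j\<in>UNIV. 1 * (h k u $ j * h j u $ i))"
        by (intro taylor_support_sum taylor_support_mult[OF Suc Suc]) force+
      ultimately show "taylor_support w (\<lambda>d v. d \<le> Suc m \<longrightarrow> w i \<le> v + w k)
          (\<lambda>u. (\<Sum>j\<in>UNIV. u $ j * lie_bracket (Z j) (Z k) u $ i) - (\<Sum>j\<in>UNIV. h k u $ j * h j u $ i))"
        by (intro taylor_support_diff) simp_all
    qed
  qed
qed

lemma frame_support: "taylor_support w (\<lambda>d v. w i \<le> v + w k) (\<lambda>u. Z k u $ i)"
proof -
  have "taylor_support w (\<lambda>d v. w i \<le> v + w k) (\<lambda>u. h k u $ i + axis k 1 $ i)"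
    by (intro taylor_support_add taylor_support_mono[OF h_support] taylor_support_const)
      (auto simp: axis_def split: if_splits)
  then show ?thesis by (simp add: h_def)
qed

end

section \<open>Comparison of two graded frames with the same structure constants\<close>

locale two_graded_frames = X: graded_frame U Z w r b + Y: graded_frame U Z' w r b
  for U :: "(real^'p) set" and Z Z' w r b
begin

definition diff :: "'p \<Rightarrow> real^'p \<Rightarrow> real^'p" where
  "diff k u = Z k u - Z' k u"

lemma diff_h: "diff k u = X.h k u - Y.h k u"
  by (simp add: diff_def X.h_def Y.h_def)

lemma smooth_on_diff_nth: "smooth_on U (\<lambda>u. diff k u $ i)"
  unfolding diff_def by (intro smooth_on_nth smooth_on_diff X.U X.Z Y.Z)

text \<open>The difference of the quadratic terms is telescoped so that each summand contains
  exactly one factor \<open>diff\<close>; the other factor is an h with a known weight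
  bound.\<close>

lemma euler_recursion_diff:
  assumes u: "u \<in> U"
  shows "euler (\<lambda>u. diff k u $ i) u + diff k u $ i =
    (\<Sum>j\<in>UNIV. u $ j * (lie_bracket (Z j) (Z k) u $ i - lie_bracket (Z' j) (Z' k) u $ i)) -
    (\<Sum>j\<in>UNIV. diff k u $ j * X.h j u $ i + Y.h k u $ j * diff j u $ i)"
proof -
  have "euler (\<lambda>u. diff k u $ i) u = euler (\<lambda>u. X.h k u $ i) u - euler (\<lambda>u. Y.h k u $ i) u"
    unfolding diff_h vector_minus_component
    by (intro vf_apply_diff smooth_on_differentiable[OF _ u] X.smooth_on_h_nth Y.smooth_on_h_nth)
  then have "euler (\<lambda>u. diff k u $ i) u + diff k u $ i =
      (euler (\<lambda>u. X.h k u $ i) u + X.h k u $ i) - (euler (\<lambda>u. Y.h k u $ i) u + Y.h k u $ i)"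
    by (simp add: diff_h)
  then show ?thesis
    unfolding X.euler_recursion[OF u] Y.euler_recursion[OF u]
    by (simp add: diff_h algebra_simps flip: sum_subtractf sum.distrib)
qed

text \<open>With equal constants \<open>b\<close> the coordinate directions cancel, so the bracket
  difference combines only \<open>diff\<close> fields and inherits their better bound. Beyond weight
  r the extra 1 comes from the strict inequality r < w j + w k.\<close>

lemma bracket_diff_support:
  assumes "\<And>l. taylor_support w (\<lambda>d v. 1 \<le> d \<and> (d \<le> m \<longrightarrow> w i + 1 \<le> v + w l)) (\<lambda>u. diff l u $ i)"
  shows "taylor_support w (\<lambda>d v. d \<le> m \<longrightarrow> w i + 1 \<le> v + (w j + w k))
    (\<lambda>u. lie_bracket (Z j) (Z k) u $ i - lie_bracket (Z' j) (Z' k) u $ i)"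
proof (cases "w j + w k \<le> r")
  case True
  have "taylor_support w (\<lambda>d v. d \<le> m \<longrightarrow> w i + 1 \<le> v + (w j + w k)) (\<lambda>u. \<Sum>l\<in>{l. b j k l \<noteq> 0}. b j k l * diff l u $ i)"
  proof (intro taylor_support_sum)
    fix l assume l: "l \<in> {l. b j k l \<noteq> 0}"
    then show "taylor_support w (\<lambda>d v. d \<le> m \<longrightarrow> w i + 1 \<le> v + (w j + w k)) (\<lambda>u. diff l u $ i)"
      using X.b_weight by (intro taylor_support_mono[OF assms[of l]]) auto
  qed simp
  moreover have "(\<Sum>l\<in>{l. b j k l \<noteq> 0}. b j k l * diff l u $ i) =
      lie_bracket (Z j) (Z k) u $ i - lie_bracket (Z' j) (Z' k) u $ i" if "u \<in> U" for u
    using X.bracket[OF True that] Y.bracket[OF True that]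
    by (simp add: diff_def right_diff_distrib flip: sum_subtractf) (rule sum.mono_neutral_left, auto)
  ultimately show ?thesis
    by (rule taylor_support_cong[OF _ X.U])
next
  case False
  have "smooth_on U (\<lambda>u. lie_bracket (Z j) (Z k) u $ i - lie_bracket (Z' j) (Z' k) u $ i)"
    by (intro smooth_on_diff X.smooth_on_bracket_nth Y.smooth_on_bracket_nth X.U)
  then show ?thesis
    using X.w_le[of i] False by (intro taylor_support_mono[OF taylor_support_smooth[OF X.U]]) auto
qed

text \<open>The degree induction for \<open>h_support\<close> with every bound raised by 1. In the
  quadratic terms the extra 1 is supplied by the \<open>diff\<close> factor, while the full bound of
  the h factor suffices and its degree of at least 1 lowers the degree of
  \<open>diff\<close>.\<close>

lemma diff_support: "taylor_support w (\<lambda>d v. w i + 1 \<le> v + w k) (\<lambda>u. diff k u $ i)"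
proof -
  have "taylor_support w (\<lambda>d v. 1 \<le> d \<and> w i + 1 \<le> v + w k) (\<lambda>u. diff k u $ i)"
  proof (rule taylor_support_all_degrees)
    show "taylor_support w (\<lambda>d v. 1 \<le> d \<and> (d \<le> m \<longrightarrow> w i + 1 \<le> v + w k)) (\<lambda>u. diff k u $ i)" for m
    proof (induction m arbitrary: i k)
      case 0
      then show ?case
        by (rule taylor_support_vanishing[OF X.U smooth_on_diff_nth]) (simp add: diff_h X.h_zero Y.h_zero)
    next
      case (Suc m)
      show ?case
      proof (rule taylor_support_euler_step[OF Suc X.U smooth_on_diff_nth euler_recursion_diff])
        have "taylor_support w (\<lambda>d v. d \<le> Suc m \<longrightarrow> w i + 1 \<le> v + w k)
            (\<lambda>u. \<Sum>j\<in>UNIV. 1 * (u $ j * (lie_bracket (Z j) (Z k) u $ i - lie_bracket (Z' j) (Z' k) u $ i)))"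
          by (intro taylor_support_sum taylor_support_mult[OF taylor_support_coordinate bracket_diff_support[OF Suc]]) auto
        moreover have "taylor_support w (\<lambda>d v. d \<le> Suc m \<longrightarrow> w i + 1 \<le> v + w k)
            (\<lambda>u. \<Sum>j\<in>UNIV. 1 * (diff k u $ j * X.h j u $ i + Y.h k u $ j * diff j u $ i))"
          by (intro taylor_support_sum taylor_support_add taylor_support_mult[OF Suc X.h_support]
              taylor_support_mult[OF Y.h_support Suc]) force+
        ultimately show "taylor_support w (\<lambda>d v. d \<le> Suc m \<longrightarrow> w i + 1 \<le> v + w k)
            (\<lambda>u. (\<Sum>j\<in>UNIV. u $ j * (lie_bracket (Z j) (Z k) u $ i - lie_bracket (Z' j) (Z' k) u $ i)) -
              (\<Sum>j\<in>UNIV. diff k u $ j * X.h j u $ i + Y.h k u $ j * diff j u $ i))"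
          by (intro taylor_support_diff) simp_all
      qed
    qed
  qed
  then show ?thesis by (rule taylor_support_mono) auto
qed

end

section \<open>Push-forward of vector fields\<close>

locale smooth_inverse_pair =
  fixes U V :: "'a::euclidean_space set" and E \<theta> :: "'a \<Rightarrow> 'a"
  assumes U: "open U" and V: "open V" and E: "smooth_on U E" and \<theta>: "smooth_on V \<theta>"
    and E_in: "\<And>u. u \<in> U \<Longrightarrow> E u \<in> V" and \<theta>_in: "\<And>\<xi>. \<xi> \<in> V \<Longrightarrow> \<theta> \<xi> \<in> U"
    and \<theta>_E: "\<And>u. u \<in> U \<Longrightarrow> \<theta> (E u) = u" and E_\<theta>: "\<And>\<xi>. \<xi> \<in> V \<Longrightarrow> E (\<theta> \<xi>) = \<xi>"
begin

definition push :: "('a \<Rightarrow> 'a) \<Rightarrow> 'a \<Rightarrow> 'a" where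
  "push Z u = frechet_derivative \<theta> (at (E u)) (Z (E u))"

lemma smooth_on_push: "smooth_on V Z \<Longrightarrow> smooth_on U (push Z)"
  unfolding push_def[abs_def]
  by (intro smooth_on_derivative_apply[OF \<theta> U V E] smooth_on_compose[OF _ U V E]) (use E_in in auto)

lemma vf_apply_push:
  assumes f: "smooth_on U f" and u: "u \<in> U"
  shows "vf_apply (push Z) f u = vf_apply Z (\<lambda>\<xi>. f (\<theta> \<xi>)) (E u)"
proof -
  have "frechet_derivative (\<lambda>\<xi>. f (\<theta> \<xi>)) (at (E u)) (Z (E u)) =
      frechet_derivative f (at (\<theta> (E u))) (frechet_derivative \<theta> (at (E u)) (Z (E u)))"
    by (rule frechet_derivative_eqI[OF has_derivative_compose[OF
            smooth_on_has_derivative[OF \<theta> E_in[OF u]] smooth_on_has_derivative[OF f]]])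
      (simp add: \<theta>_E u)
  then show ?thesis by (simp add: vf_apply_def push_def \<theta>_E u)
qed

text \<open>As an operator, the push-forward is conjugation by composition with \<theta>, hence it
  respects ZW - WZ.\<close>

lemma lie_bracket_push:
  assumes Z: "smooth_on V Z" and W: "smooth_on V W" and u: "u \<in> U"
  shows "lie_bracket (push Z) (push W) u = push (lie_bracket Z W) u"
proof (rule vector_field_eqI[OF u U])
  fix f :: "'a \<Rightarrow> real" assume f: "smooth_on U f"
  have f\<theta>: "smooth_on V (\<lambda>\<xi>. f (\<theta> \<xi>))"
    by (rule smooth_on_compose[OF f V U \<theta>]) (use \<theta>_in in auto)
  have push2: "vf_apply (push P) (vf_apply (push Q) f) u = vf_apply P (vf_apply Q (\<lambda>\<xi>. f (\<theta> \<xi>))) (E u)"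
    if "smooth_on V P" "smooth_on V Q" for P Q
  proof -
    have "vf_apply (push P) (vf_apply (push Q) f) u = vf_apply P (\<lambda>\<xi>. vf_apply (push Q) f (\<theta> \<xi>)) (E u)"
      by (rule vf_apply_push[OF smooth_on_vf_apply[OF U smooth_on_push[OF that(2)] f] u])
    also have "\<dots> = vf_apply P (vf_apply Q (\<lambda>\<xi>. f (\<theta> \<xi>))) (E u)"
      by (rule vf_apply_cong[OF V E_in[OF u]]) (simp add: vf_apply_push[OF f \<theta>_in] E_\<theta>)
    finally show ?thesis .
  qed
  have "vf_apply (lie_bracket (push Z) (push W)) f u =
      vf_apply Z (vf_apply W (\<lambda>\<xi>. f (\<theta> \<xi>))) (E u) - vf_apply W (vf_apply Z (\<lambda>\<xi>. f (\<theta> \<xi>))) (E u)"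
    using push2 Z W by (simp add: vf_apply_lie_bracket[OF U f smooth_on_push smooth_on_push u])
  also have "\<dots> = vf_apply (lie_bracket Z W) (\<lambda>\<xi>. f (\<theta> \<xi>)) (E u)"
    using vf_apply_lie_bracket[OF V f\<theta> Z W E_in[OF u]] by simp
  also have "\<dots> = vf_apply (push (lie_bracket Z W)) f u"
    using vf_apply_push[OF f u] by simp
  finally show "vf_apply (\<lambda>_. lie_bracket (push Z) (push W) u) f u = vf_apply (\<lambda>_. push (lie_bracket Z W) u) f u"
    by (simp add: vf_apply_def)
qed

lemma push_sum:
  assumes u: "u \<in> U" and Z: "Z (E u) = (\<Sum>i\<in>A. c i *\<^sub>R W i (E u))"
  shows "push Z u = (\<Sum>i\<in>A. c i *\<^sub>R push (W i) u)"
  using smooth_on_linear_derivative[OF \<theta> E_in[OF u]]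
  by (simp add: push_def Z linear_sum linear_scale)

end

section \<open>Integral curves\<close>

abbreviation integral_curve :: "'a::real_normed_vector set \<Rightarrow> ('a \<Rightarrow> 'a) \<Rightarrow> (real \<Rightarrow> 'a) \<Rightarrow> bool" where
  "integral_curve \<Omega> Z \<phi> \<equiv>
    \<forall>t\<in>{0..1}. \<phi> t \<in> \<Omega> \<and> (\<phi> has_vector_derivative Z (\<phi> t)) (at t within {0..1})"

lemma smooth_on_lipschitz_compact:
  fixes Z :: "'a::euclidean_space \<Rightarrow> 'a"
  assumes "open \<Omega>" "smooth_on \<Omega> Z" "compact K" "K \<subseteq> \<Omega>"
  obtains L where "L-lipschitz_on K Z"
proof -
  \<comment> \<open>The real argument is a dummy time, as the Lipschitz lemma concerns
    time-dependent fields.\<close>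
  define f' where "f' = (\<lambda>(t::real, x). Blinfun (frechet_derivative Z (at x)))"
  have bl: "blinfun_apply (Blinfun (frechet_derivative Z (at x))) = frechet_derivative Z (at x)" if "x \<in> \<Omega>" for x
    using smooth_on_has_derivative[OF assms(2) that] has_derivative_bounded_linear bounded_linear_Blinfun_apply by blast
  have "local_lipschitz (UNIV :: real set) \<Omega> (\<lambda>t. Z)"
  proof (rule c1_implies_local_lipschitz)
    show "(Z has_derivative blinfun_apply (f' (t, x))) (at x)" if "x \<in> \<Omega>" for t x
      using smooth_on_has_derivative[OF assms(2) that] bl[OF that] by (simp add: f'_def)
    show "continuous_on (UNIV \<times> \<Omega>) f'"
    proof (rule continuous_on_blinfun_componentwise)
      fix i :: 'a
      have "continuous_on (UNIV \<times> \<Omega>) (\<lambda>z :: real \<times> 'a. frechet_derivative Z (at (snd z)) i)"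
        by (rule continuous_on_compose2[OF smooth_on_continuous[OF smooth_on_derivative[OF assms(2)]]])
          (auto intro: continuous_intros)
      then show "continuous_on (UNIV \<times> \<Omega>) (\<lambda>z. blinfun_apply (f' z) i)"
        by (rule continuous_on_eq) (auto simp: f'_def bl)
    qed
  qed (use assms in auto)
  then have "local_lipschitz {0 :: real} K (\<lambda>t. Z)"
    using local_lipschitz_subset assms(4) by blast
  from local_lipschitz_compact_implies_lipschitz[OF this assms(3)] that show ?thesis
    by auto
qed

text \<open>Gronwall: \<open>|\<phi> - \<psi>|\<^sup>2 exp (-2 L t)\<close> is nonincreasing.\<close>

lemma integral_curve_unique:
  fixes Z :: "'a::euclidean_space \<Rightarrow> 'a"
  assumes \<Omega>: "open \<Omega>" and Z: "smooth_on \<Omega> Z" and \<phi>: "integral_curve \<Omega> Z \<phi>" and \<psi>: "integral_curve \<Omega> Z \<psi>"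
    and init: "\<phi> 0 = \<psi> 0"
  shows "\<phi> 1 = \<psi> 1"
proof -
  have cont: "continuous_on {0..1} \<phi>" "continuous_on {0..1} \<psi>"
    using \<phi> \<psi> by (auto simp: continuous_on_eq_continuous_within intro: has_vector_derivative_continuous)
  then have "compact (\<phi> ` {0..1} \<union> \<psi> ` {0..1})"
    by (intro compact_Un compact_continuous_image) auto
  moreover have "\<phi> ` {0..1} \<union> \<psi> ` {0..1} \<subseteq> \<Omega>" using \<phi> \<psi> by auto
  ultimately obtain L where L: "L-lipschitz_on (\<phi> ` {0..1} \<union> \<psi> ` {0..1}) Z"
    using smooth_on_lipschitz_compact[OF \<Omega> Z] by blast
  define g where "g t = (\<phi> t - \<psi> t) \<bullet> (\<phi> t - \<psi> t) * exp (- 2 * L * t)" for t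
  have "g 1 \<le> g 0"
  proof (rule DERIV_nonpos_imp_decreasing_open[of 0 1 g])
    show "continuous_on {0..1} g"
      unfolding g_def[abs_def] by (intro continuous_intros cont)
    fix t :: real assume t: "0 < t" "t < 1"
    let ?d = "\<phi> t - \<psi> t" and ?e = "Z (\<phi> t) - Z (\<psi> t)"
    have D: "(\<phi> has_vector_derivative Z (\<phi> t)) (at t)" "(\<psi> has_vector_derivative Z (\<psi> t)) (at t)"
      using \<phi> \<psi> t by (metis at_within_Icc_at atLeastAtMost_iff less_eq_real_def)+
    have sq: "((\<lambda>t. (\<phi> t - \<psi> t) \<bullet> (\<phi> t - \<psi> t)) has_real_derivative 2 * (?d \<bullet> ?e)) (at t)"
      unfolding has_field_derivative_def
      by (rule has_derivative_eq_rhs[OF has_derivative_inner[OF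
              has_vector_derivative_diff[OF D, unfolded has_vector_derivative_def]
              has_vector_derivative_diff[OF D, unfolded has_vector_derivative_def]]])
        (auto simp: inner_commute algebra_simps)
    have "((\<lambda>t. exp (- 2 * L * t)) has_real_derivative exp (- 2 * L * t) * (- 2 * L)) (at t)"
      by (auto intro!: derivative_eq_intros)
    from DERIV_mult[OF sq this]
    have "(g has_real_derivative exp (- 2 * L * t) * (2 * (?d \<bullet> ?e - L * (?d \<bullet> ?d)))) (at t)"
      unfolding g_def[abs_def] by (rule DERIV_cong) (simp only: algebra_simps)
    moreover
    have "norm ?e \<le> L * norm ?d"
      using lipschitz_onD[OF L, of "\<phi> t" "\<psi> t"] t by (simp add: dist_norm)
    then have "?d \<bullet> ?e \<le> L * (?d \<bullet> ?d)"
      using order.trans[OF norm_cauchy_schwarz[of ?d ?e] mult_left_mono[of "norm ?e" "L * norm ?d" "norm ?d"]]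
      by (simp add: dot_square_norm power2_eq_square mult.left_commute)
    then have "exp (- 2 * L * t) * (2 * (?d \<bullet> ?e - L * (?d \<bullet> ?d))) \<le> 0"
      by (intro mult_nonneg_nonpos) auto
    ultimately show "\<exists>y. (g has_real_derivative y) (at t) \<and> y \<le> 0"
      by blast
  qed simp
  then have "(\<phi> 1 - \<psi> 1) \<bullet> (\<phi> 1 - \<psi> 1) * exp (- 2 * L) \<le> 0"
    using init by (simp add: g_def)
  then have "(\<phi> 1 - \<psi> 1) \<bullet> (\<phi> 1 - \<psi> 1) \<le> 0"
    by (simp add: mult_le_0_iff)
  then show ?thesis
    using inner_ge_zero[of "\<phi> 1 - \<psi> 1"] by (metis antisym inner_eq_zero_iff eq_iff_diff_eq_0)
qed

text \<open>\<open>is_exp\<close> only asserts that some integral curve exists; this makes the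
  exponential a partial function.\<close>

lemma is_exp_unique:
  fixes Z :: "'a::euclidean_space \<Rightarrow> 'a"
  assumes "open \<Omega>" "smooth_on \<Omega> Z" "is_exp \<Omega> Z \<eta> \<xi>" "is_exp \<Omega> Z \<eta> \<xi>'"
  shows "\<xi> = \<xi>'"
  using assms(3,4) integral_curve_unique[OF assms(1,2)] unfolding is_exp_def by metis

text \<open>The curve from \<eta> to E(u) is t |-> E(t u), so its velocity at time 1 is both the
  derivative of E in direction u and the value of the field at E(u).\<close>

lemma exp_radial_derivative:
  fixes X :: "'p::finite \<Rightarrow> real^'p \<Rightarrow> real^'p"
  assumes \<Omega>: "open \<Omega>" and X: "\<And>j. smooth_on \<Omega> (X j)"
    and E: "\<And>v. v \<in> ball 0 e \<Longrightarrow> is_exp \<Omega> (\<lambda>x. \<Sum>j\<in>UNIV. v $ j *\<^sub>R X j x) \<eta> (E v)"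
    and u: "u \<in> ball 0 e" and dE: "E differentiable (at u)"
  shows "frechet_derivative E (at u) u = (\<Sum>j\<in>UNIV. u $ j *\<^sub>R X j (E u))"
proof -
  define Z where "Z v x = (\<Sum>j\<in>UNIV. v $ j *\<^sub>R X j x)" for v x
  have Z_scale: "Z (t *\<^sub>R v) x = t *\<^sub>R Z v x" for t v x
    by (simp add: Z_def scaleR_sum_right)
  have Z: "smooth_on \<Omega> (Z v)" for v
    unfolding Z_def[abs_def] by (intro smooth_on_sum smooth_on_scaleR smooth_on_const X \<Omega>)
  have expE: "is_exp \<Omega> (Z v) \<eta> (E v)" if "v \<in> ball 0 e" for v
    using E[OF that] by (simp add: Z_def[abs_def])
  from expE[OF u] obtain \<phi> where \<phi>: "\<phi> 0 = \<eta>" "\<phi> 1 = E u" "integral_curve \<Omega> (Z u) \<phi>"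
    unfolding is_exp_def by blast
  have \<phi>_eq: "E (t *\<^sub>R u) = \<phi> t" if t: "t \<in> {0..1}" for t
  proof -
    have "norm (t *\<^sub>R u) \<le> norm u"
      using t by (auto intro: mult_left_le_one_le)
    then have "t *\<^sub>R u \<in> ball 0 e" using u by (simp add: dist_norm)
    \<comment> \<open>Slowing the curve down by the factor t gives an integral curve of t times the
      field, which is the field belonging to t u.\<close>
    moreover have "is_exp \<Omega> (Z (t *\<^sub>R u)) \<eta> (\<phi> t)"
      unfolding is_exp_def
    proof (intro exI[of _ "\<lambda>s. \<phi> (t * s)"] conjI ballI)
      fix s :: real assume s: "s \<in> {0..1}"
      have ts: "t * s \<in> {0..1}" using s t by (auto intro: mult_le_one)
      then show "\<phi> (t * s) \<in> \<Omega>" using \<phi>(3) by blast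
      have "(\<phi> has_vector_derivative Z u (\<phi> (t * s))) (at (t * s) within (\<lambda>s. t * s) ` {0..1})"
      proof (rule has_vector_derivative_within_subset)
        show "(\<phi> has_vector_derivative Z u (\<phi> (t * s))) (at (t * s) within {0..1})"
          using \<phi>(3) ts by blast
        show "(\<lambda>s. t * s) ` {0..1} \<subseteq> {0..1}" using t by (auto intro: mult_le_one)
      qed
      moreover have "((\<lambda>s. t * s) has_vector_derivative t) (at s within {0..1})"
        by (auto intro!: derivative_eq_intros simp: has_real_derivative_iff_has_vector_derivative[symmetric])
      ultimately show "((\<lambda>s. \<phi> (t * s)) has_vector_derivative Z (t *\<^sub>R u) (\<phi> (t * s))) (at s within {0..1})"
        using vector_diff_chain_within by (fastforce simp: o_def Z_scale)
    qed (use \<phi> in auto)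
    ultimately show ?thesis
      using is_exp_unique[OF \<Omega> Z expE] by blast
  qed
  \<comment> \<open>The curve is controlled on [0,1] alone, so the two velocities at the endpoint 1
    are compared as one-sided derivatives.\<close>
  have "(\<phi> has_vector_derivative Z u (E u)) (at 1 within {0..1})"
    using bspec[OF \<phi>(3), of 1] \<phi>(2) by simp
  then have "((\<lambda>t. E (t *\<^sub>R u)) has_vector_derivative Z u (E u)) (at 1 within {0..1})"
    by (rule has_vector_derivative_transform[rotated 2]) (auto simp: \<phi>_eq)
  moreover have "((\<lambda>t. E (t *\<^sub>R u)) has_vector_derivative frechet_derivative E (at u) u) (at 1 within {0..1})"
  proof -
    have "((\<lambda>t. t *\<^sub>R u) has_derivative (\<lambda>t. t *\<^sub>R u)) (at 1 within {0..1})"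
      by (auto intro!: derivative_eq_intros)
    moreover have F: "(E has_derivative frechet_derivative E (at u)) (at (1 *\<^sub>R u))"
      using dE by (simp flip: frechet_derivative_works)
    ultimately have "((\<lambda>t. E (t *\<^sub>R u)) has_derivative (\<lambda>t. frechet_derivative E (at u) (t *\<^sub>R u))) (at 1 within {0..1})"
      by (rule has_derivative_compose)
    then show ?thesis
      unfolding has_vector_derivative_def linear_scale[OF has_derivative_linear[OF F]] .
  qed
  ultimately show ?thesis
    using vector_derivative_unique_within_closed_interval[of 0 1 1 "\<lambda>t. E (t *\<^sub>R u)"] by (simp add: Z_def)
qed

section \<open>Joint inversion of the coordinate maps\<close>

text \<open>Local injectivity does not glue in general, but here colliding points share the first
  coordinate x. The two balls around \<eta> and \<eta>' then meet at x, and with e' <= e the second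
  point is within e/3 + e'/3 + e'/3 <= e of \<eta>; so both points lie in one square where
  \<open>F\<close> is injective.\<close>

lemma inj_on_near_diagonal:
  fixes F :: "'a::metric_space \<times> 'a \<Rightarrow> 'a \<times> 'b"
  assumes F: "\<And>z. fst (F z) = fst z"
    and e: "\<And>\<eta>. \<eta> \<in> \<Omega> \<Longrightarrow> inj_on F (ball \<eta> (e \<eta>) \<times> ball \<eta> (e \<eta>))"
  shows "inj_on F (\<Union>\<eta>\<in>\<Omega>. ball \<eta> (e \<eta> / 3) \<times> ball \<eta> (e \<eta> / 3))"
proof -
  have *: "\<xi> = \<xi>'"
    if "F (x, \<xi>) = F (x, \<xi>')" "\<eta> \<in> \<Omega>" "x \<in> ball \<eta> (e \<eta> / 3)" "\<xi> \<in> ball \<eta> (e \<eta> / 3)"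
      "x \<in> ball \<eta>' (e \<eta>' / 3)" "\<xi>' \<in> ball \<eta>' (e \<eta>' / 3)" "e \<eta>' \<le> e \<eta>" for x \<xi> \<xi>' \<eta> \<eta>'
  proof -
    have "dist \<eta> \<xi>' \<le> dist \<eta> x + dist x \<eta>' + dist \<eta>' \<xi>'"
      by (meson dist_triangle order.trans add_right_mono)
    then have "\<xi>' \<in> ball \<eta> (e \<eta>)" using that by (auto simp: dist_commute)
    moreover have "0 < e \<eta>" using that(3) by (simp) (smt (verit) zero_le_dist)
    then have "x \<in> ball \<eta> (e \<eta>)" "\<xi> \<in> ball \<eta> (e \<eta>)" using that by auto
    ultimately show ?thesis using inj_onD[OF e[OF that(2)] that(1)] by auto
  qed
  show ?thesis
  proof (rule inj_onI, clarify)
    fix x \<xi> x' \<xi>' \<eta> \<eta>'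
    assume a: "F (x, \<xi>) = F (x', \<xi>')" "\<eta> \<in> \<Omega>" "x \<in> ball \<eta> (e \<eta> / 3)" "\<xi> \<in> ball \<eta> (e \<eta> / 3)"
      "\<eta>' \<in> \<Omega>" "x' \<in> ball \<eta>' (e \<eta>' / 3)" "\<xi>' \<in> ball \<eta>' (e \<eta>' / 3)"
    have "x = x'" using a(1) F[of "(x, \<xi>)"] F[of "(x', \<xi>')"] by simp
    then show "x = x' \<and> \<xi> = \<xi>'"
      using *[of x \<xi> \<xi>' \<eta> \<eta>'] *[of x \<xi>' \<xi> \<eta>' \<eta>] a by (metis linear)
  qed
qed

locale smooth_family =
  fixes D :: "((real^'p) \<times> (real^'p)) set" and T :: "(real^'p) \<times> (real^'p) \<Rightarrow> real^'p"
  assumes D: "open D" and T: "smooth_on D T"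
begin

text \<open>The partial Jacobian in the second variable, with the parameter frozen.\<close>

definition jac :: "(real^'p) \<times> (real^'p) \<Rightarrow> real^'p^'p" where
  "jac z = matrix (\<lambda>v. frechet_derivative T (at z) (0, v))"

text \<open>Carrying the parameter along turns the inversion of a family of maps into the inversion
  of one map between spaces of equal dimension.\<close>

definition F :: "(real^'p) \<times> (real^'p) \<Rightarrow> (real^'p) \<times> (real^'p)" where
  "F z = (fst z, T z)"

definition F' :: "(real^'p) \<times> (real^'p) \<Rightarrow> (real^'p) \<times> (real^'p) \<Rightarrow> (real^'p) \<times> (real^'p)" where
  "F' z v = (fst v, frechet_derivative T (at z) v)"

lemma linear_snd_derivative: "z \<in> D \<Longrightarrow> linear (\<lambda>v. frechet_derivative T (at z) (0, v))"
  using linear_compose[of "\<lambda>v. (0, v)" "frechet_derivative T (at z)"] smooth_on_linear_derivative[OF T]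
  by (simp add: o_def linear_iff)

lemma jac_works: "z \<in> D \<Longrightarrow> jac z *v v = frechet_derivative T (at z) (0, v)"
  unfolding jac_def by (rule matrix_works) (simp add: linear_matrix_vector_mul_eq linear_snd_derivative)

lemma smooth_on_jac: "smooth_on D (\<lambda>z. jac z $ i $ j)"
  unfolding jac_def matrix_def by (simp, intro smooth_on_nth D smooth_on_derivative T)

lemma has_derivative_F: "z \<in> D \<Longrightarrow> (F has_derivative F' z) (at z)"
  unfolding F_def[abs_def] F'_def[abs_def]
  by (intro has_derivative_Pair bounded_linear_imp_has_derivative bounded_linear_fst smooth_on_has_derivative[OF T])

lemma continuous_on_F: "continuous_on D F"
  using has_derivative_F has_derivative_continuous continuous_at_imp_continuous_on by blast

text \<open>The derivative is block triangular: a kernel vector has zero first part, and then the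
  invertible \<open>jac\<close> annihilates its second part.\<close>

lemma F'_inverse:
  assumes "z \<in> D" "det (jac z) \<noteq> 0"
  obtains g where "linear g" "g \<circ> F' z = id" "F' z \<circ> g = id"
proof -
  have lin: "linear (F' z)"
    using has_derivative_linear[OF has_derivative_F[OF assms(1)]] .
  have "v = 0" if "F' z v = 0" for v
  proof -
    have "fst v = 0" "frechet_derivative T (at z) v = 0"
      using that by (auto simp: F'_def zero_prod_def)
    then have "jac z *v snd v = 0"
      using jac_works[OF assms(1), of "snd v"] by (metis prod.collapse)
    then have "snd v = 0"
      using assms(2) by (metis invertible_det_nz invertible_left_inverse matrix_left_invertible_ker)
    with \<open>fst v = 0\<close> show ?thesis by (simp add: prod_eq_iff)
  qed
  then have "inj (F' z)" using lin linear_injective_0 by blast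
  from linear_injective_isomorphism[OF lin this] that show ?thesis
    by (auto simp: fun_eq_iff)
qed

lemma locally_injective:
  assumes "open D'" "D' \<subseteq> D" "z \<in> D'" "det (jac z) \<noteq> 0"
  shows "\<exists>U. open U \<and> z \<in> U \<and> U \<subseteq> D' \<and> inj_on F U"
proof -
  obtain g where g: "linear g" "g \<circ> F' z = id" using F'_inverse assms by blast
  define f' where "f' y = Blinfun (F' y)" for y
  have bl: "blinfun_apply (f' y) = F' y" if "y \<in> D'" for y
    unfolding f'_def using has_derivative_F assms(2) that
    by (intro bounded_linear_Blinfun_apply has_derivative_bounded_linear) blast
  have "blinfun_apply (Blinfun g) = g"
    using g(1) linear_conv_bounded_linear bounded_linear_Blinfun_apply by blast
  then have inv: "Blinfun g o\<^sub>L f' z = id_blinfun"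
    using bl[OF assms(3)] g(2) by (intro blinfun_eqI) (metis blinfun_apply_blinfun_compose blinfun_apply_id_blinfun comp_apply id_apply)
  have cont: "continuous_on D' f'"
  proof (rule continuous_on_blinfun_componentwise)
    fix i :: "(real^'p) \<times> (real^'p)"
    have "continuous_on D' (\<lambda>y. (fst i, frechet_derivative T (at y) i))"
      by (intro continuous_on_Pair continuous_on_const
          continuous_on_subset[OF smooth_on_continuous[OF smooth_on_derivative[OF T]] assms(2)])
    then show "continuous_on D' (\<lambda>y. blinfun_apply (f' y) i)"
      by (rule continuous_on_eq) (simp add: bl F'_def)
  qed
  have der: "(F has_derivative blinfun_apply (f' y)) (at y)" if "y \<in> D'" for y
    using has_derivative_F[of y] bl[OF that] that assms(2) by auto
  obtain U V g where U: "open U" "U \<subseteq> D'" "z \<in> U" and hom: "homeomorphism U V F g"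
    by (rule inverse_function_theorem[OF assms(1) der cont assms(3) inv]) blast+
  have "inj_on F U"
    by (rule inj_on_inverseI[of _ g]) (rule homeomorphism_apply1[OF hom])
  with U show ?thesis by blast
qed

text \<open>The derivative of the solution \<open>G\<close> of \<open>T (\<eta>, G (\<eta>, u)) = u\<close> solves a linear system with coefficients
  smooth in \<open>G\<close>, which bootstraps its regularity.\<close>

lemma smooth_on_implicit:
  assumes W: "open W" and G: "\<And>w. w \<in> W \<Longrightarrow> G differentiable (at w)"
    and sub: "\<And>w. w \<in> W \<Longrightarrow> (fst w, G w) \<in> D \<and> det (jac (fst w, G w)) \<noteq> 0"
    and eq: "\<And>w. w \<in> W \<Longrightarrow> T (fst w, G w) = snd w"
  shows "smooth_on W G"
  unfolding smooth_on_def
proof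
  fix k
  show "Ck_on k G W"
  proof (induction k)
    case 0
    then show ?case
      using G by (auto simp: continuous_at_imp_continuous_on differentiable_imp_continuous_within)
  next
    case (Suc k)
    let ?dG = "\<lambda>w. frechet_derivative G (at w)" and ?z = "\<lambda>w. (fst w, G w)"
    have dG: "(G has_derivative ?dG w) (at w)" if "w \<in> W" for w
      using G[OF that] by (simp flip: frechet_derivative_works)
    have z: "Ck_on k ?z W"
      by (intro Ck_on_Pair W Suc Ck_on_bounded_linear bounded_linear_fst)
    have comp: "Ck_on k (\<lambda>w. f (?z w)) W" if "smooth_on D f" for f :: "(real^'p) \<times> (real^'p) \<Rightarrow> 'c::real_normed_vector"
      using that sub by (intro Ck_on_compose[OF W D _ _ z]) (auto simp: smooth_on_def)
    have lin: "jac (?z w) *v ?dG w v = snd v - frechet_derivative T (at (?z w)) (fst v, 0)" if w: "w \<in> W" for w v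
    proof -
      have dT: "(T has_derivative frechet_derivative T (at (?z w))) (at (?z w))"
        using smooth_on_has_derivative[OF T] sub[OF w] by blast
      have "((\<lambda>w. T (?z w)) has_derivative (\<lambda>v. frechet_derivative T (at (?z w)) (fst v, ?dG w v))) (at w)"
        by (rule has_derivative_compose[OF has_derivative_Pair[OF
                bounded_linear_imp_has_derivative[OF bounded_linear_fst] dG[OF w]] dT])
      from frechet_derivative_eqI[OF this]
      have "frechet_derivative T (at (?z w)) (fst v, ?dG w v) = frechet_derivative (\<lambda>w. T (?z w)) (at w) v"
        by simp
      also have "frechet_derivative (\<lambda>w. T (?z w)) (at w) = frechet_derivative snd (at w)"
        by (rule frechet_derivative_cong, rule eventually_nhds_openI[OF W w]) (rule eq)
      also have "frechet_derivative snd (at w) v = snd v"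
        by (rule frechet_derivative_eqI[OF bounded_linear_imp_has_derivative[OF bounded_linear_snd]])
      finally have "frechet_derivative T (at (?z w)) ((0, ?dG w v) + (fst v, 0)) = snd v"
        by simp
      then show ?thesis
        using jac_works[of "?z w" "?dG w v"] sub[OF w] linear_add[OF has_derivative_linear[OF dT]]
        by (metis add_diff_cancel_right')
    qed
    show ?case
    proof (rule Ck_on_SucI[OF W dG])
      fix v
      have "Ck_on k (\<lambda>w. snd v - frechet_derivative T (at (?z w)) (fst v, 0)) W"
        by (rule comp, intro smooth_on_diff smooth_on_const smooth_on_derivative D T)
      then show "Ck_on k (\<lambda>w. ?dG w v) W"
        by (intro Ck_on_linear_solve[OF W comp[OF smooth_on_jac] _ _ lin]) (use sub in auto)
    qed
  qed
qed

text \<open>Local injectivity at the diagonal points is glued to injectivity on a whole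
  neighbourhood \<open>N\<close> of the diagonal; there the inverse exists globally and is
  differentiable, hence smooth in both variables.\<close>

lemma joint_inverse:
  assumes \<Omega>: "open \<Omega>" and diag: "\<forall>\<eta>\<in>\<Omega>. (\<eta>, \<eta>) \<in> D \<and> det (jac (\<eta>, \<eta>)) \<noteq> 0"
  obtains N G W where "open N" "N \<subseteq> D" "N \<subseteq> \<Omega> \<times> \<Omega>" "\<And>\<eta>. \<eta> \<in> \<Omega> \<Longrightarrow> (\<eta>, \<eta>) \<in> N"
    "open W" "smooth_on W G"
    "\<And>\<eta> \<xi>. (\<eta>, \<xi>) \<in> N \<Longrightarrow> (\<eta>, T (\<eta>, \<xi>)) \<in> W \<and> G (\<eta>, T (\<eta>, \<xi>)) = \<xi>"
    "\<And>\<eta> u. (\<eta>, u) \<in> W \<Longrightarrow> (\<eta>, G (\<eta>, u)) \<in> N \<and> T (\<eta>, G (\<eta>, u)) = u"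
proof -
  define D0 where "D0 = {z \<in> D. det (jac z) \<noteq> 0} \<inter> \<Omega> \<times> \<Omega>"
  have "open (D \<inter> (\<lambda>z. det (jac z)) -` (- {0}))"
    by (rule continuous_open_preimage[OF smooth_on_continuous[OF smooth_on_det[OF D smooth_on_jac]] D]) auto
  moreover have "D0 = (D \<inter> (\<lambda>z. det (jac z)) -` (- {0})) \<inter> \<Omega> \<times> \<Omega>"
    by (auto simp: D0_def)
  ultimately have D0: "open D0" "D0 \<subseteq> D"
    using \<Omega> by (auto intro: open_Times)
  have "\<exists>e>0. ball \<eta> e \<times> ball \<eta> e \<subseteq> D0 \<and> inj_on F (ball \<eta> e \<times> ball \<eta> e)" if \<eta>: "\<eta> \<in> \<Omega>" for \<eta>
  proof -
    have "(\<eta>, \<eta>) \<in> D0" "det (jac (\<eta>, \<eta>)) \<noteq> 0" using diag \<eta> by (auto simp: D0_def)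
    then obtain U where U: "open U" "(\<eta>, \<eta>) \<in> U" "U \<subseteq> D0" "inj_on F U"
      using locally_injective[OF D0] by blast
    obtain A B where AB: "open A" "open B" "(\<eta>, \<eta>) \<in> A \<times> B" "A \<times> B \<subseteq> U"
      by (rule open_prod_elim[OF U(1,2)])
    then obtain e where "e > 0" "ball \<eta> e \<subseteq> A \<inter> B"
      using openE[of "A \<inter> B" \<eta>] by auto
    then have "ball \<eta> e \<times> ball \<eta> e \<subseteq> U" using AB by blast
    then show ?thesis using \<open>e > 0\<close> U inj_on_subset by blast
  qed
  then obtain e where e: "\<And>\<eta>. \<eta> \<in> \<Omega> \<Longrightarrow> e \<eta> > 0" "\<And>\<eta>. \<eta> \<in> \<Omega> \<Longrightarrow> ball \<eta> (e \<eta>) \<times> ball \<eta> (e \<eta>) \<subseteq> D0"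
    "\<And>\<eta>. \<eta> \<in> \<Omega> \<Longrightarrow> inj_on F (ball \<eta> (e \<eta>) \<times> ball \<eta> (e \<eta>))"
    by metis
  define N where "N = (\<Union>\<eta>\<in>\<Omega>. ball \<eta> (e \<eta> / 3) \<times> ball \<eta> (e \<eta> / 3))"
  have inj: "inj_on F N"
    unfolding N_def by (rule inj_on_near_diagonal[OF _ e(3)]) (auto simp: F_def)
  have N: "open N" by (auto simp: N_def intro!: open_Times)
  have third: "ball \<eta> (e \<eta> / 3) \<subseteq> ball \<eta> (e \<eta>)" if "\<eta> \<in> \<Omega>" for \<eta>
    using e(1)[OF that] by (intro subset_ball) auto
  have ND0: "N \<subseteq> D0"
    unfolding N_def using third e(2) by (fastforce intro: subsetD)
  then have ND: "N \<subseteq> D" using D0(2) by blast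
  have diagN: "(\<eta>, \<eta>) \<in> N" if "\<eta> \<in> \<Omega>" for \<eta>
    using e(1) that by (auto simp: N_def intro!: bexI[of _ \<eta>])
  define W where "W = F ` N"
  \<comment> \<open>Source and target have equal dimension, so invariance of domain applies to the
    continuous injective map \<open>F\<close>.\<close>
  have W: "open W"
    unfolding W_def by (rule invariance_of_domain[OF continuous_on_subset[OF continuous_on_F ND] N inj])
  define H where "H = inv_into N F"
  have HF: "H (F z) = z" if "z \<in> N" for z
    using inv_into_f_f[OF inj that] by (simp add: H_def)
  have HW: "H w \<in> N" "F (H w) = w" if "w \<in> W" for w
    using that inv_into_into[of w F N] f_inv_into_f[of w F N] by (auto simp: H_def W_def)
  define G where "G w = snd (H w)" for w
  have Hw: "H w = (fst w, G w)" "T (fst w, G w) = snd w" if "w \<in> W" for w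
  proof -
    show "H w = (fst w, G w)"
      using HW(2)[OF that] by (auto simp: F_def G_def prod_eq_iff)
    then show "T (fst w, G w) = snd w"
      using arg_cong[OF HW(2)[OF that], of snd] by (simp add: F_def)
  qed
  \<comment> \<open>Mere differentiability is enough at this point;
    \<open>smooth_on_implicit\<close> raises it to smoothness.\<close>
  have "G differentiable (at w)" if w: "w \<in> W" for w
  proof -
    have z: "H w \<in> D" "det (jac (H w)) \<noteq> 0" using HW(1)[OF w] ND0 by (auto simp: D0_def)
    obtain g where "F' (H w) \<circ> g = id" using F'_inverse[OF z] by blast
    then have "(H has_derivative g) (at (F (H w)))"
      using HW(1)[OF w] ND by (intro has_derivative_inverse_on[OF N has_derivative_F HF, where g' = "\<lambda>_. g"]) auto
    then have "(H has_derivative g) (at w)" by (simp add: HW(2)[OF w])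
    then have "((\<lambda>w. snd (H w)) has_derivative (\<lambda>v. snd (g v))) (at w)"
      by (rule has_derivative_snd)
    then show ?thesis by (auto simp: G_def[abs_def] differentiable_def)
  qed
  then have G: "smooth_on W G"
    by (rule smooth_on_implicit[OF W]) (use HW Hw ND0 in \<open>force simp: D0_def\<close>)+
  show ?thesis
  proof (rule that[OF N ND _ diagN W G])
    show "N \<subseteq> \<Omega> \<times> \<Omega>" using ND0 by (auto simp: D0_def)
    show "(\<eta>, T (\<eta>, \<xi>)) \<in> W \<and> G (\<eta>, T (\<eta>, \<xi>)) = \<xi>" if "(\<eta>, \<xi>) \<in> N" for \<eta> \<xi>
      using HF[OF that] that by (force simp: F_def G_def W_def)
    show "(\<eta>, G (\<eta>, u)) \<in> N \<and> T (\<eta>, G (\<eta>, u)) = u" if "(\<eta>, u) \<in> W" for \<eta> u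
      using Hw[OF that] HW(1)[OF that] by simp
  qed
qed

end

section \<open>Canonical coordinates\<close>

lemma open_slice: "open W \<Longrightarrow> open {u. (\<eta>, u) \<in> W}"
  using open_vimage[of W "Pair \<eta>"] by (simp add: vimage_def continuous_on_Pair)

lemma smooth_on_slice:
  fixes f :: "'a::euclidean_space \<times> 'b::euclidean_space \<Rightarrow> 'c::real_normed_vector"
  assumes "open W" "smooth_on W f"
  shows "smooth_on {u. (\<eta>, u) \<in> W} (\<lambda>u. f (\<eta>, u))"
proof (rule smooth_on_compose[OF assms(2) open_slice[OF assms(1)] assms(1)])
  show "smooth_on {u. (\<eta>, u) \<in> W} (Pair \<eta>)"
    by (intro smooth_on_Pair smooth_on_const smooth_on_bounded_linear bounded_linear_ident open_slice assms)
qed auto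

lemma graded_frame_subset:
  assumes "graded_frame U Z w r b" "open S" "0 \<in> S" "S \<subseteq> U"
  shows "graded_frame S Z w r b"
proof -
  interpret graded_frame U Z w r b by fact
  show ?thesis
    by unfold_locales (use assms(2-) radial w_le b_weight bracket in \<open>auto intro: smooth_on_subset[OF Z]\<close>)
qed

text \<open>The support condition is imposed only where the coefficient is nonzero, since the weight
  of j is known only there.\<close>

lemma taylor_support_combination:
  fixes Z :: "'j::finite \<Rightarrow> real^'p \<Rightarrow> real^'p"
  assumes "open U" "0 \<in> U" "\<And>u. u \<in> U \<Longrightarrow> V u = (\<Sum>j\<in>UNIV. c j *\<^sub>R Z j u)"
    and "\<And>j. c j \<noteq> 0 \<Longrightarrow> taylor_support w S (\<lambda>u. Z j u $ i)"
  shows "taylor_support w S (\<lambda>u. V u $ i)"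
proof (rule taylor_support_cong[OF _ assms(1,2)])
  show "taylor_support w S (\<lambda>u. \<Sum>j\<in>{j. c j \<noteq> 0}. c j * Z j u $ i)"
    by (rule taylor_support_sum) (use assms(4) in auto)
  show "(\<Sum>j\<in>{j. c j \<noteq> 0}. c j * Z j u $ i) = V u $ i" if "u \<in> U" for u
    by (simp add: assms(3)[OF that]) (rule sum.mono_neutral_left, auto)
qed

text \<open>Replaces the inverses given for each \<eta> by the joint inverse \<open>G\<close>, and
  shows that near u = 0 it still is the exponential. Invertibility on the diagonal comes from the
  local diffeomorphisms of the hypothesis.\<close>

lemma canonical_coordinates_inverse:
  fixes X :: "nat \<Rightarrow> real^'p \<Rightarrow> real^'p"
  assumes \<Omega>: "open \<Omega>" and cc: "canonical_coordinates \<Omega> X B \<Theta>"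
  obtains N G W where "open N" "N \<subseteq> \<Omega> \<times> \<Omega>" "\<And>\<eta>. \<eta> \<in> \<Omega> \<Longrightarrow> (\<eta>, \<eta>) \<in> N" "smooth_on N (\<lambda>(\<eta>, \<xi>). \<Theta> \<eta> \<xi>)"
    "open W" "smooth_on W G"
    "\<And>\<eta> \<xi>. (\<eta>, \<xi>) \<in> N \<Longrightarrow> (\<eta>, \<Theta> \<eta> \<xi>) \<in> W \<and> G (\<eta>, \<Theta> \<eta> \<xi>) = \<xi>"
    "\<And>\<eta> u. (\<eta>, u) \<in> W \<Longrightarrow> (\<eta>, G (\<eta>, u)) \<in> N \<and> \<Theta> \<eta> (G (\<eta>, u)) = u"
    "\<And>\<eta>. \<eta> \<in> \<Omega> \<Longrightarrow> \<Theta> \<eta> \<eta> = 0"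
    "\<And>\<eta>. \<eta> \<in> \<Omega> \<Longrightarrow> \<exists>e>0. \<forall>u\<in>ball 0 e. (\<eta>, u) \<in> W \<and>
      is_exp \<Omega> (\<lambda>x. \<Sum>j\<in>UNIV. u $ j *\<^sub>R commutator X (B j) x) \<eta> (G (\<eta>, u))"
proof -
  let ?T = "\<lambda>(\<eta>, \<xi>). \<Theta> \<eta> \<xi>" and ?Z = "\<lambda>u x. \<Sum>j\<in>UNIV. u $ j *\<^sub>R commutator X (B j) x"
  obtain D where D: "open D" "\<And>\<eta>. \<eta> \<in> \<Omega> \<Longrightarrow> (\<eta>, \<eta>) \<in> D" "smooth_on D ?T"
    using cc unfolding canonical_coordinates_def by blast
  have loc: "\<exists>U V E. 0 \<in> U \<and> \<eta> \<in> V \<and> (\<forall>u\<in>U. is_exp \<Omega> (?Z u) \<eta> (E u)) \<and> diffeomorphism U V E (\<Theta> \<eta>)"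
    if "\<eta> \<in> \<Omega>" for \<eta>
    using cc that unfolding canonical_coordinates_def by blast
  interpret fam: smooth_family D ?T
    by unfold_locales (use D in auto)
  have E0: "E 0 = \<eta>" if "\<eta> \<in> \<Omega>" "is_exp \<Omega> (?Z 0) \<eta> (E 0)" for \<eta> and E :: "real^'p \<Rightarrow> real^'p"
  proof -
    have "is_exp \<Omega> (?Z 0) \<eta> \<eta>"
      unfolding is_exp_def using that(1) by (intro exI[of _ "\<lambda>_. \<eta>"]) auto
    with that(2) show ?thesis
      by (intro is_exp_unique[OF \<Omega>]) (auto simp: smooth_on_const)
  qed
  have \<Theta>_diag: "\<Theta> \<eta> \<eta> = 0" if \<eta>: "\<eta> \<in> \<Omega>" for \<eta>
  proof -
    obtain U V E where U: "0 \<in> U" "\<forall>u\<in>U. is_exp \<Omega> (?Z u) \<eta> (E u)" "diffeomorphism U V E (\<Theta> \<eta>)"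
      using loc[OF \<eta>] by blast
    then have "\<Theta> \<eta> (E 0) = 0"
      unfolding diffeomorphism_def homeomorphism_def by blast
    then show ?thesis using E0[OF \<eta>, of E] U by auto
  qed
  have det: "det (fam.jac (\<eta>, \<eta>)) \<noteq> 0" if \<eta>: "\<eta> \<in> \<Omega>" for \<eta>
  proof -
    obtain U V E where U: "0 \<in> U" "\<eta> \<in> V" "diffeomorphism U V E (\<Theta> \<eta>)"
      using loc[OF \<eta>] by blast
    then have UV: "open V" "smooth_on U E" "\<And>\<xi>. \<xi> \<in> V \<Longrightarrow> E (\<Theta> \<eta> \<xi>) = \<xi>"
      by (auto simp: diffeomorphism_def homeomorphism_def)
    have "((\<lambda>\<xi>. ?T (\<eta>, \<xi>)) has_derivative (\<lambda>v. frechet_derivative ?T (at (\<eta>, \<eta>)) (0, v))) (at \<eta>)"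
      by (rule has_derivative_compose[OF has_derivative_Pair[OF has_derivative_const has_derivative_ident]
            smooth_on_has_derivative[OF D(3) D(2)[OF \<eta>]]])
    then have d\<Theta>: "(\<Theta> \<eta> has_derivative (\<lambda>v. fam.jac (\<eta>, \<eta>) *v v)) (at \<eta>)"
      by (simp add: fam.jac_works[OF D(2)[OF \<eta>]])
    have dE: "(E has_derivative frechet_derivative E (at 0)) (at (\<Theta> \<eta> \<eta>))"
      using smooth_on_has_derivative[OF UV(2) U(1)] \<Theta>_diag[OF \<eta>] by simp
    \<comment> \<open>Differentiating E(\<Theta>(\<eta>, \<xi>)) = \<xi> at \<eta> gives a left
      inverse of the Jacobian, which for a square matrix forces a nonzero determinant.\<close>
    have left_inv: "frechet_derivative E (at 0) (fam.jac (\<eta>, \<eta>) *v v) = v" for v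
    proof -
      have "frechet_derivative (\<lambda>\<xi>. E (\<Theta> \<eta> \<xi>)) (at \<eta>) = frechet_derivative (\<lambda>\<xi>. \<xi>) (at \<eta>)"
        by (rule frechet_derivative_cong, rule eventually_nhds_openI[OF UV(1) U(2)]) (rule UV(3))
      then show ?thesis
        using frechet_derivative_eqI[OF has_derivative_compose[OF d\<Theta> dE], of v] by simp
    qed
    have "v = 0" if "fam.jac (\<eta>, \<eta>) *v v = 0" for v
      using left_inv[of v] that linear_0[OF has_derivative_linear[OF dE]] by simp
    then show ?thesis
      by (metis invertible_det_nz invertible_left_inverse matrix_left_invertible_ker)
  qed
  have diag: "\<forall>\<eta>\<in>\<Omega>. (\<eta>, \<eta>) \<in> D \<and> det (fam.jac (\<eta>, \<eta>)) \<noteq> 0"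
    using D(2) det by blast
  obtain N G W where N: "open N" "N \<subseteq> D" "N \<subseteq> \<Omega> \<times> \<Omega>" "\<And>\<eta>. \<eta> \<in> \<Omega> \<Longrightarrow> (\<eta>, \<eta>) \<in> N"
    and W: "open W" "smooth_on W G"
    and GT: "\<And>\<eta> \<xi>. (\<eta>, \<xi>) \<in> N \<Longrightarrow> (\<eta>, ?T (\<eta>, \<xi>)) \<in> W \<and> G (\<eta>, ?T (\<eta>, \<xi>)) = \<xi>"
    and TG: "\<And>\<eta> u. (\<eta>, u) \<in> W \<Longrightarrow> (\<eta>, G (\<eta>, u)) \<in> N \<and> ?T (\<eta>, G (\<eta>, u)) = u"
    by (rule fam.joint_inverse[OF \<Omega> diag]) (rule that)
  have "\<exists>e>0. \<forall>u\<in>ball 0 e. (\<eta>, u) \<in> W \<and> is_exp \<Omega> (?Z u) \<eta> (G (\<eta>, u))" if \<eta>: "\<eta> \<in> \<Omega>" for \<eta>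
  proof -
    obtain U V E where U: "0 \<in> U" "\<forall>u\<in>U. is_exp \<Omega> (?Z u) \<eta> (E u)" "diffeomorphism U V E (\<Theta> \<eta>)"
      using loc[OF \<eta>] by blast
    then have U': "open U" "continuous_on U E" "\<And>u. u \<in> U \<Longrightarrow> \<Theta> \<eta> (E u) = u"
      by (auto simp: diffeomorphism_def homeomorphism_def)
    \<comment> \<open>For u in this set (\<eta>, E u) lies in N, where \<open>G\<close> inverts
      \<Theta>; hence G(\<eta>, u) = E(u), and the exponential property passes from \<open>E\<close>
      to \<open>G\<close>.\<close>
    have "open (U \<inter> E -` {\<xi>. (\<eta>, \<xi>) \<in> N})"
      by (rule continuous_open_preimage[OF U'(2,1) open_slice[OF N(1)]])
    moreover have "0 \<in> U \<inter> E -` {\<xi>. (\<eta>, \<xi>) \<in> N}"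
      using U(1) E0[OF \<eta>, of E] U(2) N(4)[OF \<eta>] by auto
    ultimately obtain e where e: "e > 0" "ball 0 e \<subseteq> U \<inter> E -` {\<xi>. (\<eta>, \<xi>) \<in> N}"
      using openE by blast
    have "(\<eta>, u) \<in> W \<and> is_exp \<Omega> (?Z u) \<eta> (G (\<eta>, u))" if "u \<in> ball 0 e" for u
    proof -
      have u: "u \<in> U" "(\<eta>, E u) \<in> N" using that e by auto
      from GT[OF u(2)] U'(3)[OF u(1)] have "(\<eta>, u) \<in> W" "G (\<eta>, u) = E u" by auto
      then show ?thesis using U(2) u(1) by simp
    qed
    then show ?thesis using e(1) by blast
  qed
  then show ?thesis
    using that[of N W G] N W GT TG \<Theta>_diag smooth_on_subset[OF D(3) N(2)] by auto
qed

section \<open>The commutators in canonical coordinates, jointly in the centre and the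
  coordinates\<close>

locale canonical_chart =
  fixes \<Omega> :: "(real^'p) set" and X :: "nat \<Rightarrow> real^'p \<Rightarrow> real^'p" and n r :: nat
    and B :: "'p \<Rightarrow> nat list" and \<Theta> :: "real^'p \<Rightarrow> real^'p \<Rightarrow> real^'p"
    and N W :: "((real^'p) \<times> (real^'p)) set" and G :: "(real^'p) \<times> (real^'p) \<Rightarrow> real^'p"
    and c :: "nat list \<Rightarrow> 'p \<Rightarrow> real" and b :: "'p \<Rightarrow> 'p \<Rightarrow> 'p \<Rightarrow> real"
  assumes \<Omega>: "open \<Omega>" and X: "\<And>i. i \<le> n \<Longrightarrow> smooth_on \<Omega> (X i)"
    and B: "\<And>j. B j \<in> multiindices n" "\<And>j. wt (B j) \<le> r"
    and N: "open N" "N \<subseteq> \<Omega> \<times> \<Omega>" "\<And>\<eta>. \<eta> \<in> \<Omega> \<Longrightarrow> (\<eta>, \<eta>) \<in> N" and T: "smooth_on N (\<lambda>(\<eta>, \<xi>). \<Theta> \<eta> \<xi>)"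
    and W: "open W" and G: "smooth_on W G"
    and G_\<Theta>: "\<And>\<eta> \<xi>. (\<eta>, \<xi>) \<in> N \<Longrightarrow> (\<eta>, \<Theta> \<eta> \<xi>) \<in> W \<and> G (\<eta>, \<Theta> \<eta> \<xi>) = \<xi>"
    and \<Theta>_G: "\<And>\<eta> u. (\<eta>, u) \<in> W \<Longrightarrow> (\<eta>, G (\<eta>, u)) \<in> N \<and> \<Theta> \<eta> (G (\<eta>, u)) = u"
    and \<Theta>_diag: "\<And>\<eta>. \<eta> \<in> \<Omega> \<Longrightarrow> \<Theta> \<eta> \<eta> = 0"
    and exp: "\<And>\<eta>. \<eta> \<in> \<Omega> \<Longrightarrow> \<exists>e>0. \<forall>u\<in>ball 0 e. (\<eta>, u) \<in> W \<and>
      is_exp \<Omega> (\<lambda>x. \<Sum>j\<in>UNIV. u $ j *\<^sub>R commutator X (B j) x) \<eta> (G (\<eta>, u))"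
    and c_weight: "\<And>I j. c I j \<noteq> 0 \<Longrightarrow> wt (B j) = wt I"
    and commutator_expand: "\<And>S (Y :: nat \<Rightarrow> real^'p \<Rightarrow> real^'p) I u. open S \<Longrightarrow>
      (\<And>i. i \<le> n \<Longrightarrow> smooth_on S (Y i)) \<Longrightarrow> u \<in> S \<Longrightarrow> I \<in> multiindices n \<Longrightarrow> wt I \<le> r \<Longrightarrow>
      commutator Y I u = (\<Sum>j\<in>UNIV. c I j *\<^sub>R commutator Y (B j) u)"
    and b_weight: "\<And>j k l. b j k l \<noteq> 0 \<Longrightarrow> wt (B l) = wt (B j) + wt (B k)"
    and bracket_expand: "\<And>S (Y :: nat \<Rightarrow> real^'p \<Rightarrow> real^'p) j k u. open S \<Longrightarrow>
      (\<And>i. i \<le> n \<Longrightarrow> smooth_on S (Y i)) \<Longrightarrow> u \<in> S \<Longrightarrow> wt (B j) + wt (B k) \<le> r \<Longrightarrow>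
      lie_bracket (commutator Y (B j)) (commutator Y (B k)) u = (\<Sum>l\<in>UNIV. b j k l *\<^sub>R commutator Y (B l) u)"
begin

text \<open>X_[I] in the chart centred at \<eta>. For fixed \<eta> it is a push-forward; the formula
  through \<open>G\<close> exhibits the dependence on \<eta> as well.\<close>

definition coord :: "real^'p \<Rightarrow> nat list \<Rightarrow> real^'p \<Rightarrow> real^'p" where
  "coord \<eta> I u = frechet_derivative (\<Theta> \<eta>) (at (G (\<eta>, u))) (commutator X I (G (\<eta>, u)))"

abbreviation slice :: "real^'p \<Rightarrow> (real^'p) set" where
  "slice \<eta> \<equiv> {u. (\<eta>, u) \<in> W}"

lemma smooth_on_comm: "open S \<Longrightarrow> (\<And>i. i \<le> n \<Longrightarrow> smooth_on S (Y i)) \<Longrightarrow> I \<in> multiindices n \<Longrightarrow> smooth_on S (commutator Y I)"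
  for Y :: "nat \<Rightarrow> real^'p \<Rightarrow> real^'p"
  by (rule smooth_on_commutator) (auto simp: multiindices_def)

lemma smooth_inverse_pair: "smooth_inverse_pair (slice \<eta>) {\<xi>. (\<eta>, \<xi>) \<in> N} (\<lambda>u. G (\<eta>, u)) (\<Theta> \<eta>)"
  using smooth_on_slice[OF W G, of \<eta>] smooth_on_slice[OF N(1) T, of \<eta>] open_slice[OF W, of \<eta>] open_slice[OF N(1), of \<eta>]
    G_\<Theta> \<Theta>_G by unfold_locales auto

lemma push_eq_coord: "smooth_inverse_pair.push (\<lambda>u. G (\<eta>, u)) (\<Theta> \<eta>) (commutator X I) = coord \<eta> I"
  using smooth_inverse_pair.push_def[OF smooth_inverse_pair] by (auto simp: coord_def fun_eq_iff)

lemma smooth_on_slice_commutator: "I \<in> multiindices n \<Longrightarrow> smooth_on {\<xi>. (\<eta>, \<xi>) \<in> N} (commutator X I)"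
  by (rule smooth_on_subset[OF smooth_on_comm[OF \<Omega> X]]) (use N(2) in auto)

lemma smooth_on_coord_slice: "I \<in> multiindices n \<Longrightarrow> smooth_on (slice \<eta>) (coord \<eta> I)"
  using smooth_inverse_pair.smooth_on_push[OF smooth_inverse_pair smooth_on_slice_commutator] push_eq_coord by simp

text \<open>The derivative of \<open>\<Theta> \<eta>\<close> is the derivative of the joint map in
  directions (0, v), so \<open>coord\<close> is assembled from maps smooth in (\<eta>, u).\<close>

lemma smooth_on_coord:
  assumes I: "I \<in> multiindices n"
  shows "smooth_on W (\<lambda>(\<eta>, u). coord \<eta> I u)"
proof (rule smooth_on_cong[OF _ W])
  let ?T = "\<lambda>(\<eta>, \<xi>). \<Theta> \<eta> \<xi>"
  have "G ` W \<subseteq> \<Omega>" using \<Theta>_G N(2) by fastforce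
  have GX: "smooth_on W (\<lambda>w. commutator X I (G w))"
    by (rule smooth_on_compose[OF smooth_on_comm[OF \<Omega> X I] W \<Omega> G]) (use \<open>G ` W \<subseteq> \<Omega>\<close> in auto)
  then have "smooth_on W (\<lambda>w. (0 :: real^'p, commutator X I (G w)))"
    by (rule smooth_on_Pair[OF W smooth_on_const])
  moreover have "smooth_on W (\<lambda>w. (fst w, G w))"
    by (rule smooth_on_Pair[OF W smooth_on_bounded_linear[OF W bounded_linear_fst] G])
  moreover have "(\<lambda>w. (fst w, G w)) ` W \<subseteq> N" using \<Theta>_G by auto
  ultimately show "smooth_on W (\<lambda>w. frechet_derivative ?T (at (fst w, G w)) (0, commutator X I (G w)))"
    by (intro smooth_on_derivative_apply[OF T W N(1)])
  fix w assume w: "w \<in> W"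
  obtain \<eta> u where wu: "w = (\<eta>, u)" by (cases w)
  have "(\<eta>, G (\<eta>, u)) \<in> N" using \<Theta>_G w wu by blast
  from has_derivative_compose[OF has_derivative_Pair[OF has_derivative_const has_derivative_ident] smooth_on_has_derivative[OF T this]]
  have "(\<Theta> \<eta> has_derivative (\<lambda>v. frechet_derivative ?T (at (\<eta>, G (\<eta>, u))) (0, v))) (at (G (\<eta>, u)))"
    by simp
  from frechet_derivative_eqI[OF this]
  show "frechet_derivative ?T (at (fst w, G w)) (0, commutator X I (G w)) = (case w of (\<eta>, u) \<Rightarrow> coord \<eta> I u)"
    by (simp add: wu coord_def)
qed

lemma zero_in_slice: "\<eta> \<in> \<Omega> \<Longrightarrow> 0 \<in> slice \<eta>"
  using G_\<Theta>[OF N(3)] \<Theta>_diag by force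

lemma coord_expand:
  assumes "I \<in> multiindices n" "wt I \<le> r" "u \<in> slice \<eta>"
  shows "coord \<eta> I u = (\<Sum>j\<in>UNIV. c I j *\<^sub>R coord \<eta> (B j) u)"
proof -
  interpret p: smooth_inverse_pair "slice \<eta>" "{\<xi>. (\<eta>, \<xi>) \<in> N}" "\<lambda>u. G (\<eta>, u)" "\<Theta> \<eta>"
    by (rule smooth_inverse_pair)
  have "G (\<eta>, u) \<in> \<Omega>" using \<Theta>_G assms(3) N(2) by blast
  then have "commutator X I (G (\<eta>, u)) = (\<Sum>j\<in>UNIV. c I j *\<^sub>R commutator X (B j) (G (\<eta>, u)))"
    by (intro commutator_expand[OF \<Omega> X] assms)
  from p.push_sum[of u "commutator X I" "c I" "\<lambda>j. commutator X (B j)", OF assms(3) this] show ?thesis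
    by (simp add: push_eq_coord)
qed

text \<open>The radial identity comes from the exponential, the bracket relations from pushing
  forward those of \<open>X\<close> on \<Omega>.\<close>

lemma coord_frame:
  assumes \<eta>: "\<eta> \<in> \<Omega>"
  obtains U where "U \<subseteq> slice \<eta>" "graded_frame U (\<lambda>j. coord \<eta> (B j)) (\<lambda>j. wt (B j)) r b"
proof -
  interpret p: smooth_inverse_pair "slice \<eta>" "{\<xi>. (\<eta>, \<xi>) \<in> N}" "\<lambda>u. G (\<eta>, u)" "\<Theta> \<eta>"
    by (rule smooth_inverse_pair)
  obtain e where e: "e > 0" "\<And>u. u \<in> ball 0 e \<Longrightarrow> u \<in> slice \<eta>"
    "\<And>u. u \<in> ball 0 e \<Longrightarrow> is_exp \<Omega> (\<lambda>x. \<Sum>j\<in>UNIV. u $ j *\<^sub>R commutator X (B j) x) \<eta> (G (\<eta>, u))"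
    using exp[OF \<eta>] by auto
  have XB: "smooth_on \<Omega> (commutator X (B j))" for j
    by (rule smooth_on_comm[OF \<Omega> X B(1)])
  have "graded_frame (ball 0 e) (\<lambda>j. coord \<eta> (B j)) (\<lambda>j. wt (B j)) r b"
  proof
    show "open (ball (0 :: real^'p) e)" "(0 :: real^'p) \<in> ball 0 e" using e(1) by auto
    show "smooth_on (ball 0 e) (coord \<eta> (B j))" for j
      using smooth_on_subset[OF smooth_on_coord_slice[OF B(1)]] e(2) by blast
    show "(\<Sum>j\<in>UNIV. u $ j *\<^sub>R coord \<eta> (B j) u) = u" if u: "u \<in> ball 0 e" for u
    proof -
      \<comment> \<open>Since \<Theta> inverts G, u is the image under the derivative of \<Theta> of
        the radial derivative of G, which \<open>exp_radial_derivative\<close> evaluates.\<close>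
      have dE: "((\<lambda>u. G (\<eta>, u)) has_derivative frechet_derivative (\<lambda>u. G (\<eta>, u)) (at u)) (at u)"
        by (rule smooth_on_has_derivative[OF p.E e(2)[OF u]])
      have d\<theta>: "(\<Theta> \<eta> has_derivative frechet_derivative (\<Theta> \<eta>) (at (G (\<eta>, u)))) (at (G (\<eta>, u)))"
        by (rule smooth_on_has_derivative[OF p.\<theta> p.E_in[OF e(2)[OF u]]])
      have "frechet_derivative (\<lambda>u. \<Theta> \<eta> (G (\<eta>, u))) (at u) = frechet_derivative (\<lambda>u. u) (at u)"
        by (rule frechet_derivative_cong, rule eventually_nhds_openI[OF p.U e(2)[OF u]]) (rule p.\<theta>_E)
      then have "u = frechet_derivative (\<Theta> \<eta>) (at (G (\<eta>, u))) (frechet_derivative (\<lambda>u. G (\<eta>, u)) (at u) u)"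
        using frechet_derivative_eqI[OF has_derivative_compose[OF dE d\<theta>], of u] by simp
      also have "frechet_derivative (\<lambda>u. G (\<eta>, u)) (at u) u = (\<Sum>j\<in>UNIV. u $ j *\<^sub>R commutator X (B j) (G (\<eta>, u)))"
        by (rule exp_radial_derivative[OF \<Omega> XB e(3) u]) (use dE in \<open>auto simp: differentiable_def\<close>)
      finally show ?thesis
        using has_derivative_linear[OF d\<theta>] by (simp add: coord_def linear_sum linear_scale)
    qed
    show "wt (B j) \<le> r" for j by (rule B)
    show "wt (B l) = wt (B j) + wt (B k)" if "b j k l \<noteq> 0" for j k l using b_weight[OF that] .
    show "lie_bracket (coord \<eta> (B j)) (coord \<eta> (B k)) u = (\<Sum>l\<in>UNIV. b j k l *\<^sub>R coord \<eta> (B l) u)"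
      if jk: "wt (B j) + wt (B k) \<le> r" and u: "u \<in> ball 0 e" for j k u
    proof -
      have "G (\<eta>, u) \<in> \<Omega>" using \<Theta>_G e(2)[OF u] N(2) by blast
      then have "lie_bracket (commutator X (B j)) (commutator X (B k)) (G (\<eta>, u)) =
          (\<Sum>l\<in>UNIV. b j k l *\<^sub>R commutator X (B l) (G (\<eta>, u)))"
        by (intro bracket_expand[OF \<Omega> X] jk)
      from p.push_sum[of u "lie_bracket (commutator X (B j)) (commutator X (B k))" "b j k" "\<lambda>l. commutator X (B l)",
          OF e(2)[OF u] this] p.lie_bracket_push[OF smooth_on_slice_commutator[OF B(1)] smooth_on_slice_commutator[OF B(1)] e(2)[OF u]]
      show ?thesis by (simp add: push_eq_coord)
    qed
  qed
  then show ?thesis using that e(2) by blast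
qed

text \<open>Every smooth vector field has weight at least \<open>-r\<close>, so only \<open>|I| \<le> r\<close> matters.\<close>

lemma smooth_vf_weight:
  assumes "open U" "0 \<in> U" "smooth_on U Z" "s + int r \<le> 0"
  shows "vf_weight_ge B s Z"
  unfolding vf_weight_ge_iff
proof
  fix i
  have "taylor_support (\<lambda>j. wt (B j)) (\<lambda>l v. True) (\<lambda>u. Z u $ i)"
    by (rule taylor_support_smooth[OF assms(1,2) smooth_on_nth[OF assms(1,3)]])
  then show "taylor_support (\<lambda>j. wt (B j)) (\<lambda>l v. s + int (wt (B i)) \<le> int v) (\<lambda>u. Z u $ i)"
    by (rule taylor_support_mono) (use assms(4) B(2)[of i] in linarith)
qed

text \<open>Up to weight r the field is a constant combination of frame fields of the same weight
  |I|, so the frame bound applies; beyond r smoothness is enough.\<close>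

lemma coord_weight:
  assumes \<eta>: "\<eta> \<in> \<Omega>" and I: "I \<in> multiindices n"
  shows "vf_weight_ge B (- int (wt I)) (coord \<eta> I)"
proof (cases "wt I \<le> r")
  case True
  obtain U where U: "U \<subseteq> slice \<eta>" "graded_frame U (\<lambda>j. coord \<eta> (B j)) (\<lambda>j. wt (B j)) r b"
    using coord_frame[OF \<eta>] .
  then interpret f: graded_frame U "\<lambda>j. coord \<eta> (B j)" "\<lambda>j. wt (B j)" r b by simp
  show ?thesis
    unfolding vf_weight_ge_iff
  proof (rule allI, rule taylor_support_combination[OF f.U, where c = "c I" and Z = "\<lambda>j. coord \<eta> (B j)"])
    fix i
    show "coord \<eta> I u = (\<Sum>j\<in>UNIV. c I j *\<^sub>R coord \<eta> (B j) u)" if "u \<in> U" for u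
      using coord_expand[OF I True] U that by blast
    show "taylor_support (\<lambda>j. wt (B j)) (\<lambda>l v. - int (wt I) + int (wt (B i)) \<le> int v) (\<lambda>u. coord \<eta> (B j) u $ i)"
      if "c I j \<noteq> 0" for j
      using c_weight[OF that] by (intro taylor_support_mono[OF f.frame_support]) auto
  qed
next
  case False
  then show ?thesis
    by (intro smooth_vf_weight[OF open_slice[OF W] zero_in_slice[OF \<eta>] smooth_on_coord_slice[OF I]]) auto
qed

lemma in_coordinates_coord:
  assumes \<eta>: "\<eta> \<in> \<Omega>"
  shows "in_coordinates (\<Theta> \<eta>) \<eta> (commutator X I) (coord \<eta> I)"
  unfolding in_coordinates_def
proof (rule eventually_nhds_openI[OF open_slice[OF N(1)]])
  show "\<eta> \<in> {\<xi>. (\<eta>, \<xi>) \<in> N}" using N(3)[OF \<eta>] by simp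
  show "coord \<eta> I (\<Theta> \<eta> \<xi>) = frechet_derivative (\<Theta> \<eta>) (at \<xi>) (commutator X I \<xi>)" if "\<xi> \<in> {\<xi>. (\<eta>, \<xi>) \<in> N}" for \<xi>
    using G_\<Theta> that by (auto simp: coord_def)
qed

section \<open>Comparison with a second system satisfying the radial identity\<close>

context
  fixes Y :: "nat \<Rightarrow> real^'p \<Rightarrow> real^'p" and U :: "(real^'p) set"
  assumes U: "open U" "0 \<in> U" and Y: "\<And>i. i \<le> n \<Longrightarrow> smooth_on U (Y i)"
    and radial: "\<And>u. u \<in> U \<Longrightarrow> (\<Sum>j\<in>UNIV. u $ j *\<^sub>R commutator Y (B j) u) = u"
begin

text \<open>The constants \<open>b\<close> stem from Lie polynomial identities, so Y satisfies the
  bracket relations with the very same \<open>b\<close>.\<close>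

lemma comparison_frame: "graded_frame U (\<lambda>j. commutator Y (B j)) (\<lambda>j. wt (B j)) r b"
  by unfold_locales
    (use U radial B(2) b_weight bracket_expand[OF U(1) Y] in \<open>auto intro: smooth_on_comm[OF U(1) Y B(1)]\<close>)

lemma smooth_on_remainder:
  assumes I: "I \<in> multiindices n"
  shows "smooth_on (W \<inter> {w. snd w \<in> U}) (\<lambda>(\<eta>, u). coord \<eta> I u - commutator Y I u)"
proof -
  have "open (snd -` U :: ((real^'p) \<times> (real^'p)) set)"
    by (rule open_vimage[OF U(1)]) (auto intro: continuous_intros)
  then have WU: "open (W \<inter> {w. snd w \<in> U})"
    using W by (auto simp: vimage_def)
  have "smooth_on (W \<inter> {w. snd w \<in> U}) (\<lambda>w. commutator Y I (snd w))"
    by (rule smooth_on_compose[OF smooth_on_comm[OF U(1) Y I] WU U(1)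
          smooth_on_bounded_linear[OF WU bounded_linear_snd]]) auto
  from smooth_on_diff[OF WU smooth_on_subset[OF smooth_on_coord[OF I]] this] show ?thesis
    by (simp add: case_prod_unfold)
qed

text \<open>Both commutators expand with the same \<open>c\<close>, so up to weight r the remainder
  is a combination of the frame differences bounded by \<open>diff_support\<close>, on a common
  neighbourhood of 0.\<close>

lemma remainder_weight:
  assumes \<eta>: "\<eta> \<in> \<Omega>" and I: "I \<in> multiindices n"
  shows "vf_weight_ge B (1 - int (wt I)) (\<lambda>u. coord \<eta> I u - commutator Y I u)"
proof (cases "wt I \<le> r")
  case True
  obtain S where S: "S \<subseteq> slice \<eta>" "graded_frame S (\<lambda>j. coord \<eta> (B j)) (\<lambda>j. wt (B j)) r b"
    using coord_frame[OF \<eta>] .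
  then interpret S: graded_frame S "\<lambda>j. coord \<eta> (B j)" "\<lambda>j. wt (B j)" r b by simp
  have SU: "open (S \<inter> U)" "0 \<in> S \<inter> U" using S.U U by auto
  interpret f: two_graded_frames "S \<inter> U" "\<lambda>j. coord \<eta> (B j)" "\<lambda>j. commutator Y (B j)" "\<lambda>j. wt (B j)" r b
    by (intro two_graded_frames.intro graded_frame_subset[OF S(2) SU] graded_frame_subset[OF comparison_frame SU]) auto
  show ?thesis
    unfolding vf_weight_ge_iff
  proof (rule allI, rule taylor_support_combination[OF SU, where c = "c I" and Z = f.diff])
    fix i
    show "coord \<eta> I u - commutator Y I u = (\<Sum>j\<in>UNIV. c I j *\<^sub>R f.diff j u)" if u: "u \<in> S \<inter> U" for u
    proof -
      have "coord \<eta> I u = (\<Sum>j\<in>UNIV. c I j *\<^sub>R coord \<eta> (B j) u)"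
        using coord_expand[OF I True] S u by blast
      moreover have "commutator Y I u = (\<Sum>j\<in>UNIV. c I j *\<^sub>R commutator Y (B j) u)"
        using u by (intro commutator_expand[OF U(1) Y _ I True]) auto
      ultimately show ?thesis
        by (simp add: f.diff_def scaleR_diff_right sum_subtractf)
    qed
    show "taylor_support (\<lambda>j. wt (B j)) (\<lambda>l v. 1 - int (wt I) + int (wt (B i)) \<le> int v) (\<lambda>u. f.diff j u $ i)"
      if "c I j \<noteq> 0" for j
      using c_weight[OF that] by (intro taylor_support_mono[OF f.diff_support]) auto
  qed
next
  case False
  \<comment> \<open>Here |I| >= r + 1, so the required weight 1 - |I| is at most -r and holds for
    any smooth field.\<close>
  have "smooth_on (slice \<eta> \<inter> U) (\<lambda>u. coord \<eta> I u - commutator Y I u)"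
    by (intro smooth_on_diff smooth_on_subset[OF smooth_on_coord_slice[OF I]] smooth_on_subset[OF smooth_on_comm[OF U(1) Y I]]
        open_Int open_slice[OF W] U(1)) auto
  with False show ?thesis
    using zero_in_slice[OF \<eta>] U by (intro smooth_vf_weight[of "slice \<eta> \<inter> U"] open_Int open_slice[OF W]) auto
qed

text \<open>By the chain rule X_[I] acts on f composed with \<open>\<Theta> \<eta>\<close> as
  \<open>coord \<eta> I\<close> acts on f; linearity of the derivative of f then splits off
  Y_[I].\<close>

lemma lift_identity:
  assumes \<xi>: "(\<eta>, \<xi>) \<in> N" and f: "smooth_on V f" "\<Theta> \<eta> \<xi> \<in> V"
  shows "vf_apply (commutator X I) (\<lambda>\<xi>. f (\<Theta> \<eta> \<xi>)) \<xi> =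
    vf_apply (commutator Y I) f (\<Theta> \<eta> \<xi>) + vf_apply (\<lambda>u. coord \<eta> I u - commutator Y I u) f (\<Theta> \<eta> \<xi>)"
proof -
  have d\<Theta>: "(\<Theta> \<eta> has_derivative frechet_derivative (\<Theta> \<eta>) (at \<xi>)) (at \<xi>)"
    using smooth_on_has_derivative[OF smooth_inverse_pair.\<theta>[OF smooth_inverse_pair]] \<xi> by blast
  have df: "(f has_derivative frechet_derivative f (at (\<Theta> \<eta> \<xi>))) (at (\<Theta> \<eta> \<xi>))"
    by (rule smooth_on_has_derivative[OF f])
  have "vf_apply (commutator X I) (\<lambda>\<xi>. f (\<Theta> \<eta> \<xi>)) \<xi> =
      frechet_derivative f (at (\<Theta> \<eta> \<xi>)) (coord \<eta> I (\<Theta> \<eta> \<xi>))"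
    using frechet_derivative_eqI[OF has_derivative_compose[OF d\<Theta> df]] G_\<Theta>[OF \<xi>] by (simp add: vf_apply_def coord_def)
  then show ?thesis
    using linear_diff[OF has_derivative_linear[OF df]] by (simp add: vf_apply_def)
qed

lemma lifting:
  "\<exists>(R :: real^'p \<Rightarrow> nat list \<Rightarrow> real^'p \<Rightarrow> real^'p) W.
     open W \<and> (\<forall>\<eta>\<in>\<Omega>. (\<eta>, 0) \<in> W) \<and>
     (\<forall>I\<in>multiindices n. smooth_on W (\<lambda>(\<eta>, u). R \<eta> I u)) \<and>
     (\<forall>\<eta>\<in>\<Omega>. \<forall>I\<in>multiindices n. vf_weight_ge B (1 - int (wt I)) (R \<eta> I)) \<and>
     (\<forall>\<eta>\<in>\<Omega>. \<exists>N. open N \<and> \<eta> \<in> N \<and> N \<subseteq> \<Omega> \<and>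
        (\<forall>I\<in>multiindices n. \<forall>(f :: real^'p \<Rightarrow> real) V. open V \<and> 0 \<in> V \<and> smooth_on V f \<longrightarrow>
           (\<forall>\<xi>\<in>N. \<Theta> \<eta> \<xi> \<in> V \<longrightarrow>
              vf_apply (commutator X I) (\<lambda>\<xi>. f (\<Theta> \<eta> \<xi>)) \<xi> =
              vf_apply (commutator Y I) f (\<Theta> \<eta> \<xi>) + vf_apply (R \<eta> I) f (\<Theta> \<eta> \<xi>))))"
proof (intro exI conjI)
  \<comment> \<open>The witnesses left open above are supplied by the goals below: the remainder is
    \<open>coord \<eta> I u - commutator Y I u\<close>, on the part of \<open>W\<close> where u lies
    in the domain of Y.\<close>
  have "open (snd -` U :: ((real^'p) \<times> (real^'p)) set)"
    by (rule open_vimage[OF U(1)]) (auto intro: continuous_intros)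
  then show "open (W \<inter> {w. snd w \<in> U})"
    using W by (auto simp: vimage_def)
  show "\<forall>\<eta>\<in>\<Omega>. (\<eta>, 0) \<in> W \<inter> {w. snd w \<in> U}" using zero_in_slice U by auto
  show "\<forall>I\<in>multiindices n. smooth_on (W \<inter> {w. snd w \<in> U}) (\<lambda>(\<eta>, u). coord \<eta> I u - commutator Y I u)"
    using smooth_on_remainder by blast
  show "\<forall>\<eta>\<in>\<Omega>. \<forall>I\<in>multiindices n. vf_weight_ge B (1 - int (wt I)) (\<lambda>u. coord \<eta> I u - commutator Y I u)"
    using remainder_weight by blast
  show "\<forall>\<eta>\<in>\<Omega>. \<exists>N. open N \<and> \<eta> \<in> N \<and> N \<subseteq> \<Omega> \<and>
        (\<forall>I\<in>multiindices n. \<forall>(f :: real^'p \<Rightarrow> real) V. open V \<and> 0 \<in> V \<and> smooth_on V f \<longrightarrow>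
           (\<forall>\<xi>\<in>N. \<Theta> \<eta> \<xi> \<in> V \<longrightarrow>
              vf_apply (commutator X I) (\<lambda>\<xi>. f (\<Theta> \<eta> \<xi>)) \<xi> =
              vf_apply (commutator Y I) f (\<Theta> \<eta> \<xi>) + vf_apply (\<lambda>u. coord \<eta> I u - commutator Y I u) f (\<Theta> \<eta> \<xi>)))"
  proof
    fix \<eta> assume \<eta>: "\<eta> \<in> \<Omega>"
    show "\<exists>N. open N \<and> \<eta> \<in> N \<and> N \<subseteq> \<Omega> \<and>
        (\<forall>I\<in>multiindices n. \<forall>(f :: real^'p \<Rightarrow> real) V. open V \<and> 0 \<in> V \<and> smooth_on V f \<longrightarrow>
           (\<forall>\<xi>\<in>N. \<Theta> \<eta> \<xi> \<in> V \<longrightarrow>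
              vf_apply (commutator X I) (\<lambda>\<xi>. f (\<Theta> \<eta> \<xi>)) \<xi> =
              vf_apply (commutator Y I) f (\<Theta> \<eta> \<xi>) + vf_apply (\<lambda>u. coord \<eta> I u - commutator Y I u) f (\<Theta> \<eta> \<xi>)))"
      using open_slice[OF N(1)] N(2,3) \<eta> lift_identity
      by (intro exI[of _ "{\<xi>. (\<eta>, \<xi>) \<in> N}"] conjI) auto
  qed
qed

end

end

text \<open>Smooth dependence on \<eta> is joint smoothness in (\<eta>, u) near the points (\<eta>,
  0). The neighbourhood of \<eta> is chosen before I and f; the condition that \<Theta>(\<eta>,
  \<xi>) lie in V keeps the point in the domain of f.\<close>

theorem theorem12:
  fixes \<Omega> :: "(real^'p) set"
    and X :: "nat \<Rightarrow> real^'p \<Rightarrow> real^'p"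
    and n r :: nat
    and B :: "'p \<Rightarrow> nat list"
    and \<Theta> :: "real^'p \<Rightarrow> real^'p \<Rightarrow> real^'p"
  assumes "open \<Omega>" and "connected \<Omega>"
    and "\<And>i. i \<le> n \<Longrightarrow> smooth_on \<Omega> (X i)"
    and "free_up_to n r \<Omega> X"
    and "hoermander n r \<Omega> X"
    and "basis_multiindices n r \<Omega> X B"
    and "canonical_coordinates \<Omega> X B \<Theta>"
  shows
    "(\<forall>I\<in>multiindices n. \<forall>\<eta>\<in>\<Omega>. vf_weight_ge_at \<Theta> B \<eta> (- int (wt I)) (commutator X I)) \<and>
     (\<forall>(Y :: nat \<Rightarrow> real^'p \<Rightarrow> real^'p) U.
        open U \<and> 0 \<in> U \<and> (\<forall>i\<le>n. smooth_on U (Y i)) \<and>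
        (\<forall>u\<in>U. (\<Sum>j\<in>UNIV. u $ j *\<^sub>R axis j 1) = (\<Sum>j\<in>UNIV. u $ j *\<^sub>R commutator Y (B j) u)) \<longrightarrow>
        (\<forall>I\<in>multiindices n. \<forall>\<eta>\<in>\<Omega>. \<exists>X'.
           in_coordinates (\<Theta> \<eta>) \<eta> (commutator X I) X' \<and>
           vf_weight_ge B (1 - int (wt I)) (\<lambda>u. X' u - commutator Y I u)) \<and>
        (\<exists>(R :: real^'p \<Rightarrow> nat list \<Rightarrow> real^'p \<Rightarrow> real^'p) W.
           open W \<and> (\<forall>\<eta>\<in>\<Omega>. (\<eta>, 0) \<in> W) \<and>
           (\<forall>I\<in>multiindices n. smooth_on W (\<lambda>(\<eta>, u). R \<eta> I u)) \<and>
           (\<forall>\<eta>\<in>\<Omega>. \<forall>I\<in>multiindices n. vf_weight_ge B (1 - int (wt I)) (R \<eta> I)) \<and>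
           (\<forall>\<eta>\<in>\<Omega>. \<exists>N. open N \<and> \<eta> \<in> N \<and> N \<subseteq> \<Omega> \<and>
              (\<forall>I\<in>multiindices n. \<forall>(f :: real^'p \<Rightarrow> real) V. open V \<and> 0 \<in> V \<and> smooth_on V f \<longrightarrow>
                 (\<forall>\<xi>\<in>N. \<Theta> \<eta> \<xi> \<in> V \<longrightarrow>
                    vf_apply (commutator X I) (\<lambda>\<xi>. f (\<Theta> \<eta> \<xi>)) \<xi> =
                    vf_apply (commutator Y I) f (\<Theta> \<eta> \<xi>) + vf_apply (R \<eta> I) f (\<Theta> \<eta> \<xi>)))))) "
proof (cases "\<Omega> = {}")
  case True
  have "smooth_on UNIV (\<lambda>(\<eta> :: real^'p, u :: real^'p). 0 :: real^'p)"
    using smooth_on_const[of UNIV "0 :: real^'p"] by (simp add: case_prod_unfold)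
  then show ?thesis
    unfolding True by (intro conjI allI impI exI[of _ "\<lambda>_ _ _. 0"] exI[of _ UNIV]) auto
next
  case False
  \<comment> \<open>One point is enough to extract the structure constants from freeness; this is
    why the empty domain was treated apart.\<close>
  then obtain x where x: "x \<in> \<Omega>" by blast
  obtain c :: "nat list \<Rightarrow> 'p \<Rightarrow> real" and b :: "'p \<Rightarrow> 'p \<Rightarrow> 'p \<Rightarrow> real"
    where c: "\<And>I j. c I j \<noteq> 0 \<Longrightarrow> wt (B j) = wt I"
      "\<And>S (Y :: nat \<Rightarrow> real^'p \<Rightarrow> real^'p) I u. open S \<Longrightarrow> (\<And>i. i \<le> n \<Longrightarrow> smooth_on S (Y i)) \<Longrightarrow> u \<in> S \<Longrightarrow>
        I \<in> multiindices n \<Longrightarrow> wt I \<le> r \<Longrightarrow> commutator Y I u = (\<Sum>j\<in>UNIV. c I j *\<^sub>R commutator Y (B j) u)"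
      and b: "\<And>j k l. b j k l \<noteq> 0 \<Longrightarrow> wt (B l) = wt (B j) + wt (B k)"
      "\<And>S (Y :: nat \<Rightarrow> real^'p \<Rightarrow> real^'p) j k u. open S \<Longrightarrow> (\<And>i. i \<le> n \<Longrightarrow> smooth_on S (Y i)) \<Longrightarrow> u \<in> S \<Longrightarrow>
        wt (B j) + wt (B k) \<le> r \<Longrightarrow>
        lie_bracket (commutator Y (B j)) (commutator Y (B k)) u = (\<Sum>l\<in>UNIV. b j k l *\<^sub>R commutator Y (B l) u)"
    using free_system_structure[OF assms(4,6) x] by blast
  obtain N G W where chart: "open N" "N \<subseteq> \<Omega> \<times> \<Omega>" "\<And>\<eta>. \<eta> \<in> \<Omega> \<Longrightarrow> (\<eta>, \<eta>) \<in> N" "smooth_on N (\<lambda>(\<eta>, \<xi>). \<Theta> \<eta> \<xi>)"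
    "open W" "smooth_on W G"
    "\<And>\<eta> \<xi>. (\<eta>, \<xi>) \<in> N \<Longrightarrow> (\<eta>, \<Theta> \<eta> \<xi>) \<in> W \<and> G (\<eta>, \<Theta> \<eta> \<xi>) = \<xi>"
    "\<And>\<eta> u. (\<eta>, u) \<in> W \<Longrightarrow> (\<eta>, G (\<eta>, u)) \<in> N \<and> \<Theta> \<eta> (G (\<eta>, u)) = u"
    "\<And>\<eta>. \<eta> \<in> \<Omega> \<Longrightarrow> \<Theta> \<eta> \<eta> = 0"
    "\<And>\<eta>. \<eta> \<in> \<Omega> \<Longrightarrow> \<exists>e>0. \<forall>u\<in>ball 0 e. (\<eta>, u) \<in> W \<and>
      is_exp \<Omega> (\<lambda>x. \<Sum>j\<in>UNIV. u $ j *\<^sub>R commutator X (B j) x) \<eta> (G (\<eta>, u))"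
    by (rule canonical_coordinates_inverse[OF assms(1,7)]) (rule that)
  have B: "B j \<in> multiindices n" "wt (B j) \<le> r" for j
    using assms(6) by (auto simp: basis_multiindices_def)
  interpret canonical_chart \<Omega> X n r B \<Theta> N W G c b
    by (rule canonical_chart.intro) (fact assms(1) | fact assms(3) | fact B | fact chart | fact c | fact b)+
  show ?thesis
  proof (intro conjI ballI allI impI)
    fix I \<eta> assume "I \<in> multiindices n" "\<eta> \<in> \<Omega>"
    then show "vf_weight_ge_at \<Theta> B \<eta> (- int (wt I)) (commutator X I)"
      unfolding vf_weight_ge_at_def using in_coordinates_coord coord_weight by blast
  next
    fix Y :: "nat \<Rightarrow> real^'p \<Rightarrow> real^'p" and U I \<eta>
    assume Y: "open U \<and> 0 \<in> U \<and> (\<forall>i\<le>n. smooth_on U (Y i)) \<and>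
      (\<forall>u\<in>U. (\<Sum>j\<in>UNIV. u $ j *\<^sub>R axis j 1) = (\<Sum>j\<in>UNIV. u $ j *\<^sub>R commutator Y (B j) u))"
      and I: "I \<in> multiindices n" and \<eta>: "\<eta> \<in> \<Omega>"
    have "vf_weight_ge B (1 - int (wt I)) (\<lambda>u. coord \<eta> I u - commutator Y I u)"
      by (rule remainder_weight[of U Y, OF _ _ _ _ \<eta> I]) (use Y in \<open>auto simp: sum_axis\<close>)
    then show "\<exists>X'. in_coordinates (\<Theta> \<eta>) \<eta> (commutator X I) X' \<and>
        vf_weight_ge B (1 - int (wt I)) (\<lambda>u. X' u - commutator Y I u)"
      using in_coordinates_coord[OF \<eta>] by blast
  next
    fix Y :: "nat \<Rightarrow> real^'p \<Rightarrow> real^'p" and U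
    assume Y: "open U \<and> 0 \<in> U \<and> (\<forall>i\<le>n. smooth_on U (Y i)) \<and>
      (\<forall>u\<in>U. (\<Sum>j\<in>UNIV. u $ j *\<^sub>R axis j 1) = (\<Sum>j\<in>UNIV. u $ j *\<^sub>R commutator Y (B j) u))"
    show "\<exists>(R :: real^'p \<Rightarrow> nat list \<Rightarrow> real^'p \<Rightarrow> real^'p) W.
           open W \<and> (\<forall>\<eta>\<in>\<Omega>. (\<eta>, 0) \<in> W) \<and>
           (\<forall>I\<in>multiindices n. smooth_on W (\<lambda>(\<eta>, u). R \<eta> I u)) \<and>
           (\<forall>\<eta>\<in>\<Omega>. \<forall>I\<in>multiindices n. vf_weight_ge B (1 - int (wt I)) (R \<eta> I)) \<and>
           (\<forall>\<eta>\<in>\<Omega>. \<exists>N. open N \<and> \<eta> \<in> N \<and> N \<subseteq> \<Omega> \<and>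
              (\<forall>I\<in>multiindices n. \<forall>(f :: real^'p \<Rightarrow> real) V. open V \<and> 0 \<in> V \<and> smooth_on V f \<longrightarrow>
                 (\<forall>\<xi>\<in>N. \<Theta> \<eta> \<xi> \<in> V \<longrightarrow>
                    vf_apply (commutator X I) (\<lambda>\<xi>. f (\<Theta> \<eta> \<xi>)) \<xi> =
                    vf_apply (commutator Y I) f (\<Theta> \<eta> \<xi>) + vf_apply (R \<eta> I) f (\<Theta> \<eta> \<xi>))))"
      by (rule lifting[of U Y]) (use Y in \<open>auto simp: sum_axis\<close>)
  qed
qed

end
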